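(* Let $K$ be a Galois number field of odd prime degree $\ell$ and conductor $f$ with $(f,\ell)=1$, and let $\chi$ be a primitive Dirichlet character modulo $f$ of order $\ell$. Denote by $q_1<q_2$ the two smallest rational primes that are inert in $K$. Suppose that there exists $r\in\mathbb{Z}^+$ with $$(r,q_1q_2)=1,\qquad \chi(r)=\chi(q_2)^{-1},$$ such that any of the following conditions hold: (1) $r q_2 k\not\equiv f\pmod{q_1^2}$ for all $k=1,\dots,q_1-1$, and $(q_1-1)(q_2 r-1)\leq f$; (2) $q_1\neq 2,3$ and $3q_1q_2 r\log q_1<f$; (3) $q_1\neq 2,3,7$ and $2.1\,q_1q_2 r\log q_1<f$; (4) $q_1=2$, $q_2\neq 3$, and $3q_2 r<f$; (5) $q_1=3$, $q_2\neq 5$, and $5q_2 r<f$. Then $K$ is not norm-Euclidean.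
   Context: A number field $K$ with ring of integers $\mathcal{O}_K$ and absolute norm $N=N_{K/\mathbb{Q}}$ is called norm-Euclidean if for every $\alpha,\beta\in\mathcal{O}_K$ with $\beta\neq 0$ there exists $\gamma\in\mathcal{O}_K$ such that $|N(\alpha-\gamma\beta)|<|N(\beta)|$. A Galois number field is a number field that is Galois over $\mathbb{Q}$. The conductor of an abelian number field $K$ is the smallest positive integer $f$ such that $K\subseteq\mathbb{Q}(\zeta_f)$. Here $(a,b)$ denotes the greatest common divisor and $\log$ is the natural logarithm. *)

theory Defs
  imports Complex_Main
    "HOL-Number_Theory.Number_Theory"
    "HOL-Algebra.Algebra"
    "HOL-Algebra.Algebraic_Closure_Type"
begin

hide_const (open) Divisibility.prime

text \<open>
  Number fields are taken to be subfields of the complex numbers, so that the inclusion of an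
  abelian field in a cyclotomic field is an inclusion of sets.
\<close>

abbreviation complex_ring :: "complex ring" where
  "complex_ring \<equiv> ring_of_type_algebra"

abbreviation field_ring :: "complex set \<Rightarrow> complex ring" where
  "field_ring K \<equiv> complex_ring\<lparr>carrier := K\<rparr>"

text \<open>The library's dimension predicate includes finite-dimensionality.\<close>

definition number_field_of_degree :: "complex set \<Rightarrow> nat \<Rightarrow> bool" where
  "number_field_of_degree K n \<longleftrightarrow>
     subfield K complex_ring \<and> ring.dimension complex_ring n \<rat> K"

text \<open>The fixed field of the automorphism group; a field automorphism fixes the rationals.\<close>

definition galois_over_rat :: "complex set \<Rightarrow> bool" where
  "galois_over_rat K \<longleftrightarrow>
     {x \<in> K. \<forall>\<sigma> \<in> ring_iso (field_ring K) (field_ring K). \<sigma> x = x} = \<rat>"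

definition integer_ring :: "complex set \<Rightarrow> complex set" where
  "integer_ring K = {x \<in> K. algebraic_int x}"

text \<open>
  Intersecting with the extensional functions makes each embedding count exactly once, since
  ring_hom says nothing about values outside the carrier.
\<close>

definition embeddings :: "complex set \<Rightarrow> (complex \<Rightarrow> complex) set" where
  "embeddings K = ring_hom (field_ring K) complex_ring \<inter> extensional K"

definition field_norm :: "complex set \<Rightarrow> complex \<Rightarrow> complex" where
  "field_norm K x = (\<Prod>\<sigma>\<in>embeddings K. \<sigma> x)"

definition norm_euclidean :: "complex set \<Rightarrow> bool" where
  "norm_euclidean K \<longleftrightarrow>
     (\<forall>\<alpha>\<in>integer_ring K. \<forall>\<beta>\<in>integer_ring K. \<beta> \<noteq> 0 \<longrightarrow>
        (\<exists>\<gamma>\<in>integer_ring K. cmod (field_norm K (\<alpha> - \<gamma> * \<beta>)) < cmod (field_norm K \<beta>)))"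

definition inert :: "complex set \<Rightarrow> nat \<Rightarrow> bool" where
  "inert K p \<longleftrightarrow> prime p \<and>
     primeideal (PIdl\<^bsub>field_ring (integer_ring K)\<^esub> (of_nat p)) (field_ring (integer_ring K))"

definition two_smallest_inert :: "complex set \<Rightarrow> nat \<Rightarrow> nat \<Rightarrow> bool" where
  "two_smallest_inert K q1 q2 \<longleftrightarrow>
     inert K q1 \<and> inert K q2 \<and> q1 < q2 \<and> (\<forall>p. inert K p \<longrightarrow> p = q1 \<or> q2 \<le> p)"

definition cyclotomic_field :: "nat \<Rightarrow> complex set" where
  "cyclotomic_field n = generate_field complex_ring {cis (2 * pi / real n)}"

definition has_conductor :: "complex set \<Rightarrow> nat \<Rightarrow> bool" where
  "has_conductor K f \<longleftrightarrow>
     f > 0 \<and> K \<subseteq> cyclotomic_field f \<and> (\<forall>m>0. K \<subseteq> cyclotomic_field m \<longrightarrow> f \<le> m)"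

definition dirichlet_character :: "nat \<Rightarrow> (int \<Rightarrow> complex) \<Rightarrow> bool" where
  "dirichlet_character f chi \<longleftrightarrow> f > 0 \<and>
     (\<forall>m n. chi (m * n) = chi m * chi n) \<and>
     (\<forall>n. chi (n + int f) = chi n) \<and>
     (\<forall>n. chi n \<noteq> 0 \<longleftrightarrow> coprime n (int f))"

definition primitive_dirichlet_character :: "nat \<Rightarrow> (int \<Rightarrow> complex) \<Rightarrow> bool" where
  "primitive_dirichlet_character f chi \<longleftrightarrow> dirichlet_character f chi \<and>
     \<not> (\<exists>d \<psi>. d dvd f \<and> d < f \<and> dirichlet_character d \<psi> \<and>
           (\<forall>n. coprime n (int f) \<longrightarrow> chi n = \<psi> n))"

text \<open>
  The order in the group of characters modulo f, whose identity is the principal character.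
\<close>

definition character_order :: "nat \<Rightarrow> (int \<Rightarrow> complex) \<Rightarrow> nat" where
  "character_order f chi = (LEAST k. k > 0 \<and> (\<forall>n. coprime n (int f) \<longrightarrow> chi n ^ k = 1))"

end

(*
  Genus theory first shows that the conductor of a norm-Euclidean K is prime: every prime p
  dividing f is totally ramified in K, generated by some w with sigma(w)/w a unit, and for two such
  primes these units would be independent modulo (sigma - 1)-images of units; since the units of
  norm 1 have logarithmic rank at most l - 1, comparing the number of units of bounded height
  with that rank rules this out. Primality of f is also what makes chi a character of K, a relation
  that is not among the hypotheses.

  For f prime, norms from K are l-th powers modulo f. Dividing c by w, where c^l = a modulo f,
  gives Heilbronn's criterion: if f = a + b with a, b > 0 and chi(a) = 1, then a or b is up to sign
  the norm of an integer of K. A norm divisible by an inert prime q is divisible by q^l, so it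
  suffices to find a = r q2 k with chi(k) = 1 such that q2 divides a and q1 divides f - a exactly
  once. Any k with prime factors below q1 has chi(k) = 1; if the residue k0 of f/(r q2) modulo q1
  fails modulo q1^2, replace it by n k' with n the least non-divisor of k0 and k' = k0/n modulo q1.
  As lcm(1, ..., n - 1) divides k0 < q1, n is logarithmic in q1.
*)
theory Submission
  imports Defs "HOL-Analysis.Complex_Transcendental" "HOL-Analysis.Harmonic_Numbers"
    "Jordan_Normal_Form.Char_Poly"
begin

section \<open>Algebraic integers and polynomials over subfields of the complex numbers\<close>

text \<open>That K is norm-Euclidean is used well beyond Heilbronn's criterion: it makes ideals
  principal, so primes of K appear as generators and factorizations are read off from integer norms.
  Total ramification rests on the minimality of f = p m: some automorphism of Q(zeta_f) over
  Q(zeta_m) moves K, yet it is trivial modulo 1 - zeta_p; as l is prime, its restriction generates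
  the Galois group. That l is prime to f enters twice: dividing the trace by l shows that integers
  of K are rational modulo the ramified prime, and a character of order l cannot be primitive modulo
  a multiple of p^2 with p different from l. For inertness one implication carries the argument:
  above a prime p other than f that is not inert there is an ideal of norm p^j with 0 < j < l, and
  evaluating chi on norms forces chi(p)^j = 1. The unit argument regards units of norm 1 as a module
  over Z[zeta_l], sigma - 1 acting as the prime zeta_l - 1. Two ramified primes give l^2 classes
  modulo this prime, where a lattice of rank at most l - 1 allows only l.\<close>

lemma algebraic_int_eigenvalue:
  fixes x :: complex and A :: "'a \<Rightarrow> 'a \<Rightarrow> int" and v :: "'a \<Rightarrow> complex"
  assumes fin: "finite I" and nz: "\<exists>i\<in>I. v i \<noteq> 0"
    and ev: "\<And>i. i \<in> I \<Longrightarrow> x * v i = (\<Sum>j\<in>I. of_int (A i j) * v j)"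
  shows "algebraic_int x"
proof -
  define n where "n = card I"
  obtain h where h: "bij_betw h {0..<n} I"
    using ex_bij_betw_nat_finite[OF fin] unfolding n_def by blast
  define M :: "int mat" where "M = mat n n (\<lambda>(i, j). A (h i) (h j))"
  define C :: "complex mat" where "C = map_mat of_int M"
  have M: "M \<in> carrier_mat n n" unfolding M_def by simp
  have C: "C \<in> carrier_mat n n" unfolding C_def using M by simp
  define w where "w = vec n (v \<circ> h)"
  have "w \<noteq> 0\<^sub>v n"
  proof
    assume 0: "w = 0\<^sub>v n"
    obtain i where i: "i \<in> I" "v i \<noteq> 0" using nz by blast
    then obtain k where k: "k < n" "h k = i" using h unfolding bij_betw_def by force
    have "vec_index w k = v i" using k unfolding w_def by simp
    thus False using 0 k i by simp
  qed
  moreover have "C *\<^sub>v w = x \<cdot>\<^sub>v w"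
  proof (rule eq_vecI)
    show "dim_vec (C *\<^sub>v w) = dim_vec (x \<cdot>\<^sub>v w)" using C unfolding w_def by simp
    fix k assume "k < dim_vec (x \<cdot>\<^sub>v w)"
    hence k: "k < n" unfolding w_def by simp
    have hk: "h k \<in> I" using h k unfolding bij_betw_def by force
    have "vec_index (C *\<^sub>v w) k = (\<Sum>j = 0..<n. of_int (A (h k) (h j)) * v (h j))"
      using C k unfolding w_def C_def M_def by (simp add: scalar_prod_def)
    also have "\<dots> = (\<Sum>j\<in>I. of_int (A (h k) j) * v j)"
      by (rule sum.reindex_bij_betw[OF h])
    also have "\<dots> = x * v (h k)" using ev[OF hk] by simp
    finally show "vec_index (C *\<^sub>v w) k = vec_index (x \<cdot>\<^sub>v w) k" using k unfolding w_def by simp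
  qed
  ultimately have "eigenvalue C x"
    unfolding eigenvalue_def eigenvector_def using C by (auto simp: w_def intro!: exI[of _ w])
  hence "poly (char_poly C) x = 0" using eigenvalue_root_char_poly[OF C] by simp
  moreover have "char_poly C = map_poly of_int (char_poly M)"
    unfolding C_def by (rule of_int_hom.char_poly_hom[OF M])
  moreover have "lead_coeff (char_poly M) = 1"
    using degree_monic_char_poly[OF M] by simp
  ultimately show ?thesis unfolding algebraic_int_altdef_ipoly by metis
qed

lemma algebraic_int_power_sum:
  fixes x :: complex
  assumes "algebraic_int x"
  obtains m :: nat and c :: "nat \<Rightarrow> int"
  where "m > 0" "x ^ m = (\<Sum>i<m. of_int (c i) * x ^ i)"
proof -
  obtain p :: "int poly" where p: "poly (map_poly of_int p) x = 0" "lead_coeff p = 1"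
    using assms unfolding algebraic_int_altdef_ipoly by blast
  define m where "m = degree p"
  have deg: "degree (map_poly of_int p :: complex poly) = m" unfolding m_def by simp
  have "0 = (\<Sum>i\<le>m. of_int (coeff p i) * x ^ i)"
    using p(1) unfolding poly_altdef deg by simp
  also have "\<dots> = x ^ m + (\<Sum>i<m. of_int (coeff p i) * x ^ i)"
    using p(2) unfolding m_def by (simp add: lessThan_Suc_atMost[symmetric])
  finally have eq: "x ^ m = (\<Sum>i<m. of_int (- coeff p i) * x ^ i)"
    by (simp add: sum_negf eq_neg_iff_add_eq_0)
  moreover have "m > 0"
  proof (rule ccontr)
    assume "\<not> m > 0"
    thus False using eq by simp
  qed
  ultimately show thesis using that[of m "\<lambda>i. - coeff p i"] by blast
qed

text \<open>\<open>A\<close> is the companion matrix of an integral equation for x, acting on the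
  powers of x.\<close>

lemma algebraic_int_power_matrix:
  fixes x :: complex
  assumes "algebraic_int x"
  obtains m :: nat and A :: "nat \<Rightarrow> nat \<Rightarrow> int"
  where "m > 0" "\<And>i. i < m \<Longrightarrow> x * x ^ i = (\<Sum>j<m. of_int (A i j) * x ^ j)"
proof -
  obtain m :: nat and c :: "nat \<Rightarrow> int"
    where m: "m > 0" and c: "x ^ m = (\<Sum>i<m. of_int (c i) * x ^ i)"
    using algebraic_int_power_sum[OF assms] by blast
  define A where "A = (\<lambda>i j. if Suc i < m then (if j = Suc i then 1 else 0) else c j)"
  have "x * x ^ i = (\<Sum>j<m. of_int (A i j) * x ^ j)" if i: "i < m" for i
  proof (cases "Suc i < m")
    case True
    have "(\<Sum>j<m. of_int (A i j) * x ^ j) = (\<Sum>j<m. if j = Suc i then x ^ j else 0)"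
      using True by (intro sum.cong) (auto simp: A_def)
    also have "\<dots> = x ^ Suc i" using True by simp
    finally show ?thesis by simp
  next
    case False
    hence "Suc i = m" using i by simp
    thus ?thesis using c False unfolding A_def by (auto simp flip: power_Suc)
  qed
  thus thesis using that m by blast
qed

text \<open>The products x^i y^j span a lattice stable under x and y, so x * y and x + y are
  eigenvalues of integer matrices: a Kronecker product and a Kronecker sum, with \<open>D\<close> as
  identity matrix.\<close>

lemma
  fixes x y :: complex
  assumes x: "algebraic_int x" and y: "algebraic_int y"
  shows algebraic_int_add [intro]: "algebraic_int (x + y)"
    and algebraic_int_mult [intro]: "algebraic_int (x * y)"
proof -
  obtain m A where m: "m > 0" and A: "\<And>i. i < m \<Longrightarrow> x * x ^ i = (\<Sum>j<m. of_int (A i j) * x ^ j)"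
    using algebraic_int_power_matrix[OF x] by blast
  obtain n B where n: "n > 0" and B: "\<And>i. i < n \<Longrightarrow> y * y ^ i = (\<Sum>j<n. of_int (B i j) * y ^ j)"
    using algebraic_int_power_matrix[OF y] by blast
  define D :: "nat \<Rightarrow> nat \<Rightarrow> int" where "D = (\<lambda>i j. if j = i then 1 else 0)"
  have D: "z ^ i = (\<Sum>j<k. of_int (D i j) * z ^ j)" if "i < k" for i k and z :: complex
  proof -
    have "(\<Sum>j<k. of_int (D i j) * z ^ j) = (\<Sum>j<k. if j = i then z ^ j else 0)"
      by (intro sum.cong) (auto simp: D_def)
    thus ?thesis using that by simp
  qed
  define I where "I = {..<m} \<times> {..<n}"
  define v where "v = (\<lambda>(i, j). x ^ i * y ^ j)"
  have fin: "finite I" unfolding I_def by simp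
  have nz: "\<exists>i\<in>I. v i \<noteq> 0"
    by (rule bexI[of _ "(0, 0)"]) (use m n in \<open>auto simp: v_def I_def\<close>)
  have prod: "(\<Sum>j<m. of_int (P j) * x ^ j) * (\<Sum>k<n. of_int (Q k) * y ^ k)
      = (\<Sum>q\<in>I. of_int (P (fst q) * Q (snd q)) * v q)" for P Q :: "nat \<Rightarrow> int"
    unfolding I_def v_def sum_product sum.cartesian_product
    by (intro sum.cong) (auto simp: mult_ac)
  show "algebraic_int (x * y)"
  proof (rule algebraic_int_eigenvalue[OF fin nz])
    fix p assume "p \<in> I"
    then obtain i j where p: "p = (i, j)" "i < m" "j < n" unfolding I_def by auto
    have "x * y * v p = (x * x ^ i) * (y * y ^ j)" unfolding p v_def by (simp add: mult_ac)
    also have "\<dots> = (\<Sum>q\<in>I. of_int (A (fst p) (fst q) * B (snd p) (snd q)) * v q)"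
      unfolding A[OF p(2)] B[OF p(3)] prod p by simp
    finally show "x * y * v p = (\<Sum>q\<in>I. of_int (A (fst p) (fst q) * B (snd p) (snd q)) * v q)" .
  qed
  show "algebraic_int (x + y)"
  proof (rule algebraic_int_eigenvalue[OF fin nz])
    fix p assume "p \<in> I"
    then obtain i j where p: "p = (i, j)" "i < m" "j < n" unfolding I_def by auto
    have "(x + y) * v p = (x * x ^ i) * y ^ j + x ^ i * (y * y ^ j)"
      unfolding p v_def by (simp add: algebra_simps)
    also have "\<dots> = (\<Sum>q\<in>I. of_int (A (fst p) (fst q) * D (snd p) (snd q)
        + D (fst p) (fst q) * B (snd p) (snd q)) * v q)"
      unfolding A[OF p(2)] B[OF p(3)]
      by (subst D[OF p(2)], subst D[OF p(3)])
         (simp add: prod p sum.distrib[symmetric] ring_distribs)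
    finally show "(x + y) * v p = (\<Sum>q\<in>I. of_int (A (fst p) (fst q) * D (snd p) (snd q)
        + D (fst p) (fst q) * B (snd p) (snd q)) * v q)" .
  qed
qed

lemma algebraic_int_of_int [simp, intro]: "algebraic_int (of_int n :: complex)"
  by (intro int_imp_algebraic_int) auto

lemma algebraic_int_of_nat [simp, intro]: "algebraic_int (of_nat n :: complex)"
  by (intro int_imp_algebraic_int) auto

lemma algebraic_int_diff [intro]:
  fixes x y :: complex
  shows "algebraic_int x \<Longrightarrow> algebraic_int y \<Longrightarrow> algebraic_int (x - y)"
  using algebraic_int_add[of x "- y"] by auto

lemma algebraic_int_power [intro]:
  fixes x :: complex
  shows "algebraic_int x \<Longrightarrow> algebraic_int (x ^ n)"
  by (induction n) auto

lemma algebraic_int_prod [intro]: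
  fixes g :: "'a \<Rightarrow> complex"
  shows "(\<And>i. i \<in> I \<Longrightarrow> algebraic_int (g i)) \<Longrightarrow> algebraic_int (prod g I)"
  by (induction I rule: infinite_finite_induct) (auto intro: int_imp_algebraic_int)

section \<open>Polynomials over a subfield of the complex numbers\<close>

definition polys_over :: "complex set \<Rightarrow> complex poly set" where
  "polys_over S = {p. \<forall>i. coeff p i \<in> S}"

text \<open>Closure conditions on a plain set avoid ring records. Because inverse 0 = 0, closure
  under inverses needs no side condition.\<close>

locale complex_subfield =
  fixes S :: "complex set"
  assumes zero_closed [simp, intro]: "0 \<in> S"
    and one_closed [simp, intro]: "1 \<in> S"
    and add_closed [intro]: "x \<in> S \<Longrightarrow> y \<in> S \<Longrightarrow> x + y \<in> S"
    and mult_closed [intro]: "x \<in> S \<Longrightarrow> y \<in> S \<Longrightarrow> x * y \<in> S"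
    and uminus_closed [intro]: "x \<in> S \<Longrightarrow> - x \<in> S"
    and inverse_closed [intro]: "x \<in> S \<Longrightarrow> inverse x \<in> S"
begin

lemma diff_closed [intro]: "x \<in> S \<Longrightarrow> y \<in> S \<Longrightarrow> x - y \<in> S"
  using add_closed[of x "- y"] uminus_closed by simp

lemma divide_closed [intro]: "x \<in> S \<Longrightarrow> y \<in> S \<Longrightarrow> x / y \<in> S"
  using mult_closed[of x "inverse y"] inverse_closed by (simp add: divide_inverse)

lemma power_closed [intro]: "x \<in> S \<Longrightarrow> x ^ n \<in> S"
  by (induction n) auto

lemma sum_closed [intro]: "(\<And>i. i \<in> I \<Longrightarrow> g i \<in> S) \<Longrightarrow> sum g I \<in> S"
  by (induction I rule: infinite_finite_induct) auto

lemma prod_closed [intro]: "(\<And>i. i \<in> I \<Longrightarrow> g i \<in> S) \<Longrightarrow> prod g I \<in> S"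
  by (induction I rule: infinite_finite_induct) auto

lemma of_nat_closed [simp, intro]: "of_nat n \<in> S"
  by (induction n) auto

lemma of_int_closed [simp, intro]: "of_int n \<in> S"
  by (cases n) auto

lemma Rats_closed: "\<rat> \<subseteq> S"
  by (auto elim!: Rats_cases')

lemma polys_over_0 [simp]: "0 \<in> polys_over S"
  and polys_over_1 [simp]: "1 \<in> polys_over S"
  and polys_over_const: "c \<in> S \<Longrightarrow> [:c:] \<in> polys_over S"
  by (auto simp: polys_over_def coeff_pCons split: nat.splits)

lemma polys_over_pCons: "c \<in> S \<Longrightarrow> p \<in> polys_over S \<Longrightarrow> pCons c p \<in> polys_over S"
  by (auto simp: polys_over_def coeff_pCons split: nat.splits)

lemma polys_over_X [simp]: "[:0, 1:] \<in> polys_over S"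
  by (auto simp: polys_over_def coeff_pCons split: nat.splits)

lemma polys_over_add: "p \<in> polys_over S \<Longrightarrow> q \<in> polys_over S \<Longrightarrow> p + q \<in> polys_over S"
  by (auto simp: polys_over_def)

lemma polys_over_uminus: "p \<in> polys_over S \<Longrightarrow> - p \<in> polys_over S"
  by (auto simp: polys_over_def)

lemma polys_over_diff: "p \<in> polys_over S \<Longrightarrow> q \<in> polys_over S \<Longrightarrow> p - q \<in> polys_over S"
  by (auto simp: polys_over_def)

lemma polys_over_mult: "p \<in> polys_over S \<Longrightarrow> q \<in> polys_over S \<Longrightarrow> p * q \<in> polys_over S"
  by (auto simp: polys_over_def coeff_mult intro!: sum_closed)

lemma polys_over_smult: "c \<in> S \<Longrightarrow> p \<in> polys_over S \<Longrightarrow> smult c p \<in> polys_over S"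
  by (auto simp: polys_over_def)

lemma polys_over_monom: "c \<in> S \<Longrightarrow> Polynomial.monom c n \<in> polys_over S"
  by (auto simp: polys_over_def)

lemma polys_over_pderiv: "p \<in> polys_over S \<Longrightarrow> pderiv p \<in> polys_over S"
  by (auto simp: polys_over_def coeff_pderiv intro!: mult_closed add_closed)

lemma coeff_polys_over: "p \<in> polys_over S \<Longrightarrow> coeff p i \<in> S"
  by (auto simp: polys_over_def)

lemmas polys_over_intros = polys_over_const polys_over_pCons polys_over_add polys_over_diff
  polys_over_uminus polys_over_mult polys_over_smult polys_over_monom polys_over_pderiv

lemma polys_over_division:
  assumes "a \<in> polys_over S" "b \<in> polys_over S" "b \<noteq> 0"
  shows "\<exists>q r. q \<in> polys_over S \<and> r \<in> polys_over S \<and> a = b * q + r \<and> (r = 0 \<or> degree r < degree b)"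
  using assms(1)
proof (induction "degree a" arbitrary: a rule: less_induct)
  case less
  show ?case
  proof (cases "a = 0 \<or> degree a < degree b")
    case True
    thus ?thesis by (intro exI[of _ 0] exI[of _ a]) (use less.prems in auto)
  next
    case False
    hence a0: "a \<noteq> 0" and deg: "degree b \<le> degree a" by auto
    define c where "c = lead_coeff a / lead_coeff b"
    define t where "t = Polynomial.monom c (degree a - degree b)"
    have c: "c \<in> S" unfolding c_def using less.prems assms(2) by (auto simp: coeff_polys_over)
    have c0: "c \<noteq> 0" unfolding c_def using a0 assms(3) by simp
    have t: "t \<in> polys_over S" unfolding t_def using c by (rule polys_over_monom)
    have t0: "t \<noteq> 0" unfolding t_def using c0 by simp
    have degbt: "degree (b * t) = degree a"
      using assms(3) t0 deg c0 by (simp add: degree_mult_eq t_def degree_monom_eq)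
    have "lead_coeff (b * t) = lead_coeff a"
      unfolding lead_coeff_mult t_def using assms(3) c0 by (simp add: degree_monom_eq c_def)
    hence co: "coeff (a - b * t) (degree a) = 0" using degbt by simp
    have a': "a - b * t \<in> polys_over S" using less.prems assms(2) t by (intro polys_over_intros)
    show ?thesis
    proof (cases "a - b * t = 0")
      case True
      thus ?thesis using t by (intro exI[of _ t] exI[of _ 0]) auto
    next
      case False
      have "degree (a - b * t) \<le> degree a" using degbt by (simp add: degree_diff_le)
      moreover have "degree (a - b * t) \<noteq> degree a"
        using co False by (metis leading_coeff_0_iff)
      ultimately have "degree (a - b * t) < degree a" by simp
      then obtain q r where qr: "q \<in> polys_over S" "r \<in> polys_over S" "a - b * t = b * q + r"
          "r = 0 \<or> degree r < degree b"
        using less.hyps a' by blast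
      have "a = b * (q + t) + r" using qr(3) by (simp add: algebra_simps)
      thus ?thesis using qr t polys_over_add by blast
    qed
  qed
qed

text \<open>Division inside S leaves a remainder that is a multiple of b of smaller degree, so it
  vanishes and the two quotients agree.\<close>

lemma polys_over_quotient:
  assumes "b * q \<in> polys_over S" "b \<in> polys_over S" "b \<noteq> 0"
  shows "q \<in> polys_over S"
proof -
  obtain q' r where qr: "q' \<in> polys_over S" "b * q = b * q' + r" "r = 0 \<or> degree r < degree b"
    using polys_over_division[OF assms] by blast
  have "r = b * (q - q')" using qr(2) by (simp add: algebra_simps)
  hence "q = q'" using qr(3) assms(3) by (metis degree_mult_right_le leD mult_eq_0_iff right_minus_eq)
  thus ?thesis using qr(1) by simp
qed

section \<open>Minimal polynomials, separability and simple extensions\<close>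

definition is_minpoly :: "complex \<Rightarrow> complex poly \<Rightarrow> bool" where
  "is_minpoly z m \<longleftrightarrow> m \<in> polys_over S \<and> lead_coeff m = 1 \<and> poly m z = 0 \<and>
     (\<forall>h\<in>polys_over S. poly h z = 0 \<longrightarrow> m dvd h)"

lemma ex_minpoly:
  assumes "h \<in> polys_over S" "h \<noteq> 0" "poly h z = 0"
  shows "\<exists>m. is_minpoly z m"
proof -
  define P where "P = (\<lambda>h. h \<in> polys_over S \<and> h \<noteq> 0 \<and> poly h z = 0)"
  define m0 where "m0 = arg_min degree P"
  have P0: "P m0" and min: "\<And>h. P h \<Longrightarrow> degree m0 \<le> degree h"
    using arg_min_nat_lemma[of P h degree] assms unfolding m0_def P_def by auto
  define m where "m = smult (inverse (lead_coeff m0)) m0"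
  have m: "m \<in> polys_over S" "lead_coeff m = 1" "poly m z = 0" "degree m = degree m0" "m \<noteq> 0"
    using P0 unfolding m_def P_def
    by (auto intro!: polys_over_intros intro: coeff_polys_over simp: lead_coeff_smult)
  have "m dvd h" if h: "h \<in> polys_over S" "poly h z = 0" for h
  proof -
    obtain q r where qr: "q \<in> polys_over S" "r \<in> polys_over S" "h = m * q + r"
        "r = 0 \<or> degree r < degree m"
      using polys_over_division[OF h(1) m(1) m(5)] by blast
    have "poly r z = 0" using qr(3) h(2) m(3) by simp
    hence "r = 0" using qr(2,4) m(4) min[of r] unfolding P_def by force
    thus ?thesis using qr(3) by simp
  qed
  thus ?thesis unfolding is_minpoly_def using m by blast
qed

lemma minpolyD:
  assumes "is_minpoly z m"
  shows "m \<in> polys_over S" "lead_coeff m = 1" "poly m z = 0" "m \<noteq> 0" "degree m > 0"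
    and "\<And>h. h \<in> polys_over S \<Longrightarrow> poly h z = 0 \<Longrightarrow> m dvd h"
proof -
  show *: "m \<in> polys_over S" "lead_coeff m = 1" "poly m z = 0" "m \<noteq> 0"
    "\<And>h. h \<in> polys_over S \<Longrightarrow> poly h z = 0 \<Longrightarrow> m dvd h"
    using assms unfolding is_minpoly_def by auto
  show "degree m > 0"
  proof (rule ccontr)
    assume "\<not> degree m > 0"
    then obtain c where "m = [:c:]" by (metis degree_eq_zeroE gr0I)
    thus False using * by simp
  qed
qed

lemma minpoly_irreducible:
  assumes m: "is_minpoly z m" and a: "a \<in> polys_over S" "m = a * b" and deg: "degree a > 0"
  shows "degree b = 0"
proof -
  have a0: "a \<noteq> 0" "b \<noteq> 0" using a(2) minpolyD(4)[OF m] by auto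
  have b: "b \<in> polys_over S" using polys_over_quotient[of a b] a minpolyD(1)[OF m] a0 by simp
  have degm: "degree m = degree a + degree b" using a0 unfolding a(2) by (simp add: degree_mult_eq)
  have "poly a z = 0 \<or> poly b z = 0" using minpolyD(3)[OF m] a(2) by simp
  thus ?thesis
  proof
    assume "poly a z = 0"
    hence "m dvd a" using minpolyD(6)[OF m] a by blast
    hence "degree m \<le> degree a" using a0 by (simp add: dvd_imp_degree_le)
    thus ?thesis using degm by simp
  next
    assume "poly b z = 0"
    hence "m dvd b" using minpolyD(6)[OF m] b by blast
    hence "degree m \<le> degree b" using a0 by (simp add: dvd_imp_degree_le)
    thus ?thesis using degm deg by simp
  qed
qed

text \<open>By irreducibility a root w of m has a minimal polynomial of the same degree as m. If w
  were multiple, that polynomial would divide the derivative of m, which is nonzero in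
  characteristic 0 and of smaller degree.\<close>

lemma rsquarefree_minpoly:
  assumes m: "is_minpoly z m"
  shows "rsquarefree m"
  unfolding rsquarefree_roots
proof (intro allI notI, elim conjE)
  fix w assume w: "poly m w = 0" "poly (pderiv m) w = 0"
  note mD = minpolyD[OF m]
  obtain m' where m': "is_minpoly w m'" using ex_minpoly[OF mD(1,4) w(1)] by blast
  note mD' = minpolyD[OF m']
  obtain b where b: "m = m' * b" using mD'(6)[OF mD(1) w(1)] by (elim dvdE)
  have "degree b = 0" using minpoly_irreducible[OF m mD'(1) b mD'(5)] .
  hence "degree m' = degree m" using b mD(4) by (auto simp: degree_mult_eq)
  moreover have "m' dvd pderiv m" by (rule mD'(6)) (use mD w in \<open>auto intro: polys_over_intros\<close>)
  moreover have "pderiv m \<noteq> 0" using mD(5) by (simp add: pderiv_eq_0_iff)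
  ultimately have "degree m \<le> degree (pderiv m)" by (metis dvd_imp_degree_le)
  thus False using mD(5) by (simp add: degree_pderiv)
qed

lemma card_roots_minpoly:
  assumes m: "is_minpoly z m"
  shows "card {w. poly m w = 0} = degree m"
proof -
  have "m = smult (lead_coeff m) (\<Prod>w|poly m w = 0. [:- w, 1:])"
    using complex_poly_decompose_rsquarefree[OF rsquarefree_minpoly[OF m]] by simp
  hence "degree m = degree (\<Prod>w|poly m w = 0. [:- w, 1:])"
    using minpolyD(2)[OF m] by simp
  also have "\<dots> = card {w. poly m w = 0}"
    by (subst degree_prod_sum_eq) auto
  finally show ?thesis by simp
qed

text \<open>By separability, a non-constant value at \<^term>\<open>z\<close> is moved by passing to a conjugate of
  \<^term>\<open>z\<close>: a polynomial of degree below that of the minimal polynomial cannot be constant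
  on all of its roots.\<close>

lemma ex_conjugate_value:
  assumes m: "is_minpoly z m" and g: "g \<in> polys_over S" and gz: "poly g z \<notin> S"
  shows "\<exists>w. poly m w = 0 \<and> poly g w \<noteq> poly g z"
proof (rule ccontr)
  assume "\<not> ?thesis"
  hence const: "\<And>w. poly m w = 0 \<Longrightarrow> poly g w = poly g z" by blast
  note mD = minpolyD[OF m]
  obtain q r where qr: "q \<in> polys_over S" "r \<in> polys_over S" "g = m * q + r"
      "r = 0 \<or> degree r < degree m"
    using polys_over_division[OF g mD(1,4)] by blast
  have r: "poly r w = poly g z" if "poly m w = 0" for w
    using const[OF that] that qr(3) by simp
  define s where "s = r - [:poly g z:]"
  have "s \<noteq> 0"
  proof
    assume "s = 0"
    hence "r = [:poly g z:]" unfolding s_def by simp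
    hence "coeff r 0 = poly g z" by simp
    thus False using gz qr(2) by (metis coeff_polys_over)
  qed
  have "degree s < degree m"
    using qr(4) mD(5) unfolding s_def by (auto intro!: degree_diff_less)
  moreover have "card {w. poly m w = 0} \<le> card {w. poly s w = 0}"
    using \<open>s \<noteq> 0\<close> r by (intro card_mono poly_roots_finite) (auto simp: s_def)
  moreover have "card {w. poly s w = 0} \<le> degree s"
    using \<open>s \<noteq> 0\<close> by (rule card_poly_roots_bound)
  ultimately show False using card_roots_minpoly[OF m] by simp
qed

definition adjoin :: "complex \<Rightarrow> complex set" where
  "adjoin z = {poly h z | h. h \<in> polys_over S}"

text \<open>Euclid's algorithm on m and h: the remainder r of m by h is nonzero at z by
  irreducibility, and poly r z is a multiple of poly h z, so an inverse of the former yields one of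
  the latter.\<close>

lemma adjoin_inverse_aux:
  assumes m: "is_minpoly z m" and "h \<in> polys_over S" "poly h z \<noteq> 0" "degree h < degree m"
  shows "\<exists>u\<in>polys_over S. poly u z * poly h z = 1"
  using assms(2-)
proof (induction "degree h" arbitrary: h rule: less_induct)
  case less
  note mD = minpolyD[OF m]
  have h0: "h \<noteq> 0" using less.prems by auto
  show ?case
  proof (cases "degree h = 0")
    case True
    then obtain c where c: "h = [:c:]" by (metis degree_eq_zeroE)
    hence "c \<in> S" using less.prems(1) by (metis coeff_polys_over coeff_pCons_0)
    thus ?thesis using c less.prems by (intro bexI[of _ "[:inverse c:]"]) (auto intro: polys_over_const)
  next
    case False
    obtain q r where qr: "q \<in> polys_over S" "r \<in> polys_over S" "m = h * q + r"
        "r = 0 \<or> degree r < degree h"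
      using polys_over_division[OF mD(1) less.prems(1) h0] by blast
    have rne: "poly r z \<noteq> 0"
    proof
      assume rz: "poly r z = 0"
      have "r = 0"
      proof (rule ccontr)
        assume r0: "r \<noteq> 0"
        have "m dvd r" using mD(6)[OF qr(2) rz] .
        hence "degree m \<le> degree r" using r0 by (rule dvd_imp_degree_le)
        thus False using qr(4) r0 less.prems(3) by simp
      qed
      hence mhq: "m = h * q" using qr(3) by simp
      hence "degree q = 0" using minpoly_irreducible[OF m less.prems(1)] False by blast
      moreover have "q \<noteq> 0" using mhq mD(4) by auto
      ultimately have "degree m = degree h" unfolding mhq using h0 by (simp add: degree_mult_eq)
      thus False using less.prems(3) by simp
    qed
    hence "degree r < degree h" using qr(4) by auto
    then obtain u where u: "u \<in> polys_over S" "poly u z * poly r z = 1"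
      using less.hyps[of r] qr(2) rne less.prems(3) by auto
    have "poly r z = - (poly h z * poly q z)"
      using arg_cong[OF qr(3), of "\<lambda>p. poly p z"] mD(3) by (simp add: eq_neg_iff_add_eq_0 add.commute)
    hence "poly (- (u * q)) z * poly h z = 1" using u(2) by (simp add: mult_ac)
    thus ?thesis using u(1) qr(1) by (intro bexI[of _ "- (u * q)"] polys_over_intros)
  qed
qed

lemma complex_subfield_adjoin:
  assumes "h \<in> polys_over S" "h \<noteq> 0" "poly h z = 0"
  shows "complex_subfield (adjoin z)"
proof -
  obtain m where m: "is_minpoly z m" using ex_minpoly[OF assms] by blast
  note mD = minpolyD[OF m]
  show ?thesis
  proof
    show "0 \<in> adjoin z" unfolding adjoin_def by (intro CollectI exI[of _ 0]) auto
    show "1 \<in> adjoin z" unfolding adjoin_def by (intro CollectI exI[of _ 1]) auto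
  next
    fix x y assume "x \<in> adjoin z" "y \<in> adjoin z"
    then obtain a b where ab: "a \<in> polys_over S" "b \<in> polys_over S" "x = poly a z" "y = poly b z"
      unfolding adjoin_def by blast
    show "x + y \<in> adjoin z" unfolding adjoin_def
      using ab by (intro CollectI exI[of _ "a + b"]) (auto intro: polys_over_intros)
    show "x * y \<in> adjoin z" unfolding adjoin_def
      using ab by (intro CollectI exI[of _ "a * b"]) (auto intro: polys_over_intros)
  next
    fix x assume "x \<in> adjoin z"
    then obtain a where a: "a \<in> polys_over S" "x = poly a z"
      unfolding adjoin_def by blast
    show "- x \<in> adjoin z" unfolding adjoin_def
      using a by (intro CollectI exI[of _ "- a"]) (auto intro: polys_over_intros)
    show "inverse x \<in> adjoin z"
    proof (cases "x = 0")
      case True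
      thus ?thesis unfolding adjoin_def by (intro CollectI exI[of _ 0]) auto
    next
      case False
      obtain q r where qr: "q \<in> polys_over S" "r \<in> polys_over S" "a = m * q + r"
          "r = 0 \<or> degree r < degree m"
        using polys_over_division[OF a(1) mD(1,4)] by blast
      have rx: "poly r z = x" using qr(3) a(2) mD(3) by simp
      hence "r \<noteq> 0" using False by auto
      then obtain u where "u \<in> polys_over S" "poly u z * x = 1"
        using adjoin_inverse_aux[OF m qr(2)] rx False qr(4) by auto
      hence "u \<in> polys_over S \<and> inverse x = poly u z"
        using inverse_unique[of x "poly u z"] by (simp add: mult.commute)
      thus ?thesis unfolding adjoin_def by blast
    qed
  qed
qed

lemma adjoin_generator: "z \<in> adjoin z"
  unfolding adjoin_def by (intro CollectI exI[of _ "[:0, 1:]"]) auto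

lemma adjoin_base: "S \<subseteq> adjoin z"
proof
  fix c assume "c \<in> S"
  thus "c \<in> adjoin z" unfolding adjoin_def
    by (intro CollectI exI[of _ "[:c:]"]) (auto intro: polys_over_const)
qed

end

lemma complex_subfield_Rats: "complex_subfield \<rat>"
  by unfold_locales auto

section \<open>Number fields of prime degree\<close>

lemma complex_ring_simps [simp]:
  "carrier complex_ring = UNIV" "x \<otimes>\<^bsub>complex_ring\<^esub> y = x * y" "\<one>\<^bsub>complex_ring\<^esub> = 1"
  "x \<oplus>\<^bsub>complex_ring\<^esub> y = x + y" "\<zero>\<^bsub>complex_ring\<^esub> = 0"
  by (simp_all add: ring_of_type_algebra_def)

interpretation C: ring complex_ring
  by (rule ring_from_type_algebra)

lemma complex_ring_a_inv [simp]: "\<ominus>\<^bsub>complex_ring\<^esub> x = - x"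
  using C.minus_equality[of "- x" x] by simp

lemma complex_ring_m_inv: "x \<noteq> 0 \<Longrightarrow> inv\<^bsub>complex_ring\<^esub> x = inverse x"
  using C.inv_char[of x "inverse x"] by simp

lemma complex_subfield_subfield:
  assumes "subfield K complex_ring"
  shows "complex_subfield K"
proof -
  note E = subringE[OF subfieldE(1)[OF assms], simplified]
  have "inverse x \<in> K" if "x \<in> K" for x
    using C.subfield_m_inv(1)[OF assms, of x] that E(2) by (cases "x = 0") (auto simp: complex_ring_m_inv)
  thus ?thesis using E by unfold_locales auto
qed

lemma subfield_complex_subfield:
  assumes "complex_subfield K"
  shows "subfield K complex_ring"
proof -
  interpret complex_subfield K by fact
  have "subring K complex_ring" by (rule C.subringI) auto
  thus ?thesis by (rule field.subfieldI'[OF field_from_type_algebra]) (auto simp: complex_ring_m_inv)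
qed

interpretation Q: complex_subfield \<rat>
  by (rule complex_subfield_Rats)

lemma line_extension_complex:
  "u \<in> C.line_extension F a E \<longleftrightarrow> (\<exists>k\<in>F. \<exists>v\<in>E. u = k * a + v)"
  by (simp add: C.line_extension_mem_iff)

lemma dimension_1_imp_eq:
  assumes F: "complex_subfield F" and dim: "C.dimension 1 F E" and "F \<subseteq> E"
  shows "E = F"
proof (rule ccontr)
  assume "E \<noteq> F"
  interpret complex_subfield F by fact
  obtain y where y: "y \<in> E" "y \<notin> F" using \<open>E \<noteq> F\<close> assms(3) by blast
  have "C.Span F [1] = F"
    by (auto simp: line_extension_complex)
  hence "C.independent F [y, 1]"
    using y(2) by (intro C.li_Cons) auto
  hence "length [y, 1] \<le> 1"
    using y assms(3) by (intro C.independent_length_le_dimension[OF subfield_complex_subfield[OF F] dim]) auto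
  thus False by simp
qed

locale prime_degree_field =
  fixes K :: "complex set" and l :: nat
  assumes prime_l: "prime l" and odd_l: "odd l"
    and degree_l: "number_field_of_degree K l"
begin

lemma dim: "C.dimension l \<rat> K" and subfield_K: "subfield K complex_ring"
  using degree_l unfolding number_field_of_degree_def by auto

sublocale complex_subfield K
  by (rule complex_subfield_subfield[OF subfield_K])

lemma l_ge_3: "l \<ge> 3"
  using prime_l odd_l prime_ge_2_nat[OF prime_l] by (cases "l = 2") auto

lemma K_neq_Rats: "K \<noteq> \<rat>"
proof
  assume "K = \<rat>"
  have "C.dimension 1 K K" by (rule C.dimension_one[OF subfield_K])
  hence "l = 1" using dim C.dimension_is_inj[OF subfield_complex_subfield[OF complex_subfield_Rats]]
    unfolding \<open>K = \<rat>\<close> by blast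
  thus False using l_ge_3 by simp
qed

text \<open>The highest exponent comes first, so that \<open>powers x (Suc n)\<close> is
  \<open>x ^ n # powers x n\<close> and inductions on n follow the recursion of
  \<open>C.Span\<close> and \<open>C.independent\<close>.\<close>

definition powers :: "complex \<Rightarrow> nat \<Rightarrow> complex list" where
  "powers x n = map (\<lambda>i. x ^ i) (rev [0..<n])"

lemma Span_powers:
  "C.Span \<rat> (powers x n) = {poly h x | h. h \<in> polys_over \<rat> \<and> (\<forall>i\<ge>n. coeff h i = 0)}"
proof (induction n)
  case 0
  have *: "h \<in> polys_over \<rat> \<and> (\<forall>i\<ge>0. coeff h i = 0) \<longleftrightarrow> h = 0" for h :: "complex poly"
    by (auto simp: poly_eq_iff polys_over_def)
  show ?case unfolding * by (simp add: powers_def)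
next
  case (Suc n)
  have "C.Span \<rat> (powers x (Suc n)) = C.line_extension \<rat> (x ^ n) (C.Span \<rat> (powers x n))"
    by (simp add: powers_def)
  also have "\<dots> = {poly h x | h. h \<in> polys_over \<rat> \<and> (\<forall>i\<ge>Suc n. coeff h i = 0)}"
    unfolding Suc
  proof (intro Set.set_eqI iffI)
    fix u assume "u \<in> C.line_extension \<rat> (x ^ n) {poly h x | h. h \<in> polys_over \<rat> \<and> (\<forall>i\<ge>n. coeff h i = 0)}"
    then obtain k h where kh: "k \<in> \<rat>" "h \<in> polys_over \<rat>" "\<forall>i\<ge>n. coeff h i = 0" "u = k * x ^ n + poly h x"
      unfolding line_extension_complex by blast
    thus "u \<in> {poly h x | h. h \<in> polys_over \<rat> \<and> (\<forall>i\<ge>Suc n. coeff h i = 0)}"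
      by (intro CollectI exI[of _ "Polynomial.monom k n + h"])
         (auto intro: Q.polys_over_intros simp: poly_monom)
  next
    fix u assume "u \<in> {poly h x | h. h \<in> polys_over \<rat> \<and> (\<forall>i\<ge>Suc n. coeff h i = 0)}"
    then obtain h where h: "h \<in> polys_over \<rat>" "\<forall>i\<ge>Suc n. coeff h i = 0" "u = poly h x" by blast
    define h' where "h' = h - Polynomial.monom (coeff h n) n"
    have k: "coeff h n \<in> \<rat>" using h(1) by (rule Q.coeff_polys_over)
    have "h' \<in> polys_over \<rat>" unfolding h'_def using h(1) k by (intro Q.polys_over_intros)
    moreover have "coeff h' i = 0" if "i \<ge> n" for i
      using h(2) that unfolding h'_def by (cases "i = n") auto
    moreover have "u = coeff h n * x ^ n + poly h' x" unfolding h'_def h(3) by (simp add: poly_monom)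
    ultimately show "u \<in> C.line_extension \<rat> (x ^ n) {poly h x | h. h \<in> polys_over \<rat> \<and> (\<forall>i\<ge>n. coeff h i = 0)}"
      unfolding line_extension_complex using k by blast
  qed
  finally show ?case .
qed

lemma independent_powers:
  assumes "\<And>h. h \<in> polys_over \<rat> \<Longrightarrow> h \<noteq> 0 \<Longrightarrow> poly h x = 0 \<Longrightarrow> d \<le> degree h" "n \<le> d"
  shows "C.independent \<rat> (powers x n)"
  using assms(2)
proof (induction n)
  case 0
  thus ?case by (simp add: powers_def)
next
  case (Suc n)
  have "x ^ n \<notin> C.Span \<rat> (powers x n)"
  proof
    assume "x ^ n \<in> C.Span \<rat> (powers x n)"
    then obtain h where h: "h \<in> polys_over \<rat>" "\<forall>i\<ge>n. coeff h i = 0" "x ^ n = poly h x"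
      unfolding Span_powers by blast
    define g where "g = Polynomial.monom 1 n - h"
    have g: "g \<in> polys_over \<rat>" "poly g x = 0" unfolding g_def
      using h by (auto intro!: Q.polys_over_intros simp: poly_monom)
    have "coeff g n = 1" unfolding g_def using h(2) by simp
    hence "g \<noteq> 0" by auto
    moreover have "degree g \<le> n"
      by (rule degree_le) (use h(2) in \<open>auto simp: g_def\<close>)
    ultimately show False using assms(1)[OF g(1) _ g(2)] Suc.prems by simp
  qed
  hence "C.independent \<rat> (x ^ n # powers x n)"
    using Suc by (intro C.li_Cons) auto
  thus ?case by (simp add: powers_def)
qed

lemma powers_subset: "x \<in> K \<Longrightarrow> set (powers x n) \<subseteq> K"
  by (auto simp: powers_def)

lemma algebraic_element:
  assumes "x \<in> K"
  obtains h where "h \<in> polys_over \<rat>" "h \<noteq> 0" "poly h x = 0"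
proof (rule ccontr)
  assume "\<not> thesis"
  hence "C.independent \<rat> (powers x (Suc l))"
    using that by (intro independent_powers[where d = "Suc l"]) auto
  hence "length (powers x (Suc l)) \<le> l"
    using powers_subset[OF assms]
    by (intro C.independent_length_le_dimension[OF subfield_complex_subfield[OF complex_subfield_Rats] dim]) auto
  thus False by (simp add: powers_def)
qed

lemma adjoin_subset:
  assumes "complex_subfield F" "F \<subseteq> K" "x \<in> K"
  shows "complex_subfield.adjoin F x \<subseteq> K"
proof -
  interpret F: complex_subfield F by fact
  have "poly h x \<in> K" if "h \<in> polys_over F" for h
  proof -
    have "coeff h i \<in> K" for i using F.coeff_polys_over[OF that] assms(2) by blast
    thus ?thesis unfolding poly_altdef using assms(3) by (intro sum_closed mult_closed power_closed) auto
  qed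
  thus ?thesis unfolding F.adjoin_def by blast
qed

text \<open>The tower law, together with the primality of the degree, leaves no proper intermediate field.\<close>

lemma primitive_element:
  assumes x: "x \<in> K" "x \<notin> \<rat>"
  shows adjoin_eq: "Q.adjoin x = K" and ex_minpoly_degree: "\<exists>m. Q.is_minpoly x m \<and> degree m = l"
proof -
  obtain h where h: "h \<in> polys_over \<rat>" "h \<noteq> 0" "poly h x = 0"
    using algebraic_element[OF x(1)] .
  define F where "F = Q.adjoin x"
  have F: "complex_subfield F" unfolding F_def by (rule Q.complex_subfield_adjoin[OF h])
  interpret F: complex_subfield F by fact
  have sF: "subfield F complex_ring" by (rule subfield_complex_subfield[OF F])
  have sQ: "subfield \<rat> complex_ring" by (rule subfield_complex_subfield[OF complex_subfield_Rats])
  have FK: "F \<subseteq> K" unfolding F_def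
    by (rule adjoin_subset[OF complex_subfield_Rats Rats_closed x(1)])
  have sub: "subalgebra A B complex_ring" if "complex_subfield B" "A \<subseteq> B" for A B
  proof -
    interpret B: complex_subfield B by fact
    have "subgroup B (add_monoid complex_ring)"
      using subringE(1) subfieldE(1)[OF subfield_complex_subfield[OF that(1)]]
        subring.axioms(1) by blast
    thus ?thesis using that(2) unfolding subalgebra_def subalgebra_axioms_def by auto
  qed
  have finF: "C.finite_dimension \<rat> F"
    by (rule C.subalbegra_incl_imp_finite_dimension[OF sQ C.finite_dimensionI[OF dim] _ FK])
       (rule sub[OF F F.Rats_closed])
  obtain Vs where Vs: "C.independent \<rat> Vs" "length Vs = l" "C.Span \<rat> Vs = K"
    using C.exists_base[OF sQ dim] by blast
  have setVs: "set Vs \<subseteq> K" using C.Span_base_incl[OF sQ, of Vs] Vs(3) by simp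
  \<comment> \<open>A basis over the rationals still spans K over the larger field F, which makes K
    finite-dimensional over F.\<close>
  have "C.Span F Vs = K"
  proof
    show "C.Span F Vs \<subseteq> K"
      by (rule C.subalgebra_Span_incl[OF sF _ setVs]) (rule sub[OF complex_subfield_axioms FK])
    show "K \<subseteq> C.Span F Vs"
      using F.Rats_closed unfolding Vs(3)[symmetric]
      by (auto simp: C.Span_eq_combine_set[OF sQ] C.Span_eq_combine_set[OF sF] simp del: C.Span.simps)
  qed
  hence finK: "C.finite_dimension F K" using C.Span_finite_dimension[OF sF, of Vs] by simp
  obtain d e where d: "C.dimension d \<rat> F" and e: "C.dimension e F K"
    using finF finK unfolding C.finite_dimension_def by blast
  have "C.dimension (d * e) \<rat> K" by (rule C.telescopic_base[OF sQ sF d e])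
  hence l: "l = d * e" using dim C.dimension_is_inj[OF sQ] by blast
  have "d \<noteq> 1"
  proof
    assume "d = 1"
    hence "F = \<rat>" using dimension_1_imp_eq[OF complex_subfield_Rats _ F.Rats_closed] d by simp
    thus False using x(2) Q.adjoin_generator[of x] unfolding F_def by simp
  qed
  hence "e = 1" using l prime_l prime_product[of d e] by blast
  thus FK_eq: "Q.adjoin x = K"
    using dimension_1_imp_eq[OF F _ FK] e unfolding F_def by simp
  \<comment> \<open>The powers of x below the degree of m form a basis of K, so that degree is
    l.\<close>
  obtain m where m: "Q.is_minpoly x m" using Q.ex_minpoly[OF h] by blast
  note mD = Q.minpolyD[OF m]
  have "degree m \<le> degree h" if "h \<in> polys_over \<rat>" "h \<noteq> 0" "poly h x = 0" for h
    using mD(6)[OF that(1,3)] that(2) by (rule dvd_imp_degree_le)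
  hence ind: "C.independent \<rat> (powers x (degree m))" by (rule independent_powers) auto
  have "K \<subseteq> C.Span \<rat> (powers x (degree m))"
  proof
    fix y assume "y \<in> K"
    then obtain g where g: "g \<in> polys_over \<rat>" "y = poly g x"
      using FK_eq unfolding Q.adjoin_def by blast
    obtain q r where qr: "q \<in> polys_over \<rat>" "r \<in> polys_over \<rat>" "g = m * q + r"
        "r = 0 \<or> degree r < degree m"
      using Q.polys_over_division[OF g(1) mD(1,4)] by blast
    have "y = poly r x" using qr(3) g(2) mD(3) by simp
    moreover have "\<forall>i\<ge>degree m. coeff r i = 0" using qr(4) by (auto simp: coeff_eq_0)
    ultimately show "y \<in> C.Span \<rat> (powers x (degree m))" unfolding Span_powers using qr(2) by blast
  qed
  moreover have "C.Span \<rat> (powers x (degree m)) \<subseteq> K"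
    by (rule C.subalgebra_Span_incl[OF sQ _ powers_subset[OF x(1)]])
       (rule sub[OF complex_subfield_axioms Rats_closed])
  ultimately have "C.Span \<rat> (powers x (degree m)) = K" by blast
  hence "C.dimension (length (powers x (degree m))) \<rat> K"
    using C.dimensionI[OF sQ ind] by blast
  hence "degree m = l" using dim C.dimension_is_inj[OF sQ] by (auto simp: powers_def)
  thus "\<exists>m. Q.is_minpoly x m \<and> degree m = l" using m by blast
qed

end

section \<open>Cyclic fields\<close>

lemma coeff_linear_mult:
  "coeff ([:- c, 1:] * P) 0 = - (c * coeff P 0)"
  "coeff ([:- c, 1:] * P) (Suc k) = coeff P k - c * coeff P (Suc k)" for c :: complex
  by simp_all

lemma rational_poly_denominator:
  "h \<in> polys_over \<rat> \<Longrightarrow> \<exists>M::nat. M > 0 \<and> (\<forall>i. of_nat M * coeff h i \<in> \<int>)"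
proof (induction h)
  case 0
  thus ?case by (intro exI[of _ 1]) auto
next
  case (pCons c h)
  have c: "c \<in> \<rat>" using Q.coeff_polys_over[OF pCons.prems, of 0] by simp
  have "coeff h i \<in> \<rat>" for i using Q.coeff_polys_over[OF pCons.prems, of "Suc i"] by simp
  hence "h \<in> polys_over \<rat>" unfolding polys_over_def by blast
  then obtain M where M: "M > 0" "\<And>i. of_nat M * coeff h i \<in> \<int>" using pCons.IH by blast
  obtain u v where uv: "v > 0" "c = of_int u / of_int v"
    using c by (elim Rats_cases') auto
  have v: "of_nat (nat v) = (of_int v :: complex)" using uv(1) by simp
  have "of_nat (M * nat v) * coeff (pCons c h) i \<in> \<int>" for i
  proof (cases i)
    case 0
    have "of_nat (M * nat v) * coeff (pCons c h) i = of_int (int M * u)"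
      using uv unfolding 0 of_nat_mult v by simp
    thus ?thesis by (simp only: Ints_of_int)
  next
    case (Suc k)
    have "of_nat (M * nat v) * coeff (pCons c h) i = of_int v * (of_nat M * coeff h k)"
      unfolding Suc of_nat_mult v by simp
    thus ?thesis using Ints_mult[OF Ints_of_int[of v] M(2)[of k]] by (simp only:)
  qed
  thus ?case using M(1) uv(1) by (intro exI[of _ "M * nat v"]) auto
qed

text \<open>No closure is demanded: values may lie anywhere in the complex numbers, so automorphisms
  of K and embeddings of larger fields fall under one notion.\<close>

definition field_hom_on :: "complex set \<Rightarrow> (complex \<Rightarrow> complex) \<Rightarrow> bool" where
  "field_hom_on K t \<longleftrightarrow> (\<forall>x\<in>K. \<forall>y\<in>K. t (x + y) = t x + t y \<and> t (x * y) = t x * t y) \<and> t 1 = 1"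

section \<open>Arithmetic of field homomorphisms\<close>

context complex_subfield
begin

context
  fixes t assumes t: "field_hom_on S t"
begin

lemma hom_add: "x \<in> S \<Longrightarrow> y \<in> S \<Longrightarrow> t (x + y) = t x + t y"
  and hom_mult: "x \<in> S \<Longrightarrow> y \<in> S \<Longrightarrow> t (x * y) = t x * t y"
  and hom_1: "t 1 = 1"
  using t unfolding field_hom_on_def by auto

lemma hom_0: "t 0 = 0"
  using hom_add[of 0 0] by simp

lemma hom_minus: "x \<in> S \<Longrightarrow> t (- x) = - t x"
  using hom_add[of x "- x"] hom_0 by (auto simp: eq_neg_iff_add_eq_0 add.commute)

lemma hom_diff: "x \<in> S \<Longrightarrow> y \<in> S \<Longrightarrow> t (x - y) = t x - t y"
  using hom_add[of x "- y"] hom_minus[of y] by auto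

lemma hom_inverse: "x \<in> S \<Longrightarrow> t (inverse x) = inverse (t x)"
  using hom_mult[of x "inverse x"] hom_0 hom_1
  by (cases "x = 0") (auto intro!: inverse_unique[symmetric])

lemma hom_divide: "x \<in> S \<Longrightarrow> y \<in> S \<Longrightarrow> t (x / y) = t x / t y"
  using hom_mult[of x "inverse y"] hom_inverse[of y] by (auto simp: divide_inverse)

lemma hom_eq_0_iff: "x \<in> S \<Longrightarrow> t x = 0 \<longleftrightarrow> x = 0"
  using hom_mult[of x "inverse x"] inverse_closed[of x] hom_0 hom_1 by (cases "x = 0") auto

lemma hom_inj: "x \<in> S \<Longrightarrow> y \<in> S \<Longrightarrow> t x = t y \<longleftrightarrow> x = y"
  using hom_eq_0_iff[of "x - y"] hom_diff[of x y] by auto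

lemma hom_power: "x \<in> S \<Longrightarrow> t (x ^ n) = t x ^ n"
  by (induction n) (auto simp: hom_1 hom_mult power_closed)

lemma hom_sum: "(\<And>i. i \<in> I \<Longrightarrow> g i \<in> S) \<Longrightarrow> t (sum g I) = (\<Sum>i\<in>I. t (g i))"
  by (induction I rule: infinite_finite_induct) (auto simp: hom_0 hom_add sum_closed)

lemma hom_prod: "(\<And>i. i \<in> I \<Longrightarrow> g i \<in> S) \<Longrightarrow> t (prod g I) = (\<Prod>i\<in>I. t (g i))"
  by (induction I rule: infinite_finite_induct) (auto simp: hom_1 hom_mult prod_closed)

lemma hom_of_nat: "t (of_nat n) = of_nat n"
  by (induction n) (auto simp: hom_0 hom_1 hom_add)

lemma hom_of_int: "t (of_int n) = of_int n"
  by (cases n) (auto simp: hom_of_nat hom_minus hom_diff hom_1 simp del: of_nat_Suc)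

lemma hom_Rats: "q \<in> \<rat> \<Longrightarrow> t q = q"
  by (auto elim!: Rats_cases' simp: hom_divide hom_of_int)

lemma hom_poly: "h \<in> polys_over \<rat> \<Longrightarrow> x \<in> S \<Longrightarrow> t (poly h x) = poly h (t x)"
proof -
  assume h: "h \<in> polys_over \<rat>" and x: "x \<in> S"
  have c: "coeff h i \<in> \<rat>" for i using h by (simp add: polys_over_def)
  hence c': "coeff h i \<in> S" for i using Rats_closed by blast
  have "t (coeff h i * x ^ i) = coeff h i * t x ^ i" for i
    using hom_mult[OF c'[of i] power_closed[OF x, of i]] hom_power[OF x] hom_Rats[OF c] by simp
  thus ?thesis unfolding poly_altdef using c' x by (subst hom_sum) auto
qed

lemma hom_algebraic_int: "x \<in> S \<Longrightarrow> algebraic_int x \<Longrightarrow> algebraic_int (t x)"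
proof -
  assume x: "x \<in> S" "algebraic_int x"
  then obtain p where p: "lead_coeff p = 1" "\<forall>i. coeff p i \<in> \<int>" "poly p x = 0"
    by (auto elim: algebraic_int.cases)
  have "p \<in> polys_over \<rat>" using p(2) Ints_subset_Rats unfolding polys_over_def by auto
  hence "poly p (t x) = 0" using hom_poly[of p x] x p(3) hom_0 by simp
  thus ?thesis using p by (intro algebraic_int.intros[of p]) auto
qed

lemma coeff_prod_linear:
  assumes "finite I" "\<And>i. i \<in> I \<Longrightarrow> a i \<in> S"
  shows "coeff (\<Prod>i\<in>I. [:- a i, 1:]) j \<in> S \<and>
    t (coeff (\<Prod>i\<in>I. [:- a i, 1:]) j) = coeff (\<Prod>i\<in>I. [:- t (a i), 1:]) j"
  using assms
proof (induction I arbitrary: j rule: finite_induct)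
  case empty
  show ?case by (auto simp: hom_0 hom_1 coeff_pCons split: nat.splits)
next
  case (insert i I)
  have a: "a i \<in> S" using insert.prems by simp
  have IH: "coeff (\<Prod>i\<in>I. [:- a i, 1:]) k \<in> S"
     "t (coeff (\<Prod>i\<in>I. [:- a i, 1:]) k) = coeff (\<Prod>i\<in>I. [:- t (a i), 1:]) k" for k
    using insert by auto
  show ?case
  proof (cases j)
    case 0
    have "a i * coeff (\<Prod>i\<in>I. [:- a i, 1:]) 0 \<in> S" using a IH(1) by (rule mult_closed)
    thus ?thesis unfolding 0 prod.insert[OF insert.hyps] coeff_linear_mult
      using a IH by (simp add: hom_minus hom_mult uminus_closed)
  next
    case (Suc k)
    have "a i * coeff (\<Prod>i\<in>I. [:- a i, 1:]) j \<in> S" using a IH(1) by (rule mult_closed)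
    thus ?thesis unfolding Suc prod.insert[OF insert.hyps] coeff_linear_mult
      using a IH by (simp add: hom_diff hom_mult diff_closed)
  qed
qed

end

end

text \<open>One nontrivial automorphism stands for the Galois group: the degree being prime, its
  powers turn out to be all embeddings of K.\<close>

locale cyclic_field = prime_degree_field +
  fixes \<sigma> :: "complex \<Rightarrow> complex"
  assumes \<sigma>_iso: "\<sigma> \<in> ring_iso (field_ring K) (field_ring K)"
    and \<sigma>_nontrivial: "\<exists>x\<in>K. \<sigma> x \<noteq> x"
begin

definition s :: "nat \<Rightarrow> complex \<Rightarrow> complex" where
  "s i = \<sigma> ^^ i"

lemma s_0 [simp]: "s 0 x = x" and s_Suc: "s (Suc i) x = \<sigma> (s i x)"
  and s_Suc': "s (Suc i) x = s i (\<sigma> x)" and s_add: "s (i + j) x = s i (s j x)"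
  by (simp_all add: s_def funpow_add funpow_swap1)

lemma s_1: "s 1 x = \<sigma> x"
  by (simp add: s_def)

lemma \<sigma>_hom: "field_hom_on K \<sigma>"
  and \<sigma>_closed: "x \<in> K \<Longrightarrow> \<sigma> x \<in> K"
  using \<sigma>_iso unfolding ring_iso_def Ring.ring_hom_def field_hom_on_def by auto

lemma s_closed [intro]: "x \<in> K \<Longrightarrow> s i x \<in> K"
  by (induction i) (auto simp: s_Suc \<sigma>_closed)

lemma s_hom: "field_hom_on K (s i)"
proof (induction i)
  case (Suc i)
  thus ?case using \<sigma>_hom s_closed unfolding field_hom_on_def by (auto simp: s_Suc)
qed (auto simp: field_hom_on_def)

text \<open>An irrational element generates K, so an automorphism fixing it would be the
  identity.\<close>

lemma fixed_imp_rational: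
  assumes "x \<in> K" "\<sigma> x = x"
  shows "x \<in> \<rat>"
proof (rule ccontr)
  assume "x \<notin> \<rat>"
  hence gen: "Q.adjoin x = K" using adjoin_eq assms(1) by blast
  have "\<sigma> y = y" if "y \<in> K" for y
    using that hom_poly[OF \<sigma>_hom _ assms(1)] assms(2) unfolding gen[symmetric] Q.adjoin_def by auto
  thus False using \<sigma>_nontrivial by blast
qed

text \<open>The number n of factors is left free because the period of an orbit is only determined
  in \<open>orbit\<close>; for n = l this is the characteristic polynomial of x.\<close>

definition char_poly_upto :: "nat \<Rightarrow> complex \<Rightarrow> complex poly" where
  "char_poly_upto n x = (\<Prod>i<n. [:- s i x, 1:])"

lemma char_poly_rational:
  assumes "x \<in> K" "s n x = x"
  shows "char_poly_upto n x \<in> polys_over \<rat>"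
proof -
  define P where "P = char_poly_upto n x"
  \<comment> \<open>\<sigma> merely rotates the n factors, because \<open>s n x = x\<close>; hence
    it fixes the coefficients.\<close>
  have shift: "(\<Prod>i<n. [:- \<sigma> (s i x), 1:]) = P"
  proof -
    have "[:- s 0 x, 1:] * (\<Prod>i<n. [:- s (Suc i) x, 1:]) = (\<Prod>i<Suc n. [:- s i x, 1:])"
      by (simp only: prod.lessThan_Suc_shift)
    also have "\<dots> = [:- s 0 x, 1:] * P"
      unfolding P_def char_poly_upto_def using assms(2) by (simp only: prod.lessThan_Suc s_0 mult.commute)
    finally show ?thesis unfolding s_Suc by (metis mult_cancel_left pCons_eq_0_iff one_neq_zero)
  qed
  have "coeff P j \<in> K \<and> \<sigma> (coeff P j) = coeff P j" for j
    using coeff_prod_linear[OF \<sigma>_hom, of "{..<n}" "\<lambda>i. s i x" j] assms(1) s_closed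
    unfolding shift by (simp add: P_def char_poly_upto_def)
  thus ?thesis unfolding P_def polys_over_def using fixed_imp_rational by blast
qed

lemma char_poly_roots: "poly (char_poly_upto n x) y = 0 \<longleftrightarrow> (\<exists>i<n. y = s i x)"
  by (auto simp: char_poly_upto_def poly_prod)

lemma degree_char_poly: "degree (char_poly_upto n x) = n"
  unfolding char_poly_upto_def by (subst degree_prod_sum_eq) auto

text \<open>The orbit consists of roots of the minimal polynomial m, so it is finite with some
  period n, and its n distinct members give n \<le> l. Conversely m divides the rational polynomial
  with exactly these roots, so l \<le> n.\<close>

lemma orbit:
  assumes x: "x \<in> K" "x \<notin> \<rat>"
  shows "s l x = x" and "inj_on (\<lambda>i. s i x) {..<l}"
proof -
  obtain m where m: "Q.is_minpoly x m" "degree m = l"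
    using ex_minpoly_degree[OF x] by blast
  note mD = Q.minpolyD[OF m(1)]
  have root: "poly m (s i x) = 0" for i
    using hom_poly[OF s_hom mD(1) x(1), of i] mD(3) hom_0[OF s_hom] by simp
  have fin: "finite {y. poly m y = 0}" using mD(4) by (rule poly_roots_finite)
  have shift: "s (j - i) x = x" if "i < j" "s i x = s j x" for i j
  proof -
    have "s i (s (j - i) x) = s i x" using that by (simp flip: s_add)
    thus ?thesis using hom_inj[OF s_hom, of "s (j - i) x" x i] x(1) by auto
  qed
  have "\<not> inj (\<lambda>i. s i x)"
  proof
    assume "inj (\<lambda>i. s i x)"
    hence "infinite (range (\<lambda>i. s i x))" using finite_imageD by blast
    moreover have "range (\<lambda>i. s i x) \<subseteq> {y. poly m y = 0}" using root by auto
    ultimately show False using fin finite_subset by blast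
  qed
  then obtain i j where "i < j" "s i x = s j x"
    unfolding inj_def by (metis linorder_neqE_nat)
  hence "\<exists>n>0. s n x = x" using shift by (metis zero_less_diff)
  then obtain n where n: "n > 0" "s n x = x" and least: "\<And>k. 0 < k \<Longrightarrow> s k x = x \<Longrightarrow> n \<le> k"
    using LeastI_ex[of "\<lambda>n. n > 0 \<and> s n x = x"] Least_le[of "\<lambda>n. n > 0 \<and> s n x = x"] by blast
  have inj: "inj_on (\<lambda>i. s i x) {..<n}"
  proof (rule linorder_inj_onI)
    fix i j assume ij: "i < j" "i \<in> {..<n}" "j \<in> {..<n}"
    show "s i x \<noteq> s j x"
    proof
      assume "s i x = s j x"
      hence "n \<le> j - i" using shift[OF ij(1)] least ij(1) by simp
      thus False using ij by simp
    qed
  qed auto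
  have "poly (char_poly_upto n x) x = 0"
    unfolding char_poly_roots using n(1) by (intro exI[of _ 0]) simp
  hence "m dvd char_poly_upto n x" using mD(6) char_poly_rational[OF x(1) n(2)] by blast
  moreover have "char_poly_upto n x \<noteq> 0" using degree_char_poly[of n x] n(1) by auto
  ultimately have "l \<le> n" using m(2) degree_char_poly[of n x] by (metis dvd_imp_degree_le)
  moreover have "n \<le> l"
  proof -
    have "n = card ((\<lambda>i. s i x) ` {..<n})" using card_image[OF inj] by simp
    also have "\<dots> \<le> card {y. poly m y = 0}" using root fin by (intro card_mono) auto
    also have "\<dots> \<le> l" using card_poly_roots_bound[OF mD(4)] m(2) by simp
    finally show ?thesis .
  qed
  ultimately have "n = l" by simp
  thus "s l x = x" "inj_on (\<lambda>i. s i x) {..<l}" using n inj by auto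
qed

lemma s_l: "x \<in> K \<Longrightarrow> s l x = x"
  using orbit(1) hom_Rats[OF s_hom] by blast

lemma s_inverse: "x \<in> K \<Longrightarrow> i \<le> l \<Longrightarrow> s (l - i) (s i x) = x"
  using s_l[of x] by (simp flip: s_add)

text \<open>A homomorphism is determined by its value at a generator x, and this value is a root of
  the characteristic polynomial of x, that is, some \<open>s i x\<close>.\<close>

lemma hom_eq_s:
  assumes t: "field_hom_on K t"
  obtains i where "i < l" "\<And>y. y \<in> K \<Longrightarrow> t y = s i y"
proof -
  obtain x where x: "x \<in> K" "x \<notin> \<rat>" using K_neq_Rats Rats_closed by blast
  define P where "P = char_poly_upto l x"
  have P: "P \<in> polys_over \<rat>" unfolding P_def using char_poly_rational[OF x(1) s_l[OF x(1)]] .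
  have "poly P x = 0" unfolding P_def char_poly_roots
    using l_ge_3 by (intro exI[of _ 0]) auto
  hence "poly P (t x) = 0" using hom_poly[OF t P x(1)] hom_0[OF t] by simp
  then obtain i where i: "i < l" "t x = s i x" unfolding P_def char_poly_roots by blast
  have "t y = s i y" if y: "y \<in> K" for y
  proof -
    obtain h where h: "h \<in> polys_over \<rat>" "y = poly h x"
      using y adjoin_eq[OF x, symmetric] unfolding Q.adjoin_def by blast
    show ?thesis using hom_poly[OF t h(1) x(1)] hom_poly[OF s_hom h(1) x(1), of i] i(2) h(2) by simp
  qed
  thus thesis using that i(1) by blast
qed

lemma embeddings_eq: "embeddings K = (\<lambda>i. restrict (s i) K) ` {..<l}"
proof (intro equalityI subsetI)
  fix t assume "t \<in> embeddings K"
  hence t: "field_hom_on K t" "t \<in> extensional K"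
    unfolding embeddings_def Ring.ring_hom_def field_hom_on_def by auto
  obtain i where i: "i < l" "\<And>y. y \<in> K \<Longrightarrow> t y = s i y" using hom_eq_s[OF t(1)] by metis
  have "t = restrict (s i) K" using t(2) i(2) by (auto simp: fun_eq_iff extensional_def)
  thus "t \<in> (\<lambda>i. restrict (s i) K) ` {..<l}" using i(1) by blast
next
  fix t assume "t \<in> (\<lambda>i. restrict (s i) K) ` {..<l}"
  then obtain i where t: "t = restrict (s i) K" by blast
  show "t \<in> embeddings K"
    using s_hom[of i] unfolding t embeddings_def Ring.ring_hom_def field_hom_on_def by auto
qed

section \<open>Norm and trace\<close>

definition N :: "complex \<Rightarrow> complex" where
  "N x = (\<Prod>i<l. s i x)"

lemma field_norm_eq: "x \<in> K \<Longrightarrow> field_norm K x = N x"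
proof -
  assume x: "x \<in> K"
  obtain z where z: "z \<in> K" "z \<notin> \<rat>" using K_neq_Rats Rats_closed by blast
  have "inj_on (\<lambda>i. restrict (s i) K) {..<l}"
    using orbit(2)[OF z] z(1) unfolding inj_on_def by (metis restrict_apply')
  thus ?thesis unfolding field_norm_def N_def embeddings_eq using x by (simp add: prod.reindex)
qed

lemma prod_shift: "x \<in> K \<Longrightarrow> (\<Prod>i<l. f (s i (\<sigma> x))) = (\<Prod>i<l. (f (s i x) :: complex))"
\<comment> \<open>The rotation argument cancels the factor \<open>f x\<close>; if this factor
  vanishes, so do both products.\<close>
proof (cases "f x = 0")
  case False
  assume x: "x \<in> K"
  have "f (s 0 x) * (\<Prod>i<l. f (s (Suc i) x)) = (\<Prod>i<Suc l. f (s i x))"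
    by (simp only: prod.lessThan_Suc_shift)
  also have "\<dots> = f (s 0 x) * (\<Prod>i<l. f (s i x))" using s_l[OF x] by simp
  finally show ?thesis using False unfolding s_Suc' by simp
next
  case True
  assume x: "x \<in> K"
  have "\<exists>i<l. f (s i (\<sigma> x)) = 0"
    using True s_l[OF x] l_ge_3 by (intro exI[of _ "l - 1"]) (auto simp flip: s_Suc')
  moreover have "\<exists>i<l. f (s i x) = 0"
    using True l_ge_3 by (intro exI[of _ 0]) auto
  ultimately have "(\<Prod>i<l. f (s i (\<sigma> x))) = 0" "(\<Prod>i<l. f (s i x)) = 0" by auto
  thus ?thesis by (simp only:)
qed

lemma sum_shift: "x \<in> K \<Longrightarrow> (\<Sum>i<l. s i (\<sigma> x)) = (\<Sum>i<l. s i x)"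
proof -
  assume x: "x \<in> K"
  have "s 0 x + (\<Sum>i<l. s (Suc i) x) = (\<Sum>i<Suc l. s i x)"
    by (simp only: sum.lessThan_Suc_shift)
  also have "\<dots> = s 0 x + (\<Sum>i<l. s i x)" using s_l[OF x] by simp
  finally show ?thesis unfolding s_Suc' by simp
qed

lemma N_\<sigma>: "x \<in> K \<Longrightarrow> N (\<sigma> x) = N x"
  unfolding N_def using prod_shift[of x "\<lambda>x. x"] by simp

lemma N_s: "x \<in> K \<Longrightarrow> N (s i x) = N x"
  by (induction i) (auto simp: s_Suc N_\<sigma> s_closed)

lemma N_mult: "x \<in> K \<Longrightarrow> y \<in> K \<Longrightarrow> N (x * y) = N x * N y"
  unfolding N_def by (simp add: hom_mult[OF s_hom] prod.distrib)

lemma N_Rats: "x \<in> \<rat> \<Longrightarrow> N x = x ^ l"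
  unfolding N_def by (simp add: hom_Rats[OF s_hom])

lemma N_power: "x \<in> K \<Longrightarrow> N (x ^ n) = N x ^ n"
  unfolding N_def by (simp add: hom_power[OF s_hom] prod_power_distrib)

lemma N_eq_0_iff: "x \<in> K \<Longrightarrow> N x = 0 \<longleftrightarrow> x = 0"
  unfolding N_def using l_ge_3 by (auto simp: prod_zero_iff hom_eq_0_iff[OF s_hom] intro!: exI[of _ 0])

lemma N_rational: "x \<in> K \<Longrightarrow> N x \<in> \<rat>"
proof -
  assume x: "x \<in> K"
  have "\<sigma> (N x) = (\<Prod>i<l. \<sigma> (s i x))" unfolding N_def
    using x by (intro hom_prod[OF \<sigma>_hom]) auto
  also have "\<dots> = N (\<sigma> x)" unfolding N_def by (simp flip: s_Suc s_Suc')
  finally have "\<sigma> (N x) = N x" using N_\<sigma>[OF x] by simp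
  moreover have "N x \<in> K" unfolding N_def using x by auto
  ultimately show ?thesis using fixed_imp_rational by blast
qed

definition Tr :: "complex \<Rightarrow> complex" where
  "Tr x = (\<Sum>i<l. s i x)"

lemma Tr_rational: "x \<in> K \<Longrightarrow> Tr x \<in> \<rat>"
proof -
  assume x: "x \<in> K"
  have "\<sigma> (Tr x) = (\<Sum>i<l. \<sigma> (s i x))" unfolding Tr_def
    using x by (intro hom_sum[OF \<sigma>_hom]) auto
  also have "\<dots> = (\<Sum>i<l. s i (\<sigma> x))" by (simp flip: s_Suc s_Suc')
  finally have "\<sigma> (Tr x) = Tr x" using sum_shift[OF x] unfolding Tr_def by simp
  moreover have "Tr x \<in> K" unfolding Tr_def using x by auto
  ultimately show ?thesis using fixed_imp_rational by blast
qed

section \<open>The ring of integers and integral norms\<close>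

abbreviation OK :: "complex set" where
  "OK \<equiv> integer_ring K"

lemma O_iff: "x \<in> OK \<longleftrightarrow> x \<in> K \<and> algebraic_int x"
  unfolding integer_ring_def by auto

lemma O_subset: "x \<in> OK \<Longrightarrow> x \<in> K"
  by (simp add: O_iff)

lemma O_add [intro]: "x \<in> OK \<Longrightarrow> y \<in> OK \<Longrightarrow> x + y \<in> OK"
  and O_diff [intro]: "x \<in> OK \<Longrightarrow> y \<in> OK \<Longrightarrow> x - y \<in> OK"
  and O_mult [intro]: "x \<in> OK \<Longrightarrow> y \<in> OK \<Longrightarrow> x * y \<in> OK"
  and O_minus [intro]: "x \<in> OK \<Longrightarrow> - x \<in> OK"
  and O_power [intro]: "x \<in> OK \<Longrightarrow> x ^ n \<in> OK"
  and O_0 [simp, intro]: "0 \<in> OK" and O_1 [simp, intro]: "1 \<in> OK"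
  and O_of_int [simp, intro]: "of_int m \<in> OK" and O_of_nat [simp, intro]: "of_nat n \<in> OK"
  and O_s [intro]: "x \<in> OK \<Longrightarrow> s i x \<in> OK"
  by (auto simp: O_iff hom_algebraic_int[OF s_hom])

lemma O_sum [intro]: "(\<And>i. i \<in> I \<Longrightarrow> g i \<in> OK) \<Longrightarrow> sum g I \<in> OK"
  by (induction I rule: infinite_finite_induct) auto

lemma O_prod [intro]: "(\<And>i. i \<in> I \<Longrightarrow> g i \<in> OK) \<Longrightarrow> prod g I \<in> OK"
  by (induction I rule: infinite_finite_induct) auto

lemma O_rational: "x \<in> OK \<Longrightarrow> x \<in> \<rat> \<Longrightarrow> x \<in> \<int>"
  using rational_algebraic_int_is_int by (auto simp: O_iff)

lemma N_Ints: "x \<in> OK \<Longrightarrow> N x \<in> \<int>"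
  using N_rational[of x] O_rational[of "N x"] unfolding N_def by (auto simp: O_subset)

lemma Tr_Ints: "x \<in> OK \<Longrightarrow> Tr x \<in> \<int>"
  using Tr_rational[of x] O_rational[of "Tr x"] unfolding Tr_def by (auto simp: O_subset)

text \<open>The norm as a member of type int; on \<open>OK\<close> the floor and the real part
  change nothing, see \<open>of_int_nrm\<close>.\<close>

definition nrm :: "complex \<Rightarrow> int" where
  "nrm x = \<lfloor>Re (N x)\<rfloor>"

lemma of_int_nrm: "x \<in> OK \<Longrightarrow> of_int (nrm x) = N x"
  using N_Ints[of x] by (auto simp: nrm_def elim!: Ints_cases)

lemma nrm_eqI: "x \<in> OK \<Longrightarrow> N x = of_int n \<Longrightarrow> nrm x = n"
  using of_int_nrm[of x] by simp

lemma nrm_mult: "x \<in> OK \<Longrightarrow> y \<in> OK \<Longrightarrow> nrm (x * y) = nrm x * nrm y"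
  by (intro nrm_eqI) (auto simp: N_mult of_int_nrm O_subset)

lemma nrm_power: "x \<in> OK \<Longrightarrow> nrm (x ^ n) = nrm x ^ n"
  by (intro nrm_eqI) (auto simp: N_power of_int_nrm O_subset)

lemma nrm_of_int: "nrm (of_int n) = n ^ l"
  by (intro nrm_eqI) (auto simp: N_Rats)

lemma nrm_of_nat: "nrm (of_nat n) = int n ^ l"
  using nrm_of_int[of "int n"] by simp

lemma nrm_1: "nrm 1 = 1"
  using nrm_of_int[of 1] by simp

lemma nrm_s: "x \<in> OK \<Longrightarrow> nrm (s i x) = nrm x"
  by (intro nrm_eqI) (auto simp: N_s of_int_nrm O_subset)

lemma nrm_eq_0_iff: "x \<in> OK \<Longrightarrow> nrm x = 0 \<longleftrightarrow> x = 0"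
  using of_int_nrm[of x] N_eq_0_iff[of x] O_subset[of x] by (metis of_int_eq_0_iff)

definition dvdO :: "complex \<Rightarrow> complex \<Rightarrow> bool" (infix \<open>dvdO\<close> 50) where
  "a dvdO b \<longleftrightarrow> (\<exists>c\<in>OK. b = a * c)"

lemma dvdO_nrm: "a dvdO b \<Longrightarrow> a \<in> OK \<Longrightarrow> nrm a dvd nrm b"
  unfolding dvdO_def by (auto simp: nrm_mult)

lemma dvdO_refl: "a dvdO a"
  unfolding dvdO_def by (intro bexI[of _ 1]) auto

lemma dvdO_trans: "a dvdO b \<Longrightarrow> b dvdO c \<Longrightarrow> a dvdO c"
  unfolding dvdO_def by (auto simp: mult.assoc)

lemma dvdO_add: "a dvdO b \<Longrightarrow> a dvdO c \<Longrightarrow> a dvdO b + c"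
  unfolding dvdO_def by (metis O_add distrib_left)

lemma dvdO_mult: "a dvdO b \<Longrightarrow> c \<in> OK \<Longrightarrow> a dvdO b * c"
  unfolding dvdO_def by (metis O_mult mult.assoc)

lemma dvdO_s: "a \<in> OK \<Longrightarrow> a dvdO b \<Longrightarrow> s i a dvdO s i b"
  unfolding dvdO_def by (metis O_s O_subset hom_mult[OF s_hom])

lemma dvdO_Nx: "x \<in> OK \<Longrightarrow> x dvdO of_int (nrm x)"
proof -
  assume x: "x \<in> OK"
  have "{..<l} = insert 0 {1..<l}" using l_ge_3 by auto
  hence "N x = x * (\<Prod>i=1..<l. s i x)" unfolding N_def by simp
  thus ?thesis unfolding dvdO_def of_int_nrm[OF x] using x by auto
qed

text \<open>Up to sign, the inverse of u is the product of its other conjugates.\<close>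

lemma nrm_unit: "u \<in> OK \<Longrightarrow> \<bar>nrm u\<bar> = 1 \<Longrightarrow> inverse u \<in> OK"
proof -
  assume u: "u \<in> OK" "\<bar>nrm u\<bar> = 1"
  obtain c where c: "c \<in> OK" "of_int (nrm u) = u * c" using dvdO_Nx[OF u(1)] unfolding dvdO_def by blast
  have "of_int (nrm u) * of_int (nrm u) = (1 :: complex)"
    using u(2) by (metis abs_mult_self_eq mult_1 of_int_1 of_int_mult)
  hence "u * (c * of_int (nrm u)) = 1" using c(2) by (simp add: mult.assoc)
  hence "inverse u = c * of_int (nrm u)" by (rule inverse_unique)
  thus ?thesis using c(1) by auto
qed

lemma nrm_dvd_equal: "a \<in> OK \<Longrightarrow> a \<noteq> 0 \<Longrightarrow> c \<in> OK \<Longrightarrow> \<bar>nrm (a * c)\<bar> = \<bar>nrm a\<bar> \<Longrightarrow> \<bar>nrm c\<bar> = 1"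
  by (simp add: nrm_mult abs_mult nrm_eq_0_iff)

end

section \<open>Rings of cyclotomic integers\<close>

lemma power_mod_order: "z ^ n = 1 \<Longrightarrow> [i = j] (mod n) \<Longrightarrow> z ^ i = (z :: complex) ^ j"
proof -
  assume z: "z ^ n = 1" and ij: "[i = j] (mod n)"
  have "z ^ k = z ^ (k mod n)" for k
  proof -
    have "z ^ k = z ^ (n * (k div n) + k mod n)" by simp
    also have "\<dots> = z ^ (k mod n)" unfolding power_add power_mult z by simp
    finally show ?thesis .
  qed
  thus ?thesis using ij unfolding cong_def by metis
qed

text \<open>The ring \<open>\<int>[\<zeta>]\<close> for \<open>\<zeta> = a b\<close>, where \<open>b\<close> is a primitive \<open>p\<close>-th root of unity and the order
  of \<open>a\<close> is prime to \<open>p\<close>, studied locally at \<open>\<lambda> = 1 - b\<close>.\<close>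

locale root_of_unity_ring =
  fixes p m :: nat and a b :: complex
  assumes prime_p: "prime p" and coprime_pm: "coprime p m" and m_pos: "m > 0"
    and a_power: "a ^ m = 1" and b_power: "b ^ p = 1" and b_neq_1: "b \<noteq> 1"
begin

definition R :: "complex set" where
  "R = {poly (map_poly of_int g) (a * b) | g :: int poly. True}"

lemma R_add [intro]: "x \<in> R \<Longrightarrow> y \<in> R \<Longrightarrow> x + y \<in> R"
  unfolding R_def by (auto simp flip: poly_add of_int_hom.map_poly_hom_add)

lemma R_mult [intro]: "x \<in> R \<Longrightarrow> y \<in> R \<Longrightarrow> x * y \<in> R"
  unfolding R_def by (auto simp flip: poly_mult of_int_poly_hom.hom_mult)

lemma R_minus [intro]: "x \<in> R \<Longrightarrow> - x \<in> R"
  unfolding R_def by (auto simp flip: poly_minus of_int_poly_hom.hom_uminus)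

lemma R_of_int [simp, intro]: "of_int c \<in> R"
  unfolding R_def by (intro CollectI exI[of _ "[:c:]"]) (auto simp: of_int_hom.map_poly_pCons_hom)

lemma R_of_nat [simp, intro]: "of_nat c \<in> R"
  using R_of_int[of "int c"] by simp

lemma R_0 [simp, intro]: "0 \<in> R" and R_1 [simp, intro]: "1 \<in> R"
  using R_of_int[of 0] R_of_int[of 1] by auto

lemma R_diff [intro]: "x \<in> R \<Longrightarrow> y \<in> R \<Longrightarrow> x - y \<in> R"
  using R_add[of x "- y"] R_minus[of y] by simp

lemma R_power [intro]: "x \<in> R \<Longrightarrow> x ^ n \<in> R"
  by (induction n) auto

lemma R_sum [intro]: "(\<And>i. i \<in> I \<Longrightarrow> g i \<in> R) \<Longrightarrow> sum g I \<in> R"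
  by (induction I rule: infinite_finite_induct) auto

lemma R_zeta: "a * b \<in> R"
  unfolding R_def by (intro CollectI exI[of _ "[:0, 1:]"]) auto

text \<open>Both are powers of a * b, with exponents supplied by the Chinese remainder
  theorem.\<close>

lemma R_a: "a \<in> R" and R_b: "b \<in> R"
proof -
  obtain e where "[e = 1] (mod m)" "[e = 0] (mod p)"
    using binary_chinese_remainder_nat[of m p 1 0] coprime_pm by (auto simp: coprime_commute)
  hence "(a * b) ^ e = a" unfolding power_mult_distrib
    using power_mod_order[OF a_power, of e 1] power_mod_order[OF b_power, of e 0] by simp
  thus "a \<in> R" using R_power[OF R_zeta, of e] by simp
next
  obtain e where "[e = 0] (mod m)" "[e = 1] (mod p)"
    using binary_chinese_remainder_nat[of m p 0 1] coprime_pm by (auto simp: coprime_commute)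
  hence "(a * b) ^ e = b" unfolding power_mult_distrib
    using power_mod_order[OF a_power, of e 0] power_mod_order[OF b_power, of e 1] by simp
  thus "b \<in> R" using R_power[OF R_zeta, of e] by simp
qed

text \<open>As a ring R is generated by a and b, so statements about homomorphisms and Frobenius
  maps reduce to these two elements.\<close>

lemma R_induct [consumes 1, case_names int add mult a b]:
  assumes "x \<in> R" "\<And>c. P (of_int c)"
    and "\<And>x y. x \<in> R \<Longrightarrow> y \<in> R \<Longrightarrow> P x \<Longrightarrow> P y \<Longrightarrow> P (x + y)"
    and "\<And>x y. x \<in> R \<Longrightarrow> y \<in> R \<Longrightarrow> P x \<Longrightarrow> P y \<Longrightarrow> P (x * y)"
    and "P a" and "P b"
  shows "P x"
proof -
  obtain g :: "int poly" where x: "x = poly (map_poly of_int g) (a * b)"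
    using assms(1) unfolding R_def by blast
  have Pz: "P (a * b)" using assms(4)[OF R_a R_b assms(5,6)] .
  have "P (poly (map_poly of_int g) (a * b))"
  proof (induction g)
    case 0
    show ?case using assms(2)[of 0] by simp
  next
    case (pCons c g)
    have R: "poly (map_poly of_int g) (a * b) \<in> R" unfolding R_def by blast
    have "P (of_int c + a * b * poly (map_poly of_int g) (a * b))"
      using R R_zeta by (intro assms(3) assms(4) assms(2) Pz pCons.IH) auto
    thus ?case by (simp add: of_int_hom.map_poly_pCons_hom)
  qed
  thus ?thesis using x by simp
qed

lemma R_algebraic_int: "x \<in> R \<Longrightarrow> algebraic_int x"
proof -
  have root: "algebraic_int z" if "z ^ n = 1" "n > 0" for z :: complex and n
    by (rule algebraic_int_root[of 1 "Polynomial.monom 1 n"])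
       (use that in \<open>simp_all add: poly_monom degree_monom_eq\<close>)
  show "x \<in> R \<Longrightarrow> algebraic_int x"
  proof (induction rule: R_induct)
  case a
  show ?case using root a_power m_pos by blast
next
  case b
  show ?case using root b_power prime_gt_0_nat[OF prime_p] by blast
  qed auto
qed

section \<open>Congruences modulo 1 - b and the Frobenius map\<close>

definition lam :: complex where
  "lam = 1 - b"

lemma lam_neq_0: "lam \<noteq> 0" and R_lam: "lam \<in> R"
  using b_neq_1 R_b unfolding lam_def by auto

definition lamcong :: "complex \<Rightarrow> complex \<Rightarrow> bool" where
  "lamcong x y \<longleftrightarrow> (\<exists>r\<in>R. x - y = lam * r)"

lemma lamcong_refl [simp]: "lamcong x x"
  unfolding lamcong_def by (intro bexI[of _ 0]) auto

lemma lamcong_sym: "lamcong x y \<Longrightarrow> lamcong y x"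
  unfolding lamcong_def by (metis R_minus minus_diff_eq mult_minus_right)

lemma lamcong_trans [trans]: "lamcong x y \<Longrightarrow> lamcong y z \<Longrightarrow> lamcong x z"
  unfolding lamcong_def
proof -
  assume "\<exists>r\<in>R. x - y = lam * r" "\<exists>r\<in>R. y - z = lam * r"
  then obtain r t where "r \<in> R" "t \<in> R" "x - y = lam * r" "y - z = lam * t" by blast
  hence "x - z = lam * (r + t)" "r + t \<in> R" by (auto simp: algebra_simps)
  thus "\<exists>r\<in>R. x - z = lam * r" by blast
qed

lemma lamcong_add: "lamcong x y \<Longrightarrow> lamcong x' y' \<Longrightarrow> lamcong (x + x') (y + y')"
  unfolding lamcong_def
proof -
  assume "\<exists>r\<in>R. x - y = lam * r" "\<exists>r\<in>R. x' - y' = lam * r"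
  then obtain r t where "r \<in> R" "t \<in> R" "x - y = lam * r" "x' - y' = lam * t" by blast
  hence "x + x' - (y + y') = lam * (r + t)" "r + t \<in> R" by (auto simp: algebra_simps)
  thus "\<exists>r\<in>R. x + x' - (y + y') = lam * r" by blast
qed

lemma lamcong_mult:
  assumes "lamcong x y" "lamcong x' y'" "x' \<in> R" "y \<in> R"
  shows "lamcong (x * x') (y * y')"
proof -
  obtain r t where "r \<in> R" "t \<in> R" "x - y = lam * r" "x' - y' = lam * t"
    using assms unfolding lamcong_def by blast
  moreover from this have "x * x' - y * y' = lam * (r * x' + y * t)"
    by (auto simp: algebra_simps)
  moreover have "r * x' + y * t \<in> R"
    using assms calculation by (intro R_add R_mult) auto
  ultimately have "x * x' - y * y' = lam * (r * x' + y * t)" "r * x' + y * t \<in> R" by auto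
  thus ?thesis unfolding lamcong_def by blast
qed

lemma lamcong_power: "lamcong x y \<Longrightarrow> x \<in> R \<Longrightarrow> y \<in> R \<Longrightarrow> lamcong (x ^ n) (y ^ n)"
  by (induction n) (auto intro!: lamcong_mult)

lemma lamcong_b: "lamcong b 1"
  unfolding lamcong_def lam_def by (intro bexI[of _ "-1"] R_minus) auto

text \<open>Since 1 + b + ... + b^(p-1) = 0, p equals the sum of the 1 - b^i, each of them a
  multiple of \<open>lam\<close>.\<close>

lemma p_lam: "\<exists>r\<in>R. of_nat p = lam * r"
proof -
  have "(\<Sum>i<p. b ^ i) = 0" using b_power b_neq_1 by (simp add: geometric_sum)
  hence "of_nat p = (\<Sum>i<p. 1 - b ^ i)" by (simp add: sum_subtractf)
  also have "\<dots> = (\<Sum>i<p. lam * (\<Sum>j<i. b ^ j))"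
    unfolding lam_def by (simp add: one_diff_power_eq)
  also have "\<dots> = lam * (\<Sum>i<p. \<Sum>j<i. b ^ j)" by (simp add: sum_distrib_left)
  finally show ?thesis using R_b by (intro bexI[of _ "\<Sum>i<p. \<Sum>j<i. b ^ j"]) auto
qed

lemma freshman:
  assumes "x \<in> R" "y \<in> R"
  shows "\<exists>r\<in>R. (x + y) ^ p = x ^ p + y ^ p + of_nat p * r"
proof -
  have p: "p > 0" using prime_p prime_gt_0_nat by blast
  have "\<exists>c::nat. p choose k = p * c" if "k \<in> {1..<p}" for k
    using dvd_choose_prime[of k p] that prime_p p by (auto simp: dvd_def)
  then obtain c :: "nat \<Rightarrow> nat" where c: "\<And>k. k \<in> {1..<p} \<Longrightarrow> p choose k = p * c k" by metis
  have set: "{..p} = insert 0 (insert p {1..<p})" using p by auto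
  have "(x + y) ^ p = (\<Sum>k\<le>p. of_nat (p choose k) * x ^ k * y ^ (p - k))"
    by (rule binomial_ring)
  also have "\<dots> = y ^ p + (x ^ p + (\<Sum>k=1..<p. of_nat (p choose k) * x ^ k * y ^ (p - k)))"
    unfolding set using p by (subst sum.insert; simp)+
  also have "(\<Sum>k=1..<p. of_nat (p choose k) * x ^ k * y ^ (p - k)) =
      of_nat p * (\<Sum>k=1..<p. of_nat (c k) * x ^ k * y ^ (p - k))"
    unfolding sum_distrib_left by (intro sum.cong) (auto simp: c mult_ac)
  finally have "(x + y) ^ p = x ^ p + y ^ p + of_nat p * (\<Sum>k=1..<p. of_nat (c k) * x ^ k * y ^ (p - k))"
    by (simp add: add_ac)
  moreover have "(\<Sum>k=1..<p. of_nat (c k) * x ^ k * y ^ (p - k)) \<in> R"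
    using assms by (intro R_sum R_mult R_power) auto
  ultimately show ?thesis by blast
qed

text \<open>Modulo p the expansion of (1 - b)^p leaves 1 + (-1)^p, which is 0 for odd p and 2 for p
  = 2. Together with \<open>p_lam\<close> this says that p and \<open>lam\<close> divide powers of
  each other.\<close>

lemma lam_power_p: "\<exists>r\<in>R. lam ^ p = of_nat p * r"
proof -
  obtain r where r: "r \<in> R" "(1 + (- b)) ^ p = 1 ^ p + (- b) ^ p + of_nat p * r"
    using freshman[of 1 "- b"] R_b by auto
  have "(1 + (- b)) ^ p = lam ^ p" unfolding lam_def by simp
  moreover have "(- b) ^ p = (-1) ^ p" using b_power by (metis mult.right_neutral power_minus)
  moreover have "\<exists>t\<in>R. 1 + (-1) ^ p = of_nat p * t"
  proof (cases "p = 2")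
    case True
    thus ?thesis by (intro bexI[of _ 1]) auto
  next
    case False
    hence "odd p" using prime_p primes_dvd_imp_eq two_is_prime_nat by blast
    thus ?thesis by (intro bexI[of _ 0]) auto
  qed
  ultimately obtain t where t: "t \<in> R" "lam ^ p = of_nat p * t + of_nat p * r"
    using r(2) by auto
  show ?thesis using r t by (intro bexI[of _ "t + r"]) (auto simp: distrib_left)
qed

lemma lamcong_frobenius_add:
  assumes "x \<in> R" "y \<in> R"
  shows "lamcong ((x + y) ^ p ^ k) (x ^ p ^ k + y ^ p ^ k)"
proof (induction k)
  case (Suc k)
  have "lamcong (((x + y) ^ p ^ k) ^ p) ((x ^ p ^ k + y ^ p ^ k) ^ p)"
    using Suc assms by (intro lamcong_power) auto
  also obtain r where r: "r \<in> R" "(x ^ p ^ k + y ^ p ^ k) ^ p = (x ^ p ^ k) ^ p + (y ^ p ^ k) ^ p + of_nat p * r"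
    using freshman[of "x ^ p ^ k" "y ^ p ^ k"] assms by auto
  obtain t where t: "t \<in> R" "of_nat p = lam * t" using p_lam by blast
  have "lamcong ((x ^ p ^ k + y ^ p ^ k) ^ p) ((x ^ p ^ k) ^ p + (y ^ p ^ k) ^ p)"
    unfolding lamcong_def r(2) using r(1) t by (intro bexI[of _ "t * r"]) auto
  finally show ?case by (simp add: mult.commute flip: power_mult)
qed simp

text \<open>For q = p^totient(m) Euler's theorem gives q = 1 modulo m, so a^q = a, while b is 1
  modulo \<open>lam\<close>. Raising to the power q is additive and multiplicative modulo
  \<open>lam\<close>, so it fixes every class; in particular R modulo \<open>lam\<close> has no
  nilpotents.\<close>

lemma frobenius:
  obtains q where "q > 1" "\<And>x. x \<in> R \<Longrightarrow> lamcong (x ^ q) x"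
proof -
  define k where "k = totient m"
  define q where "q = p ^ k"
  have k: "k > 0" unfolding k_def using m_pos by simp
  have q1: "q > 1" unfolding q_def using k prime_gt_1_nat[OF prime_p] by (rule one_less_power[rotated])
  have q0: "(0::complex) ^ q = 0" using q1 by simp
  have "[q = 1] (mod m)" unfolding q_def k_def using euler_theorem[of p m] coprime_pm by simp
  hence aq: "a ^ q = a" using power_mod_order[OF a_power, of q 1] by simp
  have add: "lamcong ((x + y) ^ q) (x + y)"
    if "x \<in> R" "y \<in> R" "lamcong (x ^ q) x" "lamcong (y ^ q) y" for x y
    using lamcong_trans[OF lamcong_frobenius_add[OF that(1,2), of k] lamcong_add] that(3,4)
    unfolding q_def by blast
  have neg: "lamcong ((- x) ^ q) (- x)" if "x \<in> R" "lamcong (x ^ q) x" for x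
  proof -
    have "lamcong ((x + - x) ^ q) (x ^ q + (- x) ^ q)"
      unfolding q_def using that(1) by (intro lamcong_frobenius_add) auto
    hence "lamcong (x ^ q + (- x) ^ q) 0" using q0 by (auto intro: lamcong_sym)
    hence "lamcong (x ^ q + (- x) ^ q + (- (x ^ q))) (0 + (- (x ^ q)))" by (rule lamcong_add) simp
    hence "lamcong ((- x) ^ q) (- (x ^ q))" by simp
    moreover have "lamcong (- (x ^ q)) (- x)"
      using lamcong_sym[OF that(2)] unfolding lamcong_def by simp
    ultimately show ?thesis by (rule lamcong_trans)
  qed
  have nat: "lamcong (of_nat n ^ q) (of_nat n)" for n
  proof (induction n)
    case (Suc n)
    thus ?case using add[of 1 "of_nat n"] by simp
  qed (simp add: q0)
  have "lamcong (x ^ q) x" if "x \<in> R" for x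
    using that
  proof (induction rule: R_induct)
    case (int c)
    show ?case
    proof (cases c)
      case (nonneg n)
      thus ?thesis using nat[of n] by simp
    next
      case (neg n)
      thus ?thesis using nat[of "Suc n"] \<open>\<And>x. x \<in> R \<Longrightarrow> lamcong (x ^ q) x \<Longrightarrow> lamcong ((- x) ^ q) (- x)\<close>[of "of_nat (Suc n)"]
        by (simp only: of_int_minus of_int_of_nat_eq R_of_nat)
    qed
  next
    case (mult x y)
    thus ?case unfolding power_mult_distrib by (intro lamcong_mult) auto
  next
    case a
    show ?case by (simp add: aq)
  next
    case b
    have "lamcong (b ^ q) (1 ^ q)" by (intro lamcong_power lamcong_b R_b) auto
    hence "lamcong (b ^ q) 1" by simp
    thus ?case by (rule lamcong_trans[OF _ lamcong_sym[OF lamcong_b]])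
  qed (use add in auto)
  thus thesis using that q1 by blast
qed

text \<open>Reducedness of \<open>\<int>[\<zeta>]/\<lambda>\<close> makes \<open>\<int>[\<zeta>]\<close> integrally closed at \<open>\<lambda>\<close>.\<close>

lemma lam_saturated:
  assumes x: "algebraic_int x" and lx: "lam * x \<in> R"
  shows "x \<in> R"
proof -
  obtain d :: nat and c :: "nat \<Rightarrow> int" where d: "d > 0" "x ^ d = (\<Sum>i<d. of_int (c i) * x ^ i)"
    using algebraic_int_power_sum[OF x] by blast
  define y where "y = lam * x"
  have yR: "y \<in> R" using lx unfolding y_def .
  \<comment> \<open>Scaling the integral equation by lam^(d-1) turns each x^i into lam^(d-1-i) y^i,
    which lies in R; one further factor \<open>lam\<close> then gives y^d = 0 modulo
    \<open>lam\<close>.\<close>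
  have "lam ^ (d - 1) * x ^ d = (\<Sum>i<d. of_int (c i) * (lam ^ (d - 1) * x ^ i))"
    unfolding d(2) by (simp add: sum_distrib_left mult_ac)
  also have "\<dots> = (\<Sum>i<d. of_int (c i) * (lam ^ (d - 1 - i) * y ^ i))"
    unfolding y_def power_mult_distrib
    by (intro sum.cong refl) (auto simp: mult.assoc[symmetric] simp flip: power_add)
  also have "\<dots> \<in> R" using yR R_lam by (intro R_sum R_mult R_power) auto
  finally have r: "lam ^ (d - 1) * x ^ d \<in> R" .
  have "y ^ d = lam * (lam ^ (d - 1) * x ^ d)"
    using d(1) unfolding y_def power_mult_distrib by (simp add: power_eq_if mult_ac)
  hence yd: "lamcong (y ^ d) 0" unfolding lamcong_def using r by auto
  obtain q where q: "q > 1" "\<And>x. x \<in> R \<Longrightarrow> lamcong (x ^ q) x" using frobenius by blast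
  have iter: "lamcong (y ^ q ^ n) y" for n
  proof (induction n)
    case (Suc n)
    have "lamcong ((y ^ q ^ n) ^ q) (y ^ q ^ n)" using yR by (intro q(2)) auto
    thus ?case using lamcong_trans[OF _ Suc] by (simp add: mult.commute flip: power_mult)
  qed simp
  \<comment> \<open>The exponent q^d is large enough for y^(q^d) to contain the factor y^d, which
    vanishes modulo \<open>lam\<close>, while y^(q^d) is congruent to y.\<close>
  have "d \<le> q ^ d" using q(1) power_gt_expt[of q d] by simp
  hence "y ^ q ^ d = y ^ d * y ^ (q ^ d - d)" by (simp flip: power_add)
  moreover have "lamcong (y ^ d * y ^ (q ^ d - d)) (0 * y ^ (q ^ d - d))"
    using yd yR by (intro lamcong_mult) auto
  ultimately have "lamcong y 0"
    using lamcong_trans[OF lamcong_sym[OF iter[of d]], of 0] by simp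
  then obtain r where "r \<in> R" "lam * x = lam * r" unfolding lamcong_def y_def by auto
  thus ?thesis using lam_neq_0 by simp
qed

text \<open>The p-part of the denominator M divides a power of \<open>lam\<close> in R, and
  \<open>lam_saturated\<close> removes such a power one factor at a time.\<close>

lemma integral_closure:
  assumes x: "algebraic_int x" and M: "M > 0" "of_nat M * x \<in> R"
  obtains n where "coprime n p" "of_nat n * x \<in> R"
proof -
  have "M \<noteq> 0" "\<not> is_unit p" using M(1) prime_p not_prime_unit by auto
  then obtain n where n': "M = p ^ multiplicity p M * n" "\<not> p dvd n"
    by (rule multiplicity_decompose')
  define e where "e = multiplicity p M"
  have n: "M = p ^ e * n" "coprime n p"
    using n' prime_p prime_imp_coprime[of p n] unfolding e_def by (auto simp: coprime_commute)
  define y where "y = of_nat n * x"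
  have y: "algebraic_int y" unfolding y_def using x by auto
  have py: "of_nat p ^ e * y \<in> R" using M(2) unfolding n(1) y_def by (simp add: mult_ac)
  obtain t where t: "t \<in> R" "lam ^ p = of_nat p * t" using lam_power_p by blast
  have "(lam ^ p) ^ e * y = t ^ e * (of_nat p ^ e * y)" unfolding t(2) power_mult_distrib by (simp add: mult_ac)
  moreover have "t ^ e * (of_nat p ^ e * y) \<in> R" by (rule R_mult[OF R_power[OF t(1)] py])
  ultimately have ly: "lam ^ (p * e) * y \<in> R" unfolding power_mult by (simp only:)
  have saturated: "z \<in> R" if "algebraic_int z" "lam ^ k * z \<in> R" for k z
    using that
  proof (induction k arbitrary: z)
    case (Suc k)
    have "algebraic_int (lam ^ k * z)" 
      by (intro algebraic_int_mult algebraic_int_power R_algebraic_int[OF R_lam] Suc.prems(1))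
    hence "lam ^ k * z \<in> R" using Suc.prems(2) by - (rule lam_saturated, simp_all only: power_Suc mult.assoc)
    thus ?case by (rule Suc.IH[OF Suc.prems(1)])
  qed simp
  have "y \<in> R" using saturated[OF y ly] .
  thus thesis using that[OF n(2)] unfolding y_def by simp
qed

text \<open>On R the map t is the identity modulo \<open>lam\<close>, since it fixes a and changes b
  by a multiple of \<open>lam\<close>. An integral x need not lie in R, but n x does for some n
  prime to p, and Bezout inverts n modulo \<open>lam\<close> because p is a multiple of
  \<open>lam\<close>.\<close>

lemma inertia:
  assumes L: "complex_subfield L" "a \<in> L" "b \<in> L" and t: "field_hom_on L t"
    and ta: "t a = a" and tb: "lamcong (t b) b" "t b \<in> R"
    and x: "x \<in> L" "algebraic_int x" and M: "M > 0" "of_nat M * x \<in> R"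
  shows "\<exists>r. algebraic_int r \<and> t x - x = lam * r"
proof -
  interpret L: complex_subfield L by fact
  note hom = L.hom_add[OF t] L.hom_mult[OF t] L.hom_of_int[OF t]
  have R: "z \<in> L \<and> t z \<in> R \<and> lamcong (t z) z" if "z \<in> R" for z
    using that
  proof (induction rule: R_induct)
    case (add x y)
    thus ?case by (auto simp: hom intro!: lamcong_add)
  next
    case (mult x y)
    thus ?case by (auto simp: hom intro!: lamcong_mult)
  next
    case a
    show ?case using L(2) R_a by (simp add: ta)
  next
    case b
    show ?case using L(3) tb by simp
  qed (auto simp: hom)
  obtain n where n: "coprime n p" "of_nat n * x \<in> R" using integral_closure[OF x(2) M] .
  have "lamcong (of_nat n * t x) (of_nat n * x)"
    using R[OF n(2)] x(1) by (simp add: hom L.hom_of_nat[OF t])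
  then obtain r where r: "r \<in> R" "of_nat n * t x - of_nat n * x = lam * r"
    unfolding lamcong_def by blast
  obtain u v where "u * int n + v * int p = gcd (int n) (int p)"
    using bezout_int by blast
  hence uv: "u * int n + v * int p = 1" using n(1) by simp
  obtain w where w: "w \<in> R" "of_nat p = lam * w" using p_lam by blast
  define d where "d = t x - x"
  have nd: "of_nat n * d = lam * r" using r(2) unfolding d_def by (simp add: right_diff_distrib)
  have "d = of_int (u * int n + v * int p) * d" unfolding uv by simp
  also have "\<dots> = of_int u * (of_nat n * d) + of_int v * (of_nat p * d)"
    by (simp add: distrib_right mult.assoc)
  also have "\<dots> = lam * (of_int u * r + of_int v * w * d)"
    unfolding nd w(2) by (simp only: distrib_left mult_ac)
  finally have "t x - x = lam * (of_int u * r + of_int v * w * (t x - x))" unfolding d_def .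
  moreover have "algebraic_int (of_int u * r + of_int v * w * (t x - x))"
    using R_algebraic_int[OF r(1)] R_algebraic_int[OF w(1)] x(2) L.hom_algebraic_int[OF t x]
    by (intro algebraic_int_add algebraic_int_mult algebraic_int_diff algebraic_int_of_int)
  ultimately show ?thesis by blast
qed

end

section \<open>Cyclotomic fields\<close>

lemma complex_subfield_cyclotomic: "complex_subfield (cyclotomic_field n)"
  unfolding cyclotomic_field_def
  by (intro complex_subfield_subfield field.generate_field_is_subfield[OF field_from_type_algebra]) simp

lemma cis_in_cyclotomic: "cis (2 * pi / real n) \<in> cyclotomic_field n"
  unfolding cyclotomic_field_def by (rule generate_field.incl) simp

lemma cyclotomic_field_minimal:
  assumes "complex_subfield L" "cis (2 * pi / real n) \<in> L"
  shows "cyclotomic_field n \<subseteq> L"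
  unfolding cyclotomic_field_def
  by (rule field.generate_field_min_subfield1[OF field_from_type_algebra])
     (use assms subfield_complex_subfield in auto)

lemma cis_power_order: "n > 0 \<Longrightarrow> cis (2 * pi / real n) ^ n = 1"
  by (simp add: Complex.DeMoivre)

lemma cis_power_mult: "k > 0 \<Longrightarrow> cis (2 * pi / real (k * n)) ^ k = cis (2 * pi / real n)"
  by (simp add: Complex.DeMoivre)

lemma (in root_of_unity_ring) clear_denominators:
  assumes h: "h \<in> polys_over \<rat>"
  shows "\<exists>M::nat. M > 0 \<and> of_nat M * poly h (a * b) \<in> R"
proof -
  obtain M :: nat where M: "M > 0" "\<And>i. of_nat M * coeff h i \<in> \<int>"
    using rational_poly_denominator[OF h] by blast
  have R: "of_nat M * coeff h i \<in> R" for i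
    using M(2)[of i] by (elim Ints_cases) simp
  have "of_nat M * poly h (a * b) = (\<Sum>i\<le>degree h. (of_nat M * coeff h i) * (a * b) ^ i)"
    unfolding poly_altdef by (simp add: sum_distrib_left mult.assoc)
  also have "\<dots> \<in> R" by (rule R_sum) (rule R_mult[OF R R_power[OF R_zeta]])
  finally show ?thesis using M(1) by blast
qed

lemma monom_minus_1_neq_0: "n > 0 \<Longrightarrow> Polynomial.monom 1 n - 1 \<noteq> (0 :: complex poly)"
proof
  assume n: "n > 0" and "Polynomial.monom 1 n - 1 = (0 :: complex poly)"
  hence "coeff (Polynomial.monom 1 n - 1 :: complex poly) n = 0" by simp
  thus False using n by simp
qed

text \<open>The powers of b are p distinct roots of X^p - 1, which has no more than p.\<close>

lemma (in root_of_unity_ring) root_of_unity_eq_power: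
  assumes "w ^ p = 1"
  shows "\<exists>j. w = b ^ j"
proof -
  have "inj_on (\<lambda>j. b ^ j) {..<p}"
  proof (rule linorder_inj_onI)
    fix i j assume ij: "i < j" "i \<in> {..<p}" "j \<in> {..<p}"
    show "b ^ i \<noteq> b ^ j"
    proof
      assume "b ^ i = b ^ j"
      also have "\<dots> = b ^ i * b ^ (j - i)" using ij(1) by (simp flip: power_add)
      finally have 1: "b ^ (j - i) = 1"
        using b_power prime_gt_0_nat[OF prime_p] by (auto simp: power_0_left)
      have "\<not> p dvd j - i" using ij by (intro nat_dvd_not_less) auto
      hence "coprime (j - i) p"
        using prime_p prime_imp_coprime[of p "j - i"] by (simp add: coprime_commute)
      then obtain e where "[(j - i) * e = 1] (mod p)"
        using cong_solve_coprime_nat by fastforce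
      hence "b ^ ((j - i) * e) = b" using power_mod_order[OF b_power, of "(j - i) * e" 1] by simp
      thus False using 1 b_neq_1 by (simp add: power_mult)
    qed
  qed auto
  hence card: "card ((\<lambda>j. b ^ j) ` {..<p}) = p" by (simp add: card_image)
  define P :: "complex poly" where "P = Polynomial.monom 1 p - 1"
  have p0: "p > 0" using prime_p prime_gt_0_nat by blast
  have P0: "P \<noteq> 0" unfolding P_def by (rule monom_minus_1_neq_0[OF p0])
  have "degree P \<le> p" unfolding P_def by (rule degree_diff_le) (auto simp: degree_monom_le)
  hence le: "card {z. poly P z = 0} \<le> p" using card_poly_roots_bound[OF P0] by simp
  have sub: "(\<lambda>j. b ^ j) ` {..<p} \<subseteq> {z. poly P z = 0}"
    using b_power by (auto simp: P_def poly_monom power_mult[symmetric] mult.commute[of _ p])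
      (simp add: power_mult)
  have "(\<lambda>j. b ^ j) ` {..<p} = {z. poly P z = 0}"
    using card_subset_eq[OF poly_roots_finite[OF P0] sub] card le
      card_mono[OF poly_roots_finite[OF P0] sub] by simp
  moreover have "poly P w = 0" using assms by (simp add: P_def poly_monom)
  ultimately show ?thesis by blast
qed

section \<open>Inertia at a prime dividing the conductor exactly once\<close>

context cyclic_field
begin

lemma s_cong: "[i = j] (mod l) \<Longrightarrow> x \<in> K \<Longrightarrow> s i x = s j x"
proof -
  assume ij: "[i = j] (mod l)" and x: "x \<in> K"
  have mult: "s (l * n) x = x" for n
    by (induction n) (auto simp: s_add s_l x s_closed)
  have "s k x = s (k mod l) x" for k
  proof -
    have "s k x = s (k mod l + l * (k div l)) x" by simp
    thus ?thesis unfolding s_add[of "k mod l"] mult .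
  qed
  thus ?thesis using ij unfolding cong_def by metis
qed

text \<open>By minimality of f some element of K lies outside F = Q(zeta_m), so
  \<open>ex_conjugate_value\<close> supplies a homomorphism over F that moves it. This homomorphism
  sends b to a power of b and is therefore trivial modulo 1 - b; on K it is a nontrivial power of
  \<sigma>.\<close>

lemma inertia_trivial:
  assumes cond: "has_conductor K f" and f: "f = p * m" and p: "prime p" and pm: "coprime p m"
  obtains lam where "algebraic_int lam"
    and "\<exists>r. algebraic_int r \<and> of_nat p = lam * r"
    and "\<exists>r. algebraic_int r \<and> lam ^ p = of_nat p * r"
    and "\<And>x j. x \<in> OK \<Longrightarrow> \<exists>r. algebraic_int r \<and> s j x - x = lam * r"
proof -
  have f0: "f > 0" and Kf: "K \<subseteq> cyclotomic_field f"
    and min: "\<And>n. n > 0 \<Longrightarrow> K \<subseteq> cyclotomic_field n \<Longrightarrow> f \<le> n"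
    using cond unfolding has_conductor_def by auto
  have p0: "p > 0" and m0: "m > 0" using f0 f by auto
  have "m < f" unfolding f using m0 prime_gt_1_nat[OF p] by simp
  hence KF: "\<not> K \<subseteq> cyclotomic_field m" using min[OF m0] by auto
  define F where "F = cyclotomic_field m"
  interpret F: complex_subfield F unfolding F_def by (rule complex_subfield_cyclotomic)
  define z where "z = cis (2 * pi / real f)"
  have zf: "z ^ f = 1" unfolding z_def by (rule cis_power_order[OF f0])
  have order: "z ^ i = 1" if "f dvd i" for i
    using that zf by (auto elim!: dvdE simp: power_mult)
  have "z ^ p = cis (2 * pi / real m)" unfolding z_def f by (rule cis_power_mult[OF p0])
  hence zp: "z ^ p \<in> F" unfolding F_def using cis_in_cyclotomic by simp
  obtain e1 where e1: "[e1 = 1] (mod m)" "[e1 = 0] (mod p)"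
    using binary_chinese_remainder_nat[of m p 1 0] pm by (auto simp: coprime_commute)
  obtain e2 where e2: "[e2 = 0] (mod m)" "[e2 = 1] (mod p)"
    using binary_chinese_remainder_nat[of m p 0 1] pm by (auto simp: coprime_commute)
  define a b where "a = z ^ e1" and "b = z ^ e2"
  have "p dvd e1" "m dvd e2" using e1(2) e2(1) by (auto simp: cong_0_iff)
  have am: "a ^ m = 1" unfolding a_def f power_mult[symmetric]
    by (rule order) (use \<open>p dvd e1\<close> in \<open>auto simp: f\<close>)
  have bp: "b ^ p = 1" unfolding b_def f power_mult[symmetric]
    by (rule order) (use \<open>m dvd e2\<close> in \<open>auto simp: f mult.commute\<close>)
  have aF: "a \<in> F" unfolding a_def using \<open>p dvd e1\<close> zp by (auto elim!: dvdE simp: power_mult)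
  have "[e1 + e2 = 1 + 0] (mod m)" "[e1 + e2 = 0 + 1] (mod p)"
    by (rule cong_add[OF e1(1) e2(1)], rule cong_add[OF e1(2) e2(2)])
  hence "[e1 + e2 = 1] (mod f)"
    unfolding f using pm by (simp add: coprime_cong_mult_nat)
  hence "z ^ (e1 + e2) = z" using power_mod_order[OF zf, of "e1 + e2" 1] by simp
  hence ab: "a * b = z" unfolding a_def b_def power_add .
  have b1: "b \<noteq> 1"
  proof
    assume "b = 1"
    hence "z \<in> F" using ab aF by simp
    hence "cyclotomic_field f \<subseteq> F"
      by (intro cyclotomic_field_minimal F.complex_subfield_axioms) (simp add: z_def)
    thus False using Kf KF unfolding F_def by blast
  qed
  interpret U: root_of_unity_ring p m a b
    using p pm m0 am bp b1 by unfold_locales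
  define P :: "complex poly" where "P = Polynomial.monom 1 p - 1"
  have P: "P \<in> polys_over F" unfolding P_def by (intro F.polys_over_intros) auto
  have P0: "P \<noteq> 0" unfolding P_def by (rule monom_minus_1_neq_0[OF p0])
  have Pb: "poly P b = 0" using bp by (simp add: P_def poly_monom)
  obtain M where M: "F.is_minpoly b M" using F.ex_minpoly[OF P P0 Pb] by blast
  define L where "L = F.adjoin b"
  have Lsub: "complex_subfield L" unfolding L_def by (rule F.complex_subfield_adjoin[OF P P0 Pb])
  interpret L: complex_subfield L by (rule Lsub)
  have FL: "F \<subseteq> L" and bL: "b \<in> L" unfolding L_def
    using F.adjoin_base F.adjoin_generator by auto
  have aL: "a \<in> L" using aF FL by blast
  have "z \<in> L" using aL bL ab by auto
  hence fL: "cyclotomic_field f \<subseteq> L" unfolding z_def by (rule cyclotomic_field_minimal[OF Lsub])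
  hence KL: "K \<subseteq> L" using Kf by blast
  obtain \<alpha> where \<alpha>: "\<alpha> \<in> K" "\<alpha> \<notin> F" using KF unfolding F_def by blast
  then obtain g where g: "g \<in> polys_over F" "\<alpha> = poly g b" using KL unfolding L_def F.adjoin_def by blast
  obtain w where w: "poly M w = 0" "poly g w \<noteq> poly g b"
    using F.ex_conjugate_value[OF M g(1)] \<alpha>(2) g(2) by blast
  have vanish: "poly h w = 0" if "h \<in> polys_over F" "poly h b = 0" for h
    using F.minpolyD(6)[OF M that] w(1) by (auto elim!: dvdE)
  have "w ^ p = 1" using vanish[OF P Pb] by (simp add: P_def poly_monom)
  then obtain j where j: "w = b ^ j" using U.root_of_unity_eq_power by blast
  \<comment> \<open>t substitutes the conjugate w for b. The choice of h is immaterial, because a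
    polynomial over F that vanishes at b vanishes at w.\<close>
  define t where "t = (\<lambda>y. poly (SOME h. h \<in> polys_over F \<and> poly h b = y) w)"
  have t: "t (poly h b) = poly h w" if "h \<in> polys_over F" for h
  proof -
    define h' where "h' = (SOME h'. h' \<in> polys_over F \<and> poly h' b = poly h b)"
    have "h' \<in> polys_over F \<and> poly h' b = poly h b"
      unfolding h'_def by (rule someI[of _ h]) (use that in simp)
    hence "poly (h' - h) w = 0" using that by (intro vanish F.polys_over_diff) auto
    thus ?thesis unfolding t_def h'_def by simp
  qed
  have thom: "field_hom_on L t"
    unfolding field_hom_on_def
  proof (intro conjI ballI)
    fix x y assume "x \<in> L" "y \<in> L"
    then obtain h k where hk: "h \<in> polys_over F" "x = poly h b" "k \<in> polys_over F" "y = poly k b"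
      unfolding L_def F.adjoin_def by blast
    show "t (x + y) = t x + t y"
      using t[OF F.polys_over_add[OF hk(1,3)]] t[OF hk(1)] t[OF hk(3)] hk by simp
    show "t (x * y) = t x * t y"
      using t[OF F.polys_over_mult[OF hk(1,3)]] t[OF hk(1)] t[OF hk(3)] hk by simp
  next
    show "t 1 = 1" using t[of 1] by simp
  qed
  have ta: "t a = a" using t[of "[:a:]"] aF F.polys_over_const by simp
  have tb: "t b = w" using t[of "[:0, 1:]"] by simp
  have t\<alpha>: "t \<alpha> \<noteq> \<alpha>" using t[OF g(1)] w(2) g(2) by simp
  have "field_hom_on K t" using thom KL unfolding field_hom_on_def by blast
  then obtain i where i: "i < l" "\<And>y. y \<in> K \<Longrightarrow> t y = s i y" using hom_eq_s by metis
  have i0: "i \<noteq> 0"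
  proof
    assume "i = 0"
    thus False using i(2)[OF \<alpha>(1)] t\<alpha> by simp
  qed
  have tR: "t b \<in> U.R" unfolding tb j using U.R_b by auto
  have tcong: "U.lamcong (t b) b"
  proof -
    have "U.lamcong (b ^ j) (1 ^ j)" by (rule U.lamcong_power[OF U.lamcong_b U.R_b]) simp
    hence "U.lamcong (b ^ j) 1" by simp
    thus ?thesis unfolding tb j by (rule U.lamcong_trans[OF _ U.lamcong_sym[OF U.lamcong_b]])
  qed
  have step: "\<exists>r. algebraic_int r \<and> s i x - x = U.lam * r" if x: "x \<in> OK" for x
  proof -
    have xK: "x \<in> K" "algebraic_int x" using x by (auto simp: O_iff)
    have "Polynomial.monom 1 f - 1 \<in> polys_over \<rat>" by (intro Q.polys_over_intros) auto
    moreover have "Polynomial.monom 1 f - 1 \<noteq> (0 :: complex poly)" by (rule monom_minus_1_neq_0[OF f0])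
    moreover have "poly (Polynomial.monom 1 f - 1) z = 0" using zf by (simp add: poly_monom)
    ultimately have "complex_subfield (Q.adjoin z)" by (rule Q.complex_subfield_adjoin)
    hence "cyclotomic_field f \<subseteq> Q.adjoin z"
      by (rule cyclotomic_field_minimal) (use Q.adjoin_generator[of z] in \<open>simp add: z_def\<close>)
    then obtain h where h: "h \<in> polys_over \<rat>" "x = poly h z"
      using xK(1) Kf unfolding Q.adjoin_def by blast
    obtain D :: nat where D: "D > 0" "of_nat D * x \<in> U.R"
      using U.clear_denominators[OF h(1)] unfolding ab h(2) by blast
    have "\<exists>r. algebraic_int r \<and> t x - x = U.lam * r"
      using xK KL by (intro U.inertia[OF Lsub aL bL thom ta tcong tR _ xK(2) D]) blast
    thus ?thesis using i(2)[OF xK(1)] by simp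
  qed
  have iter: "\<exists>r. algebraic_int r \<and> s (n * i) x - x = U.lam * r" if x: "x \<in> OK" for x n
  proof (induction n)
    case 0
    show ?case by (intro exI[of _ 0]) auto
  next
    case (Suc n)
    then obtain r where r: "algebraic_int r" "s (n * i) x - x = U.lam * r" by blast
    obtain r' where r': "algebraic_int r'" "s i (s (n * i) x) - s (n * i) x = U.lam * r'"
      using step[OF O_s[OF x, of "n * i"]] by blast
    have "s (Suc n * i) x - x = (s i (s (n * i) x) - s (n * i) x) + (s (n * i) x - x)"
      by (simp add: s_add)
    also have "\<dots> = U.lam * (r' + r)" unfolding r r' by (simp add: distrib_left)
    finally show ?case using r r' by blast
  qed
  have final: "\<exists>r. algebraic_int r \<and> s k x - x = U.lam * r" if x: "x \<in> OK" for x k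
  proof -
    \<comment> \<open>As l is prime, i is invertible modulo l, so each \<open>s k\<close> is an
      iterate of \<open>s i\<close>.\<close>
    have "\<not> l dvd i" using i0 i(1) by (intro nat_dvd_not_less) auto
    hence "coprime i l" using prime_l prime_imp_coprime[of l i] by (simp add: coprime_commute)
    then obtain e where "[i * e = 1] (mod l)" using cong_solve_coprime_nat by fastforce
    hence "[k * (i * e) = k * 1] (mod l)" by (rule cong_scalar_left)
    hence "s ((k * e) * i) x = s k x" using O_subset[OF x] by (intro s_cong) (simp_all add: mult_ac)
    thus ?thesis using iter[OF x, of "k * e"] by simp
  qed
  show thesis
  proof (rule that[of U.lam])
    show "algebraic_int U.lam" by (rule U.R_algebraic_int[OF U.R_lam])
    show "\<exists>r. algebraic_int r \<and> of_nat p = U.lam * r" using U.p_lam U.R_algebraic_int by blast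
    show "\<exists>r. algebraic_int r \<and> U.lam ^ p = of_nat p * r" using U.lam_power_p U.R_algebraic_int by blast
  qed (rule final)
qed

end

section \<open>Total ramification in norm-Euclidean fields\<close>

text \<open>If M clears the denominators of h, then M y is a root of the monic polynomial whose
  coefficients are M^(d-i) times those of h.\<close>

lemma algebraic_int_multiple:
  assumes h: "h \<in> polys_over \<rat>" "lead_coeff h = 1" "poly h y = 0"
  shows "\<exists>M::nat. M > 0 \<and> algebraic_int (of_nat M * y)"
proof -
  obtain M :: nat where M: "M > 0" "\<And>i. of_nat M * coeff h i \<in> \<int>"
    using rational_poly_denominator[OF h(1)] by blast
  define d where "d = degree h"
  define q where "q = (\<Sum>i\<le>d. Polynomial.monom (of_nat M ^ (d - i) * coeff h i) i)"
  have cq: "coeff q j = (if j \<le> d then of_nat M ^ (d - j) * coeff h j else 0)" for j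
    unfolding q_def by (simp add: coeff_sum)
  have "degree q = d"
    by (rule antisym, rule degree_le) (use h(2) in \<open>auto simp: cq d_def intro!: le_degree\<close>)
  hence "lead_coeff q = 1" using h(2) by (simp add: cq d_def)
  moreover have "coeff q j \<in> \<int>" for j
  proof (cases "j < d")
    case True
    hence "coeff q j = of_nat M ^ (d - j - 1) * (of_nat M * coeff h j)"
      unfolding cq by (simp add: power_eq_if)
    thus ?thesis using M(2)[of j] by auto
  qed (use h(2) in \<open>auto simp: cq d_def coeff_eq_0\<close>)
  moreover have "poly q (of_nat M * y) = 0"
  proof -
    have "poly q (of_nat M * y) = (\<Sum>i\<le>d. of_nat M ^ (d - i) * coeff h i * (of_nat M * y) ^ i)"
      unfolding q_def by (simp add: poly_sum poly_monom)
    also have "\<dots> = (\<Sum>i\<le>d. of_nat M ^ d * (coeff h i * y ^ i))"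
    proof (rule sum.cong[OF refl])
      fix i assume "i \<in> {..d}"
      hence "(of_nat M :: complex) ^ d = of_nat M ^ (d - i) * of_nat M ^ i" by (simp flip: power_add)
      thus "of_nat M ^ (d - i) * coeff h i * (of_nat M * y) ^ i = of_nat M ^ d * (coeff h i * y ^ i)"
        by (simp add: power_mult_distrib mult_ac)
    qed
    also have "\<dots> = of_nat M ^ d * poly h y" unfolding poly_altdef d_def by (simp add: sum_distrib_left)
    finally show ?thesis using h(3) by simp
  qed
  ultimately show ?thesis using M(1) by (intro exI[of _ M]) (auto intro: algebraic_int.intros)
qed

lemma (in cyclic_field) \<sigma>_O: "x \<in> OK \<Longrightarrow> \<sigma> x \<in> OK"
  using O_s[of x 1] unfolding s_1 .

lemma (in cyclic_field) ex_irrational_integer: "\<exists>x\<in>OK. x \<notin> \<rat>"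
proof -
  obtain y where y: "y \<in> K" "y \<notin> \<rat>" using K_neq_Rats Rats_closed by blast
  obtain m where m: "Q.is_minpoly y m" using ex_minpoly_degree[OF y] by blast
  obtain M :: nat where M: "M > 0" "algebraic_int (of_nat M * y)"
    using algebraic_int_multiple Q.minpolyD(1-3)[OF m] by blast
  have "of_nat M * y \<notin> \<rat>"
  proof
    assume "of_nat M * y \<in> \<rat>"
    hence "of_nat M * y / of_nat M \<in> \<rat>" by (intro Rats_divide) auto
    thus False using y(2) M(1) by simp
  qed
  thus ?thesis using M y(1) by (intro bexI[of _ "of_nat M * y"]) (auto simp: O_iff)
qed

text \<open>Divisibility in the ring of all algebraic integers, because the divisor 1 - b lies in a
  cyclotomic field and in general not in K.\<close>

definition int_multiple :: "complex \<Rightarrow> complex \<Rightarrow> bool" where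
  "int_multiple a x \<longleftrightarrow> (\<exists>r. algebraic_int r \<and> x = a * r)"

lemma int_multiple_0 [simp]: "int_multiple a 0"
  unfolding int_multiple_def by (intro exI[of _ 0]) auto

lemma int_multiple_add: "int_multiple a x \<Longrightarrow> int_multiple a y \<Longrightarrow> int_multiple a (x + y)"
  unfolding int_multiple_def by (metis algebraic_int_add distrib_left)

lemma int_multiple_diff: "int_multiple a x \<Longrightarrow> int_multiple a y \<Longrightarrow> int_multiple a (x - y)"
  unfolding int_multiple_def by (metis algebraic_int_diff right_diff_distrib)

lemma int_multiple_trans: "int_multiple a (x - y) \<Longrightarrow> int_multiple a (y - z) \<Longrightarrow> int_multiple a (x - z)"
  using int_multiple_add[of a "x - y" "y - z"] by simp

lemma int_multiple_mult: "int_multiple a x \<Longrightarrow> algebraic_int y \<Longrightarrow> int_multiple a (x * y)"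
  unfolding int_multiple_def by (metis algebraic_int_mult mult.assoc)

lemma int_multiple_sum: "(\<And>i. i \<in> I \<Longrightarrow> int_multiple a (g i)) \<Longrightarrow> int_multiple a (sum g I)"
  by (induction I rule: infinite_finite_induct) (auto intro: int_multiple_add)

lemma int_multiple_prod:
  assumes "finite I" "algebraic_int c" "\<And>i. i \<in> I \<Longrightarrow> algebraic_int (g i) \<and> int_multiple a (g i - c)"
  shows "int_multiple a (prod g I - c ^ card I)"
  using assms
proof (induction I rule: finite_induct)
  case (insert i I)
  have "int_multiple a ((g i - c) * prod g I + (prod g I - c ^ card I) * c)"
    using insert by (intro int_multiple_add int_multiple_mult algebraic_int_prod) auto
  thus ?case using insert.hyps by (simp add: algebra_simps)
qed simp

text \<open>From n = lam * r follows n^p = p * (t * r^p), where the second factor is rational and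
  integral, hence an integer.\<close>

lemma int_multiple_prime:
  assumes p: "prime p" and lam: "int_multiple (of_nat p) (lam ^ p)" and n: "int_multiple lam (of_int n)"
  shows "int p dvd n"
proof -
  obtain r t where r: "algebraic_int r" "of_int n = lam * r" and t: "algebraic_int t" "lam ^ p = of_nat p * t"
    using lam n unfolding int_multiple_def by blast
  have p0: "p \<noteq> 0" using p by auto
  have eq: "of_int n ^ p = of_nat p * (t * r ^ p)" unfolding r(2) power_mult_distrib t(2) by simp
  hence "t * r ^ p = of_int n ^ p / of_nat p" using p0 by simp
  hence "t * r ^ p \<in> \<rat>" by simp
  moreover have "algebraic_int (t * r ^ p)" using r t by (intro algebraic_int_mult algebraic_int_power)
  ultimately obtain k where "t * r ^ p = of_int k" using rational_algebraic_int_is_int by (metis Ints_cases)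
  hence "of_int (n ^ p) = (of_int (int p * k) :: complex)" using eq by simp
  hence "n ^ p = int p * k" by (simp only: of_int_eq_iff)
  thus ?thesis using p prime_dvd_power_int[of "int p" n p] by auto
qed

section \<open>Principal ideals and the ramified primes\<close>

locale euclidean_cyclic_field = cyclic_field +
  assumes euclidean: "norm_euclidean K"
begin

lemma division:
  assumes "x \<in> OK" "y \<in> OK" "y \<noteq> 0"
  obtains c where "c \<in> OK" "\<bar>nrm (x - c * y)\<bar> < \<bar>nrm y\<bar>"
proof -
  obtain c where c: "c \<in> OK" "cmod (field_norm K (x - c * y)) < cmod (field_norm K y)"
    using euclidean assms unfolding norm_euclidean_def by blast
  have eq: "cmod (field_norm K z) = of_int \<bar>nrm z\<bar>" if "z \<in> OK" for z
    using that field_norm_eq[OF O_subset[OF that]] by (simp flip: of_int_nrm)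
  have "x - c * y \<in> OK" using c(1) assms by auto
  thus thesis using that[OF c(1)] c(2) eq assms(2) by simp
qed

text \<open>An element of least nonzero norm divides all others by Euclidean division; the single
  closure condition is just what the remainder needs.\<close>

lemma principal:
  assumes I: "I \<subseteq> OK" and closed: "\<And>x y c. x \<in> I \<Longrightarrow> y \<in> I \<Longrightarrow> c \<in> OK \<Longrightarrow> x - c * y \<in> I"
    and ne: "z \<in> I" "z \<noteq> 0"
  obtains g where "g \<in> I" "g \<noteq> 0" "\<And>x. x \<in> I \<Longrightarrow> g dvdO x"
proof -
  define P where "P = (\<lambda>x. x \<in> I \<and> x \<noteq> 0)"
  define g where "g = arg_min (\<lambda>x. nat \<bar>nrm x\<bar>) P"
  have g: "P g" and min: "\<And>x. P x \<Longrightarrow> nat \<bar>nrm g\<bar> \<le> nat \<bar>nrm x\<bar>"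
    using arg_min_nat_lemma[of P z "\<lambda>x. nat \<bar>nrm x\<bar>"] ne unfolding g_def P_def by auto
  have gI: "g \<in> I" "g \<in> OK" "g \<noteq> 0" using g I unfolding P_def by auto
  have "g dvdO x" if x: "x \<in> I" for x
  proof -
    obtain c where c: "c \<in> OK" "\<bar>nrm (x - c * g)\<bar> < \<bar>nrm g\<bar>"
      using division[of x g] x I gI by blast
    have "x - c * g \<in> I" using closed[OF x gI(1) c(1)] .
    hence "x - c * g = 0" using min[of "x - c * g"] c(2) unfolding P_def by fastforce
    thus ?thesis unfolding dvdO_def using c(1) by (intro bexI[of _ c]) (auto simp: mult.commute)
  qed
  thus thesis using that gI by blast
qed

text \<open>The multiples of \<open>lam\<close> in \<open>OK\<close> form an ideal, generated by w.
  Every x is rational modulo it, and it is stable under conjugation because membership depends only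
  on the norm. If |nrm w| = p^j and w^e is the exact power of w in p, norms give l = j * e; what
  remains is to exclude j = l.\<close>

lemma total_ramification:
  assumes cond: "has_conductor K f" and f: "f = p * m" and p: "prime p" and pm: "coprime p m"
    and pl: "coprime p l"
  obtains w where "w \<in> OK" "\<bar>nrm w\<bar> = int p"
    and "\<And>i. \<exists>u\<in>OK. \<bar>nrm u\<bar> = 1 \<and> s i w = w * u"
    and "\<And>x. x \<in> OK \<Longrightarrow> \<exists>c. w dvdO x - of_int c"
    and "\<And>x c. x \<in> OK \<Longrightarrow> w dvdO x - of_int c \<Longrightarrow> int p dvd nrm x - c ^ l"
proof -
  obtain lam where lam: "algebraic_int lam" "int_multiple lam (of_nat p)" "int_multiple (of_nat p) (lam ^ p)"
    and inertia: "\<And>x j. x \<in> OK \<Longrightarrow> int_multiple lam (s j x - x)"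
    using inertia_trivial[OF cond f p pm] unfolding int_multiple_def by blast
  have p0: "p > 0" using p prime_gt_0_nat by blast
  have rational: "int p dvd n" if "int_multiple lam (of_int n)" for n
    using int_multiple_prime[OF p lam(3) that] .
  have multiple: "int_multiple lam (of_int n)" if n: "int p dvd n" for n
  proof -
    obtain k where "n = int p * k" using n by (elim dvdE)
    thus ?thesis using int_multiple_mult[OF lam(2) algebraic_int_of_int[of k]] by simp
  qed
  have alg: "algebraic_int x" if "x \<in> OK" for x using that by (simp add: O_iff)
  have residue: "\<exists>c. int_multiple lam (x - of_int c)" if x: "x \<in> OK" for x
  proof -
    \<comment> \<open>All conjugates of x agree modulo \<open>lam\<close>, so Tr x is l x modulo
      \<open>lam\<close>; dividing by l, which is prime to p, makes x congruent to an
      integer.\<close>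
    obtain t where t: "Tr x = of_int t" using Tr_Ints[OF x] by (elim Ints_cases)
    have "of_int t - of_nat l * x = (\<Sum>i<l. s i x - x)"
      unfolding t[symmetric] Tr_def by (simp add: sum_subtractf)
    hence 1: "int_multiple lam (of_int t - of_nat l * x)"
      using inertia[OF x] by (simp add: int_multiple_sum)
    obtain u v where "u * int l + v * int p = gcd (int l) (int p)" using bezout_int by blast
    moreover have "coprime l p" using pl by (rule coprime_commute[THEN iffD1])
    ultimately have "u * int l + v * int p = 1" by simp
    hence uv: "of_int u * of_nat l + of_int v * of_nat p = (1 :: complex)"
      by (metis of_int_1 of_int_add of_int_mult of_int_of_nat_eq)
    have "x - of_int (u * t) = (of_int u * of_nat l + of_int v * of_nat p) * x - of_int (u * t)"
      unfolding uv by simp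
    also have "\<dots> = of_nat p * (of_int v * x) - (of_int t - of_nat l * x) * of_int u"
      by (simp add: algebra_simps)
    also have "int_multiple lam \<dots>"
      by (rule int_multiple_diff[OF int_multiple_mult[OF lam(2)] int_multiple_mult[OF 1]])
         (use alg[OF x] in auto)
    finally show ?thesis by blast
  qed
  have norm_cong: "int p dvd nrm x - c ^ l" if x: "x \<in> OK" and c: "int_multiple lam (x - of_int c)" for x c
  proof -
    have "int_multiple lam ((\<Prod>i<l. s i x) - of_int c ^ card {..<l})"
    proof (rule int_multiple_prod)
      fix i assume "i \<in> {..<l}"
      show "algebraic_int (s i x) \<and> int_multiple lam (s i x - of_int c)"
        using alg[OF O_s[OF x]] int_multiple_trans[OF inertia[OF x] c] by blast
    qed auto
    hence "int_multiple lam (of_int (nrm x - c ^ l))"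
      using of_int_nrm[OF x] by (simp add: N_def)
    thus ?thesis by (rule rational)
  qed
  have lam_iff: "int_multiple lam x \<longleftrightarrow> int p dvd nrm x" if x: "x \<in> OK" for x
  proof
    assume "int_multiple lam x"
    thus "int p dvd nrm x" using norm_cong[OF x, of 0] l_ge_3 by (simp add: power_0_left)
  next
    assume px: "int p dvd nrm x"
    obtain c where c: "int_multiple lam (x - of_int c)" using residue[OF x] by blast
    have "int p dvd c ^ l" using norm_cong[OF x c] px by (metis dvd_diff_right_iff)
    hence "int p dvd c" using p prime_dvd_power_int[of "int p" c l] by auto
    thus "int_multiple lam x" using int_multiple_add[OF c multiple[of c]] by simp
  qed
  obtain w where w: "w \<in> {x \<in> OK. int_multiple lam x}" "w \<noteq> 0"
    "\<And>x. x \<in> {x \<in> OK. int_multiple lam x} \<Longrightarrow> w dvdO x"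
  proof (rule principal[of "{x \<in> OK. int_multiple lam x}" "of_nat p"])
    fix x y c assume "x \<in> {x \<in> OK. int_multiple lam x}" "y \<in> {x \<in> OK. int_multiple lam x}" "c \<in> OK"
    thus "x - c * y \<in> {x \<in> OK. int_multiple lam x}"
      using int_multiple_diff int_multiple_mult[of lam y c] alg by (auto simp: mult.commute)
  qed (use lam p0 in auto)
  have wO: "w \<in> OK" and wlam: "int_multiple lam w" using w(1) by auto
  have w_dvd: "w dvdO x \<longleftrightarrow> int_multiple lam x" if x: "x \<in> OK" for x
    using w(3)[of x] x wlam alg int_multiple_mult unfolding dvdO_def by auto
  have p_nrm: "int p dvd nrm w" using lam_iff[OF wO] wlam by simp
  have conj: "\<exists>u\<in>OK. \<bar>nrm u\<bar> = 1 \<and> s i w = w * u" for i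
  proof -
    have "int_multiple lam (s i w)" using lam_iff[of "s i w"] p_nrm nrm_s[OF wO] wO by auto
    then obtain u where u: "u \<in> OK" "s i w = w * u"
      using w(3)[of "s i w"] wO unfolding dvdO_def by auto
    have "\<bar>nrm u\<bar> = 1" using nrm_dvd_equal[OF wO w(2) u(1)] u(2) nrm_s[OF wO, of i] by simp
    thus ?thesis using u by blast
  qed
  have w_p: "w dvdO of_nat p" using w_dvd lam(2) by simp
  have "nrm w dvd int p ^ l" using dvdO_nrm[OF w_p wO] by (simp add: nrm_of_nat)
  hence "nat \<bar>nrm w\<bar> dvd p ^ l" by (simp add: nat_abs_dvd_iff)
  then obtain j where "nat \<bar>nrm w\<bar> = p ^ j" using divides_primepow_nat[OF p] by blast
  hence j: "\<bar>nrm w\<bar> = int p ^ j" by (metis abs_ge_zero int_nat_eq of_nat_power)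
  have j0: "j \<noteq> 0"
  proof
    assume "j = 0"
    hence "int p dvd 1" using p_nrm j by (metis dvd_abs_iff power_0)
    thus False using p prime_gt_1_nat[OF p] by simp
  qed
  have p1: "int p > 1" using prime_gt_1_nat[OF p] by simp
  define E where "E = {e. w ^ e dvdO of_nat p}"
  have bound: "j * e \<le> l" if "e \<in> E" for e
  proof -
    have "nrm (w ^ e) dvd int p ^ l"
      using that wO dvdO_nrm[of "w ^ e" "of_nat p"] unfolding E_def by (auto simp: nrm_of_nat)
    hence "\<bar>nrm w\<bar> ^ e dvd int p ^ l" by (simp add: nrm_power[OF wO] flip: power_abs)
    hence "\<bar>nrm w\<bar> ^ e \<le> int p ^ l" by (rule zdvd_imp_le) (use p0 in simp)
    hence "int p ^ (j * e) \<le> int p ^ l" unfolding j by (simp add: power_mult)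
    thus ?thesis using p1 by (simp add: power_le_imp_le_exp)
  qed
  have "E \<subseteq> {..l}"
  proof
    fix e assume "e \<in> E"
    hence "j * e \<le> l" by (rule bound)
    moreover have "e \<le> j * e" using j0 by simp
    ultimately have "e \<le> l" by (rule order_trans[rotated])
    thus "e \<in> {..l}" by simp
  qed
  hence finE: "finite E" using finite_subset by blast
  have "0 \<in> E" unfolding E_def dvdO_def by auto
  \<comment> \<open>By maximality the cofactor z of w^e in p is not divisible by w, so its norm is
    prime to p and, being a divisor of a power of p, is 1 up to sign.\<close>
  define e where "e = Max E"
  have eE: "e \<in> E" unfolding e_def using finE \<open>0 \<in> E\<close> by (intro Max_in) auto
  obtain z where z: "z \<in> OK" "of_nat p = w ^ e * z" using eE unfolding E_def dvdO_def by blast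
  have "\<not> w dvdO z"
  proof
    assume "w dvdO z"
    then obtain z' where "z' \<in> OK" "z = w * z'" unfolding dvdO_def by blast
    hence "Suc e \<in> E" using z unfolding E_def dvdO_def by (auto simp: mult_ac)
    thus False using finE unfolding e_def by (metis Max_ge Suc_n_not_le_n)
  qed
  hence zp: "\<not> int p dvd nrm z" using w_dvd[OF z(1)] lam_iff[OF z(1)] by simp
  have "int p ^ l = nrm (w ^ e) * nrm z"
    using z wO by (metis O_power nrm_mult nrm_of_nat)
  hence "int p ^ l = \<bar>nrm (w ^ e) * nrm z\<bar>" by (metis abs_of_nat of_nat_power)
  hence eq: "int p ^ l = int p ^ (j * e) * \<bar>nrm z\<bar>"
    using j by (simp add: abs_mult nrm_power[OF wO] power_abs power_mult)
  have je: "j * e \<le> l" using bound[OF eE] .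
  have "int p ^ (l - j * e) = \<bar>nrm z\<bar>"
  proof -
    have "int p ^ l = int p ^ (j * e) * int p ^ (l - j * e)" using je by (simp flip: power_add)
    thus ?thesis using eq p0 by simp
  qed
  moreover have "l - j * e = 0"
  proof (rule ccontr)
    assume "l - j * e \<noteq> 0"
    hence "int p dvd int p ^ (l - j * e)" by (simp add: dvd_power)
    thus False using zp calculation by simp
  qed
  ultimately have le: "l = j * e" and z1: "\<bar>nrm z\<bar> = 1" using je by auto
  have "j = 1"
  proof (rule ccontr)
    \<comment> \<open>Here p and w are associates, so each x is an integer c plus p y with y in
      \<open>OK\<close>. Iterating, \<sigma> x - x is divisible by every power of p, which is absurd
      for irrational x.\<close>
    assume "j \<noteq> 1"
    hence e1: "e = 1" using le prime_l prime_product[of j e] by auto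
    have p_dvd: "\<exists>c y. y \<in> OK \<and> x = of_int c + of_nat p * y" if x: "x \<in> OK" for x
    proof -
      obtain c where "int_multiple lam (x - of_int c)" using residue[OF x] by blast
      hence "w dvdO x - of_int c" using w_dvd[of "x - of_int c"] x by auto
      then obtain y where y: "y \<in> OK" "x - of_int c = w * y" unfolding dvdO_def by blast
      have "z \<noteq> 0" using z1 nrm_eq_0_iff[OF z(1)] by auto
      hence "w = of_nat p * inverse z" using z(2) e1 by simp
      hence "x = of_int c + of_nat p * (inverse z * y)" using y(2) by (simp add: algebra_simps)
      thus ?thesis using y(1) nrm_unit[OF z(1) z1] by blast
    qed
    have power: "of_nat p ^ k dvdO \<sigma> x - x" if "x \<in> OK" for x k
      using that
    proof (induction k arbitrary: x)
      case 0
      have "\<sigma> x - x \<in> OK" using \<sigma>_O[OF 0] 0 by auto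
      thus ?case unfolding dvdO_def by auto
    next
      case (Suc k)
      obtain c y where y: "y \<in> OK" "x = of_int c + of_nat p * y" using p_dvd[OF Suc.prems] by blast
      have "\<sigma> x = of_int c + of_nat p * \<sigma> y"
        using O_subset[OF y(1)] unfolding y(2)
        by (simp add: hom_add[OF \<sigma>_hom] hom_mult[OF \<sigma>_hom] hom_of_int[OF \<sigma>_hom] hom_of_nat[OF \<sigma>_hom] mult_closed)
      hence "\<sigma> x - x = of_nat p * (\<sigma> y - y)" unfolding y(2) by (simp add: algebra_simps)
      thus ?case using Suc.IH[OF y(1)] unfolding dvdO_def by (auto simp: mult.assoc)
    qed
    obtain x where x: "x \<in> OK" "x \<notin> \<rat>" using ex_irrational_integer by blast
    define d where "d = \<sigma> x - x"
    have dO: "d \<in> OK" using \<sigma>_O[OF x(1)] x(1) unfolding d_def by auto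
    have "d \<noteq> 0" using fixed_imp_rational[OF O_subset[OF x(1)]] x(2) unfolding d_def by auto
    hence d0: "\<bar>nrm d\<bar> > 0" using nrm_eq_0_iff[OF dO] by simp
    define k where "k = nat \<bar>nrm d\<bar>"
    have "nrm (of_nat p ^ k) dvd nrm d" using power[OF x(1)] unfolding d_def by (intro dvdO_nrm) auto
    hence "(int p ^ l) ^ k dvd \<bar>nrm d\<bar>" by (simp add: nrm_power nrm_of_nat)
    hence "(int p ^ l) ^ k \<le> \<bar>nrm d\<bar>" using d0 by (rule zdvd_imp_le)
    moreover have "p ^ l > 1" using prime_gt_1_nat[OF p] l_ge_3 by (intro one_less_power) auto
    hence "k < (p ^ l) ^ k" by (intro power_gt_expt) auto
    hence "int k < (int p ^ l) ^ k" by (metis of_nat_less_iff of_nat_power)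
    ultimately show False unfolding k_def using d0 by simp
  qed
  hence nw: "\<bar>nrm w\<bar> = int p" using j by simp
  show thesis
  proof (rule that[OF wO nw conj])
    fix x assume x: "x \<in> OK"
    show "\<exists>c. w dvdO x - of_int c" using residue[OF x] w_dvd x by (metis O_diff O_of_int)
    fix c assume "w dvdO x - of_int c"
    thus "int p dvd nrm x - c ^ l" using norm_cong[OF x] w_dvd[of "x - of_int c"] x by auto
  qed
qed

end

section \<open>Units\<close>

lemma coeff_prod_linear_algebraic_int:
  fixes a :: "'a \<Rightarrow> complex"
  assumes "finite I" "\<And>i. i \<in> I \<Longrightarrow> algebraic_int (a i)"
  shows "algebraic_int (coeff (\<Prod>i\<in>I. [:- a i, 1:]) j)"
  using assms
proof (induction I arbitrary: j rule: finite_induct)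
  case empty
  show ?case by (auto simp: coeff_pCons split: nat.splits)
next
  case (insert i I)
  show ?case unfolding prod.insert[OF insert.hyps]
    using insert by (cases j) (auto simp only: coeff_linear_mult insert_iff intro!: algebraic_int_diff algebraic_int_mult algebraic_int_minus)
qed

lemma coeff_prod_linear_bound:
  fixes a :: "'a \<Rightarrow> complex"
  assumes "finite I" "\<And>i. i \<in> I \<Longrightarrow> cmod (a i) \<le> B" "B \<ge> 0"
  shows "cmod (coeff (\<Prod>i\<in>I. [:- a i, 1:]) j) \<le> (1 + B) ^ card I"
  using assms
proof (induction I arbitrary: j rule: finite_induct)
  case empty
  show ?case by (auto simp: coeff_pCons split: nat.splits)
next
  case (insert i I)
  define P where "P = (\<Prod>i\<in>I. [:- a i, 1:])"
  have IH: "cmod (coeff P k) \<le> (1 + B) ^ card I" for k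
    unfolding P_def using insert by auto
  have mult: "cmod (a i * coeff P k) \<le> B * (1 + B) ^ card I" for k
    unfolding norm_mult using insert.prems IH[of k] by (intro mult_mono) auto
  have pos: "0 \<le> (1 + B) ^ card I" using assms(3) by simp
  have "cmod (coeff ([:- a i, 1:] * P) j) \<le> (1 + B) * (1 + B) ^ card I"
  proof (cases j)
    case 0
    show ?thesis unfolding 0 coeff_linear_mult norm_minus_cancel
      using mult[of 0] pos by (simp add: distrib_right)
  next
    case (Suc k)
    have "cmod (coeff P k - a i * coeff P (Suc k)) \<le> cmod (coeff P k) + cmod (a i * coeff P (Suc k))"
      by (rule norm_triangle_ineq4)
    thus ?thesis unfolding Suc coeff_linear_mult
      using mult[of "Suc k"] IH[of k] by (simp add: distrib_right)
  qed
  thus ?case unfolding prod.insert[OF insert.hyps] P_def[symmetric] using insert.hyps by simp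
qed

lemma finite_bounded_polys:
  assumes "finite A"
  shows "finite {p :: complex poly. degree p \<le> n \<and> (\<forall>i. coeff p i \<in> A)}"
proof (rule finite_subset)
  show "{p. degree p \<le> n \<and> (\<forall>i. coeff p i \<in> A)} \<subseteq> Poly ` {xs. set xs \<subseteq> A \<and> length xs \<le> Suc n}"
  proof
    fix p :: "complex poly" assume "p \<in> {p. degree p \<le> n \<and> (\<forall>i. coeff p i \<in> A)}"
    hence p: "degree p \<le> n" "\<And>i. coeff p i \<in> A" by auto
    have "set (coeffs p) \<subseteq> A" using p(2) by (auto simp: coeffs_def)
    moreover have "length (coeffs p) \<le> Suc n" using p(1) by (simp add: coeffs_def)
    ultimately show "p \<in> Poly ` {xs. set xs \<subseteq> A \<and> length xs \<le> Suc n}"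
      by (intro image_eqI[of _ _ "coeffs p"]) auto
  qed
  show "finite (Poly ` {xs. set xs \<subseteq> A \<and> length xs \<le> Suc n})"
    using assms by (intro finite_imageI finite_lists_length_le)
qed

lemma card_le_fibers:
  assumes "finite Y" "\<And>y. y \<in> f ` Y \<Longrightarrow> card {x \<in> Y. f x = y} \<le> S"
  shows "card Y \<le> card (f ` Y) * S"
proof -
  have "Y = (\<Union>y\<in>f ` Y. {x \<in> Y. f x = y})" by auto
  hence "card Y \<le> (\<Sum>y\<in>f ` Y. card {x \<in> Y. f x = y})"
    using card_UN_le[of "f ` Y" "\<lambda>y. {x \<in> Y. f x = y}"] assms(1) by simp
  also have "\<dots> \<le> card (f ` Y) * S" using sum_bounded_above[of "f ` Y", OF assms(2)] by simp
  finally show ?thesis .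
qed

context cyclic_field
begin

lemma l_pos: "l > 0"
  using l_ge_3 by simp

text \<open>Bounds on the conjugates bound the coefficients of the characteristic polynomial; these
  are integers, which leaves finitely many polynomials and so finitely many roots.\<close>

lemma finite_bounded_integers: "finite {x \<in> OK. \<forall>i<l. cmod (s i x) \<le> B}"
proof (cases "B \<ge> 0")
  case False
  have "{x \<in> OK. \<forall>i<l. cmod (s i x) \<le> B} = {}"
    using False l_pos by (auto dest!: spec[of _ 0]) (meson norm_ge_zero order_trans)
  thus ?thesis by (metis finite.emptyI)
next
  case B: True
  define b where "b = \<lceil>(1 + B) ^ l\<rceil>"
  define A :: "complex set" where "A = of_int ` {- b..b}"
  define Q where "Q = {p :: complex poly. degree p \<le> l \<and> (\<forall>i. coeff p i \<in> A)} - {0}"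
  have "finite A" unfolding A_def by simp
  hence "finite Q" unfolding Q_def using finite_bounded_polys by blast
  hence fin: "finite (\<Union>p\<in>Q. {x. poly p x = 0})"
    by (intro finite_UN_I poly_roots_finite) (auto simp: Q_def)
  have "{x \<in> OK. \<forall>i<l. cmod (s i x) \<le> B} \<subseteq> (\<Union>p\<in>Q. {x. poly p x = 0})"
  proof
    fix x assume "x \<in> {x \<in> OK. \<forall>i<l. cmod (s i x) \<le> B}"
    hence x: "x \<in> OK" "\<And>i. i < l \<Longrightarrow> cmod (s i x) \<le> B" by auto
    define P where "P = char_poly_upto l x"
    have deg: "degree P = l" unfolding P_def by (rule degree_char_poly)
    have "coeff P j \<in> A" for j
    proof -
      have "coeff P j \<in> \<rat>"
        using char_poly_rational[OF O_subset[OF x(1)] s_l[OF O_subset[OF x(1)]]]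
        unfolding P_def by (rule Q.coeff_polys_over)
      moreover have "algebraic_int (coeff P j)"
        unfolding P_def char_poly_upto_def
        by (rule coeff_prod_linear_algebraic_int) (use O_s[OF x(1)] in \<open>auto simp: O_iff\<close>)
      ultimately obtain n where n: "coeff P j = of_int n"
        using rational_algebraic_int_is_int by (metis Ints_cases)
      have "cmod (coeff P j) \<le> (1 + B) ^ card {..<l}"
        unfolding P_def char_poly_upto_def
        by (rule coeff_prod_linear_bound) (use x(2) B in auto)
      hence "of_int \<bar>n\<bar> \<le> (1 + B) ^ l" unfolding n by simp
      hence "\<bar>n\<bar> \<le> b" unfolding b_def by linarith
      hence "n \<in> {- b..b}" by auto
      thus ?thesis unfolding A_def n by (rule imageI)
    qed
    moreover have "P \<noteq> 0" using deg l_pos by auto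
    moreover have "poly P x = 0" unfolding P_def char_poly_roots using l_pos by (intro exI[of _ 0]) auto
    ultimately show "x \<in> (\<Union>p\<in>Q. {x. poly p x = 0})" unfolding Q_def using deg by auto
  qed
  thus ?thesis using fin finite_subset by blast
qed

section \<open>Units of norm 1 as a module under sigma - 1\<close>

definition units1 :: "complex set" where
  "units1 = {u \<in> OK. nrm u = 1}"

lemma units1_O: "u \<in> units1 \<Longrightarrow> u \<in> OK"
  and units1_K: "u \<in> units1 \<Longrightarrow> u \<in> K"
  and units1_neq_0: "u \<in> units1 \<Longrightarrow> u \<noteq> 0"
  and units1_1 [simp, intro]: "1 \<in> units1"
  and units1_mult [intro]: "u \<in> units1 \<Longrightarrow> v \<in> units1 \<Longrightarrow> u * v \<in> units1"
  and units1_power [intro]: "u \<in> units1 \<Longrightarrow> u ^ n \<in> units1"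
  and units1_s [intro]: "u \<in> units1 \<Longrightarrow> s i u \<in> units1"
  using nrm_eq_0_iff[of 0]
  by (auto simp: units1_def O_subset nrm_1 nrm_mult nrm_power nrm_s)

lemma units1_inverse [intro]: "u \<in> units1 \<Longrightarrow> inverse u \<in> units1"
proof -
  assume u: "u \<in> units1"
  have i: "inverse u \<in> OK" using nrm_unit[of u] u unfolding units1_def by auto
  have "nrm (u * inverse u) = nrm u * nrm (inverse u)" using i units1_O[OF u] by (rule nrm_mult[rotated])
  thus ?thesis using i u units1_neq_0[OF u] unfolding units1_def by (simp add: nrm_1)
qed

lemma units1_divide [intro]: "u \<in> units1 \<Longrightarrow> v \<in> units1 \<Longrightarrow> u / v \<in> units1"
  unfolding divide_inverse by (intro units1_mult units1_inverse)

lemma units1_prod [intro]: "(\<And>i. i \<in> I \<Longrightarrow> g i \<in> units1) \<Longrightarrow> prod g I \<in> units1"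
  by (induction I rule: infinite_finite_induct) auto

text \<open>The operator \<open>\<sigma> - 1\<close>, written multiplicatively.\<close>

definition T :: "complex \<Rightarrow> complex" where
  "T u = \<sigma> u / u"

lemma T_units1 [intro]: "u \<in> units1 \<Longrightarrow> T u \<in> units1"
  unfolding T_def using units1_s[of u 1] by (intro units1_divide) (auto simp: s_def)

lemma T_mult: "u \<in> units1 \<Longrightarrow> v \<in> units1 \<Longrightarrow> T (u * v) = T u * T v"
  unfolding T_def by (simp add: hom_mult[OF \<sigma>_hom] units1_K)

lemma T_1: "T 1 = 1"
  unfolding T_def by (simp add: hom_1[OF \<sigma>_hom])

lemma T_inverse: "u \<in> units1 \<Longrightarrow> T (inverse u) = inverse (T u)"
  unfolding T_def by (simp add: hom_inverse[OF \<sigma>_hom] units1_K divide_inverse)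

lemma T_power: "u \<in> units1 \<Longrightarrow> T (u ^ n) = T u ^ n"
  unfolding T_def by (simp add: hom_power[OF \<sigma>_hom] units1_K power_divide)

lemma Tn_units1 [intro]: "u \<in> units1 \<Longrightarrow> (T ^^ n) u \<in> units1"
  by (induction n) auto

lemma Tn_mult: "u \<in> units1 \<Longrightarrow> v \<in> units1 \<Longrightarrow> (T ^^ n) (u * v) = (T ^^ n) u * (T ^^ n) v"
  by (induction n) (auto simp: T_mult Tn_units1)

lemma Tn_inverse: "u \<in> units1 \<Longrightarrow> (T ^^ n) (inverse u) = inverse ((T ^^ n) u)"
  by (induction n) (auto simp: T_inverse Tn_units1)

lemma Tn_power: "u \<in> units1 \<Longrightarrow> (T ^^ n) (u ^ k) = (T ^^ n) u ^ k"
  by (induction n) (auto simp: T_power Tn_units1)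

lemma Tn_1: "(T ^^ n) 1 = 1"
  by (induction n) (auto simp: T_1)

text \<open>A unit fixed by \<sigma> is a rational integer n with n^l = 1. As l is odd, n = -1 is
  excluded; restricting to norm 1 is thus what makes \<open>T\<close> injective.\<close>

lemma T_eq_1: "u \<in> units1 \<Longrightarrow> T u = 1 \<Longrightarrow> u = 1"
proof -
  assume u: "u \<in> units1" "T u = 1"
  have "\<sigma> u = u" using u units1_neq_0[OF u(1)] unfolding T_def by simp
  hence "u \<in> \<rat>" using fixed_imp_rational units1_K[OF u(1)] by blast
  hence "u \<in> \<int>" using O_rational[OF units1_O[OF u(1)]] by blast
  then obtain n where n: "u = of_int n" by (elim Ints_cases)
  have "n ^ l = 1" using u(1) unfolding units1_def n by (simp add: nrm_of_int)
  hence "\<bar>n\<bar> ^ l = 1" by (metis abs_1 power_abs)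
  hence "\<bar>n\<bar> = 1" using power_eq_iff_eq_base[OF l_pos, of "\<bar>n\<bar>" 1] by simp
  moreover have "n \<noteq> - 1" using \<open>n ^ l = 1\<close> odd_l by auto
  ultimately show ?thesis using n by auto
qed

lemma T_inj: "u \<in> units1 \<Longrightarrow> v \<in> units1 \<Longrightarrow> T u = T v \<Longrightarrow> u = v"
proof -
  assume uv: "u \<in> units1" "v \<in> units1" "T u = T v"
  have "T (u * inverse v) = 1"
    using uv units1_neq_0[OF T_units1[OF uv(2)]] by (simp add: T_mult T_inverse units1_inverse)
  hence "u * inverse v = 1" by (rule T_eq_1[rotated]) (rule units1_mult[OF uv(1) units1_inverse[OF uv(2)]])
  thus ?thesis using units1_neq_0[OF uv(2)] by (simp add: field_simps)
qed

lemma Tn_eq_1: "u \<in> units1 \<Longrightarrow> (T ^^ n) u = 1 \<Longrightarrow> u = 1"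
  by (induction n) (auto dest: T_eq_1[OF Tn_units1])

text \<open>Writing \<sigma> = 1 + T additively, this is the identity ((1 + T)^n - 1) / T = sum of
  binomial(n, j + 1) T^j.\<close>

lemma prod_s_eq:
  "u \<in> units1 \<Longrightarrow> (\<Prod>i<n. s i u) = (\<Prod>j<n. (T ^^ j) u ^ (n choose Suc j))"
proof (induction n arbitrary: u)
  case (Suc n)
  have \<sigma>u: "\<sigma> u = u * T u" using units1_neq_0[OF Suc.prems] unfolding T_def by simp
  have "(\<Prod>i<Suc n. s i u) = u * (\<Prod>i<n. s i (\<sigma> u))"
    by (subst prod.lessThan_Suc_shift) (simp add: s_Suc')
  also have "(\<Prod>i<n. s i (\<sigma> u)) = (\<Prod>i<n. s i u) * (\<Prod>i<n. s i (T u))"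
    unfolding \<sigma>u prod.distrib[symmetric]
    using units1_K[OF Suc.prems] units1_K[OF T_units1[OF Suc.prems]] by (simp add: hom_mult[OF s_hom])
  also have "u * \<dots> = (\<Prod>j<n. (T ^^ j) u ^ (n choose Suc j)) *
      (u * (\<Prod>j<n. (T ^^ Suc j) u ^ (n choose Suc j)))"
    unfolding Suc.IH[OF Suc.prems] Suc.IH[OF T_units1[OF Suc.prems]]
    by (simp add: funpow_swap1 mult_ac)
  also have "u * (\<Prod>j<n. (T ^^ Suc j) u ^ (n choose Suc j)) = (\<Prod>j<Suc n. (T ^^ j) u ^ (n choose j))"
    by (simp only: prod.lessThan_Suc_shift) simp
  also have "(\<Prod>j<n. (T ^^ j) u ^ (n choose Suc j)) = (\<Prod>j<Suc n. (T ^^ j) u ^ (n choose Suc j))"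
    by (simp add: binomial_eq_0)
  also have "\<dots> * (\<Prod>j<Suc n. (T ^^ j) u ^ (n choose j)) = (\<Prod>j<Suc n. (T ^^ j) u ^ (Suc n choose Suc j))"
    unfolding prod.distrib[symmetric] by (intro prod.cong refl) (simp add: power_add mult_ac)
  finally show ?case .
qed simp

text \<open>On units of norm 1 the operator \<open>(\<sigma> - 1)\<^sup>l\<^sup>-\<^sup>1\<close> is divisible by \<open>l\<close>, since \<open>1 + \<sigma> + \<dots> + \<sigma>\<^sup>l\<^sup>-\<^sup>1\<close>
  acts trivially and is an Eisenstein polynomial in \<open>\<sigma> - 1\<close>.\<close>

lemma eisenstein_relation:
  "\<exists>c :: nat \<Rightarrow> nat. c 0 = 1 \<and>
     (\<forall>u\<in>units1. (\<Prod>j<l - 1. (T ^^ j) u ^ c j) ^ l * (T ^^ (l - 1)) u = 1)"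
proof -
  define c where "c = (\<lambda>j. (l choose Suc j) div l)"
  have c: "l choose Suc j = c j * l" if "j < l - 1" for j
    using dvd_choose_prime[of "Suc j" l] that prime_l l_pos unfolding c_def by auto
  have "(\<Prod>j<l - 1. (T ^^ j) u ^ c j) ^ l * (T ^^ (l - 1)) u = 1" if u: "u \<in> units1" for u
  proof -
    have l: "{..<l} = insert (l - 1) {..<l - 1}" using l_pos by auto
    have "1 = N u" using u of_int_nrm[OF units1_O[OF u]] unfolding units1_def by simp
    also have "\<dots> = (\<Prod>j<l. (T ^^ j) u ^ (l choose Suc j))" unfolding N_def by (rule prod_s_eq[OF u])
    also have "\<dots> = (\<Prod>j<l - 1. (T ^^ j) u ^ (l choose Suc j)) * (T ^^ (l - 1)) u"
      unfolding l using l_pos by (subst prod.insert) auto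
    also have "(\<Prod>j<l - 1. (T ^^ j) u ^ (l choose Suc j)) = (\<Prod>j<l - 1. (T ^^ j) u ^ c j) ^ l"
      unfolding prod_power_distrib by (intro prod.cong refl) (simp add: c power_mult)
    finally show ?thesis by simp
  qed
  moreover have "c 0 = 1" unfolding c_def using l_pos by simp
  ultimately show ?thesis by blast
qed

text \<open>If u^l = 1, \<open>eisenstein_relation\<close> collapses to T^(l-1) u = 1, and
  \<open>T\<close> has trivial kernel.\<close>

lemma units1_root_of_unity: "u \<in> units1 \<Longrightarrow> u ^ l = 1 \<Longrightarrow> u = 1"
proof -
  assume u: "u \<in> units1" "u ^ l = 1"
  obtain c :: "nat \<Rightarrow> nat" where c0: "c 0 = 1"
    and rel: "\<forall>u\<in>units1. (\<Prod>j<l - 1. (T ^^ j) u ^ c j) ^ l * (T ^^ (l - 1)) u = 1"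
    using eisenstein_relation by blast
  note c = rel[rule_format, OF u(1)]
  have "(\<Prod>j<l - 1. (T ^^ j) u ^ c j) ^ l = (\<Prod>j<l - 1. ((T ^^ j) u ^ l) ^ c j)"
    unfolding prod_power_distrib by (intro prod.cong refl) (simp add: mult.commute flip: power_mult)
  also have "\<dots> = 1" using u by (simp add: Tn_power[symmetric] Tn_1)
  finally have "(T ^^ (l - 1)) u = 1" using c by simp
  thus ?thesis using Tn_eq_1 u(1) by blast
qed

text \<open>This solves \<open>eisenstein_relation\<close> for its term j = 0, whose exponent is
  \<open>c 0 = 1\<close>; the other terms have a factor \<open>T\<close> in common.\<close>

lemma power_l_step:
  assumes u: "u \<in> units1"
  shows "\<exists>a\<in>units1. \<exists>b\<in>units1. u ^ l = (T ^^ (l - 1)) a * T (b ^ l)"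
proof -
  obtain c :: "nat \<Rightarrow> nat" where c0: "c 0 = 1"
    and rel: "\<forall>u\<in>units1. (\<Prod>j<l - 1. (T ^^ j) u ^ c j) ^ l * (T ^^ (l - 1)) u = 1"
    using eisenstein_relation by blast
  note c = c0 rel[rule_format, OF u]
  have set: "{..<l - 1} = insert 0 {1..<l - 1}" using l_ge_3 by auto
  define v where "v = (\<Prod>j=1..<l - 1. (T ^^ (j - 1)) u ^ c j)"
  have v: "v \<in> units1" unfolding v_def using u by auto
  have Tv: "T v = (\<Prod>j=1..<l - 1. (T ^^ j) u ^ c j)"
  proof -
    have prodT: "T (\<Prod>j\<in>J. g j) = (\<Prod>j\<in>J. T (g j))" if "finite J" "\<And>j. g j \<in> units1" for J :: "nat set" and g
      using that(1) by induction (auto simp: T_1 T_mult that(2) units1_prod)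
    have "T v = (\<Prod>j=1..<l - 1. T ((T ^^ (j - 1)) u ^ c j))" unfolding v_def
      by (rule prodT) (use u in auto)
    also have "\<dots> = (\<Prod>j=1..<l - 1. (T ^^ j) u ^ c j)"
    proof (intro prod.cong refl)
      fix j assume "j \<in> {1..<l - 1}"
      then obtain i where "j = Suc i" by (cases j) auto
      thus "T ((T ^^ (j - 1)) u ^ c j) = (T ^^ j) u ^ c j" using u by (simp add: T_power Tn_units1)
    qed
    finally show ?thesis .
  qed
  have "u ^ l * T v ^ l * (T ^^ (l - 1)) u = 1"
    using c unfolding set Tv by (simp add: power_mult_distrib)
  moreover have "T v ^ l \<noteq> 0" "(T ^^ (l - 1)) u \<noteq> 0"
    using units1_neq_0[OF T_units1[OF v]] units1_neq_0[OF Tn_units1[OF u]] by auto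
  ultimately have "u ^ l = inverse ((T ^^ (l - 1)) u) * inverse (T v) ^ l"
    by (simp add: field_simps)
  also have "\<dots> = (T ^^ (l - 1)) (inverse u) * T (inverse v ^ l)"
    using u v by (simp only: Tn_inverse T_inverse T_power units1_inverse)
  finally show ?thesis using u v by blast
qed

text \<open>Each use of \<open>power_l_step\<close> pushes the remaining l-th power one
  \<open>T\<close> deeper; after l - 1 rounds it is absorbed. In Z[zeta_l] this is the fact that
  (zeta_l - 1)^(l-1) divides l.\<close>

lemma power_l_in_image:
  assumes u: "u \<in> units1"
  shows "\<exists>w\<in>units1. u ^ l = (T ^^ (l - 1)) w"
proof -
  have "\<exists>a\<in>units1. \<exists>b\<in>units1. u ^ l = (T ^^ (l - 1)) a * (T ^^ k) (b ^ l)" for k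
  proof (induction k)
    case 0
    show ?case using u by (intro bexI[of _ 1] bexI[of _ u]) (auto simp: Tn_1)
  next
    case (Suc k)
    then obtain a b where ab: "a \<in> units1" "b \<in> units1" "u ^ l = (T ^^ (l - 1)) a * (T ^^ k) (b ^ l)" by blast
    obtain a' b' where ab': "a' \<in> units1" "b' \<in> units1" "b ^ l = (T ^^ (l - 1)) a' * T (b' ^ l)"
      using power_l_step[OF ab(2)] by blast
    have "(T ^^ k) (b ^ l) = (T ^^ k) ((T ^^ (l - 1)) a') * (T ^^ k) (T (b' ^ l))"
      unfolding ab'(3) by (rule Tn_mult[OF Tn_units1[OF ab'(1)] T_units1[OF units1_power[OF ab'(2)]]])
    also have "(T ^^ k) ((T ^^ (l - 1)) a') = (T ^^ (l - 1)) ((T ^^ k) a')"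
      by (metis add.commute comp_apply funpow_add)
    also have "(T ^^ k) (T (b' ^ l)) = (T ^^ Suc k) (b' ^ l)" by (simp add: funpow_swap1)
    finally have "u ^ l = (T ^^ (l - 1)) (a * (T ^^ k) a') * (T ^^ Suc k) (b' ^ l)"
      unfolding ab(3) using ab ab' by (simp only: Tn_mult Tn_units1 mult.assoc)
    thus ?case using ab ab' by (intro bexI[of _ "a * (T ^^ k) a'"] bexI[of _ b']) auto
  qed
  then obtain a b where "a \<in> units1" "b \<in> units1" "u ^ l = (T ^^ (l - 1)) a * (T ^^ (l - 1)) (b ^ l)"
    by blast
  hence "u ^ l = (T ^^ (l - 1)) (a * b ^ l)" by (simp only: Tn_mult units1_power)
  thus ?thesis using \<open>a \<in> units1\<close> \<open>b \<in> units1\<close> by blast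
qed

section \<open>Counting units by logarithmic height\<close>

definition log_bounded :: "real \<Rightarrow> complex \<Rightarrow> bool" where
  "log_bounded B u \<longleftrightarrow> (\<forall>i<l. \<bar>ln (cmod (s i u))\<bar> \<le> B)"

lemma cmod_s_pos: "u \<in> units1 \<Longrightarrow> cmod (s i u) > 0"
  using units1_neq_0[OF units1_s[of u i]] by simp

lemma ln_s_mult: "u \<in> units1 \<Longrightarrow> v \<in> units1 \<Longrightarrow> ln (cmod (s i (u * v))) = ln (cmod (s i u)) + ln (cmod (s i v))"
  using cmod_s_pos by (simp add: hom_mult[OF s_hom] units1_K norm_mult ln_mult)

lemma ln_s_power: "u \<in> units1 \<Longrightarrow> ln (cmod (s i (u ^ n))) = real n * ln (cmod (s i u))"
  using cmod_s_pos by (simp add: hom_power[OF s_hom] units1_K norm_power ln_realpow)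

lemma ln_s_inverse: "u \<in> units1 \<Longrightarrow> ln (cmod (s i (inverse u))) = - ln (cmod (s i u))"
  using cmod_s_pos by (simp add: hom_inverse[OF s_hom] units1_K norm_inverse ln_inverse)

lemma sum_ln_s: "u \<in> units1 \<Longrightarrow> (\<Sum>i<l. ln (cmod (s i u))) = 0"
proof -
  assume u: "u \<in> units1"
  have "(\<Sum>i<l. ln (cmod (s i u))) = ln (\<Prod>i<l. cmod (s i u))"
    using cmod_s_pos[OF u] by (subst ln_prod) auto
  also have "(\<Prod>i<l. cmod (s i u)) = cmod (N u)" unfolding N_def by (simp add: prod_norm)
  also have "N u = 1" using u of_int_nrm[OF units1_O[OF u]] unfolding units1_def by simp
  finally show ?thesis by simp
qed

text \<open>The logarithms of units of norm 1 form a lattice in a space of dimension \<open>l - 1\<close>.\<close>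

lemma unit_packing:
  "\<exists>S::nat. \<forall>Y h. finite Y \<and> Y \<subseteq> units1 \<and> (\<forall>u\<in>Y. log_bounded (real h) u) \<longrightarrow>
     card Y \<le> (2 * h + 1) ^ (l - 1) * S"
proof -
  define B where "B = {x \<in> OK. \<forall>i<l. cmod (s i x) \<le> exp (real l)}"
  have finB: "finite B" unfolding B_def by (rule finite_bounded_integers)
  \<comment> \<open>Only l - 1 coordinates are rounded, since the logarithms sum to 0. Two units in
    one cell have a quotient whose first l - 1 logarithms are at most 1 in absolute value, so the
    last is at most l - 1 and the quotient lies in \<open>B\<close>.\<close>
  define F where "F = (\<lambda>u. \<lambda>i\<in>{..<l - 1}. \<lfloor>ln (cmod (s i u))\<rfloor>)"
  have main: "card Y \<le> (2 * h + 1) ^ (l - 1) * card B"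
    if Y: "finite Y" "Y \<subseteq> units1" and bd: "\<And>u. u \<in> Y \<Longrightarrow> log_bounded (real h) u" for Y h
  proof -
    define E where "E = Pi\<^sub>E {..<l - 1} (\<lambda>_. {- int h..int h})"
    have cardE: "card E = (2 * h + 1) ^ (l - 1)"
    proof -
      have "card {- int h..int h} = 2 * h + 1" by (simp add: nat_mult_distrib)
      thus ?thesis unfolding E_def by (simp add: card_PiE)
    qed
    have finE: "finite E" unfolding E_def by (intro finite_PiE) auto
    have "F u \<in> E" if "u \<in> Y" for u
    proof -
      have "\<bar>ln (cmod (s i u))\<bar> \<le> real h" if "i < l - 1" for i
        using bd[OF \<open>u \<in> Y\<close>] that unfolding log_bounded_def by simp
      hence "\<lfloor>ln (cmod (s i u))\<rfloor> \<in> {- int h..int h}" if "i < l - 1" for i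
        using that by (fastforce simp: abs_le_iff le_floor_iff floor_le_iff)
      thus ?thesis unfolding F_def E_def by auto
    qed
    hence sub: "F ` Y \<subseteq> E" by blast
    have "card Y \<le> card (F ` Y) * card B"
    proof (rule card_le_fibers[OF Y(1)])
      fix y assume "y \<in> F ` Y"
      then obtain u where u: "u \<in> Y" "F u = y" by blast
      have uM: "u \<in> units1" using u Y by blast
      have inj: "inj_on (\<lambda>v. v * inverse u) {v \<in> Y. F v = y}"
        using units1_neq_0[OF uM] by (intro inj_onI) simp
      have "(\<lambda>v. v * inverse u) ` {v \<in> Y. F v = y} \<subseteq> B"
      proof (rule image_subsetI)
        fix v assume "v \<in> {v \<in> Y. F v = y}"
        hence v: "v \<in> units1" "F v = F u" using Y u by auto
        define w where "w = v * inverse u"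
        have w: "w \<in> units1" unfolding w_def using v uM by auto
        have small: "\<bar>ln (cmod (s i w))\<bar> \<le> 1" if i: "i < l - 1" for i
        proof -
          have "\<lfloor>ln (cmod (s i v))\<rfloor> = \<lfloor>ln (cmod (s i u))\<rfloor>"
            using fun_cong[OF v(2), of i] i unfolding F_def by simp
          moreover have "ln (cmod (s i w)) = ln (cmod (s i v)) - ln (cmod (s i u))"
            unfolding w_def using v uM by (simp add: ln_s_mult ln_s_inverse units1_inverse)
          ultimately show ?thesis by linarith
        qed
        have "ln (cmod (s i w)) \<le> real l" if "i < l" for i
        proof (cases "i < l - 1")
          case True
          thus ?thesis using small[OF True] l_pos by simp
        next
          case False
          hence i: "i = l - 1" using that by simp
          have set: "{..<l} = insert (l - 1) {..<l - 1}" using l_pos by auto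
          have "ln (cmod (s (l - 1) w)) = - (\<Sum>i<l - 1. ln (cmod (s i w)))"
            using sum_ln_s[OF w] unfolding set by simp
          also have "\<dots> = (\<Sum>i<l - 1. - ln (cmod (s i w)))" by (simp add: sum_negf)
          also have "\<dots> \<le> (\<Sum>i<l - 1. 1)" using small by (intro sum_mono) (auto simp: abs_le_iff)
          finally show ?thesis unfolding i using l_pos by simp
        qed
        hence "cmod (s i w) \<le> exp (real l)" if "i < l" for i
          using that cmod_s_pos[OF w, of i] by (metis exp_le_cancel_iff exp_ln)
        thus "v * inverse u \<in> B" unfolding B_def w_def[symmetric] using units1_O[OF w] by auto
      qed
      thus "card {x \<in> Y. F x = y} \<le> card B" using card_inj_on_le[OF inj _ finB] by blast
    qed
    also have "\<dots> \<le> card E * card B" using card_mono[OF finE sub] by simp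
    finally show ?thesis unfolding cardE .
  qed
  show ?thesis
  proof (intro exI[of _ "card B"] allI impI, elim conjE)
    fix Y h assume "finite Y" "Y \<subseteq> units1" "\<forall>u\<in>Y. log_bounded (real h) u"
    thus "card Y \<le> (2 * h + 1) ^ (l - 1) * card B" by (intro main) auto
  qed
qed

end

section \<open>Uniqueness of the ramified prime\<close>

lemma exponent_eq_of_power_ratio:
  fixes p q :: nat
  assumes "prime p" "prime q" "p \<noteq> q" "x > 0" "y > 0" "a < n" "a' < n"
    and eq: "x ^ n * (p ^ a * q ^ b) = y ^ n * (p ^ a' * q ^ b')"
  shows "a = a'"
proof -
  have pe: "prime_elem p" using assms(1) by simp
  have p0: "p \<noteq> 0" "q \<noteq> 0" using assms by auto
  have val: "multiplicity p (z ^ n * (p ^ c * q ^ d)) = n * multiplicity p z + c" if "z > 0" for z c d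
    using that p0 assms(1-3)
    by (simp add: prime_elem_multiplicity_mult_distrib[OF pe] prime_elem_multiplicity_power_distrib[OF pe]
        multiplicity_distinct_prime_power)
  have "(n * multiplicity p x + a) mod n = (n * multiplicity p y + a') mod n"
    using arg_cong[OF eq, of "multiplicity p"] val assms(4,5) by simp
  thus ?thesis using assms(6,7) by simp
qed

context cyclic_field
begin

text \<open>A multiplicative form of the ambiguous class number formula: \<open>\<sigma>w/w\<close> for the ramified primes \<open>w\<close>
  are independent modulo \<open>(\<sigma> - 1)\<close>-images of units, and two independent classes would produce
  too many units of bounded height.\<close>

lemma ramified_prime_unique:
  assumes p: "prime p" "prime q" "p \<noteq> q"
    and w: "w \<in> OK" "\<bar>nrm w\<bar> = int p" "w \<noteq> 0" "u \<in> OK" "\<sigma> w = w * u"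
    and v: "v \<in> OK" "\<bar>nrm v\<bar> = int q" "v \<noteq> 0" "t \<in> OK" "\<sigma> v = v * t"
  shows False
proof -
  \<comment> \<open>The l^2 monomials \<open>\<theta> d\<close> in the two generators, and the units
    \<open>m d\<close> by which \<sigma> multiplies them, serve as digits below.\<close>
  define D where "D = {..<l} \<times> {..<l}"
  define \<theta> where "\<theta> = (\<lambda>d :: nat \<times> nat. w ^ fst d * v ^ snd d)"
  have \<theta>O: "\<theta> d \<in> OK" for d unfolding \<theta>_def using w v by auto
  have \<theta>0: "\<theta> d \<noteq> 0" for d unfolding \<theta>_def using w v by auto
  have \<theta>nrm: "nat \<bar>nrm (\<theta> d)\<bar> = p ^ fst d * q ^ snd d" for d
    unfolding \<theta>_def using w v by (simp add: nrm_mult nrm_power O_power abs_mult power_abs nat_mult_distrib nat_power_eq)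
  define m where "m = (\<lambda>d. u ^ fst d * t ^ snd d)"
  have \<sigma>\<theta>: "\<sigma> (\<theta> d) = \<theta> d * m d" for d
    using O_subset[OF w(1)] O_subset[OF v(1)] w(5) v(5) unfolding \<theta>_def m_def
    by (simp add: hom_mult[OF \<sigma>_hom] hom_power[OF \<sigma>_hom] power_closed power_mult_distrib mult_ac)
  have mU: "m d \<in> units1" for d
  proof -
    have mO: "m d \<in> OK" unfolding m_def using w v by auto
    have "nrm (\<theta> d) = nrm (\<theta> d) * nrm (m d)"
      using nrm_s[OF \<theta>O, of 1 d] unfolding s_1 \<sigma>\<theta> nrm_mult[OF \<theta>O mO] by simp
    moreover have "nrm (\<theta> d) \<noteq> 0" using nrm_eq_0_iff[OF \<theta>O] \<theta>0 by simp
    ultimately show ?thesis unfolding units1_def using mO by simp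
  qed
  \<comment> \<open>If \<open>m d\<close> and \<open>m d'\<close> differ by T z, then \<theta> d /
    (\<theta> d' z) is fixed by \<sigma>, hence rational. Its norm is an l-th power of a rational
    number, so the exponents of p and q agree modulo l.\<close>
  have separate: "d = d'" if d: "d \<in> D" "d' \<in> D" and z: "z \<in> units1" and eq: "m d = m d' * T z" for d d' z
  proof -
    define y where "y = \<theta> d / (\<theta> d' * z)"
    have K: "\<theta> d \<in> K" "\<theta> d' \<in> K" "z \<in> K" using \<theta>O O_subset units1_K[OF z] by auto
    have z0: "z \<noteq> 0" using units1_neq_0[OF z] .
    have yK: "y \<in> K" unfolding y_def using K by auto
    have "\<sigma> y = \<sigma> (\<theta> d) / (\<sigma> (\<theta> d') * \<sigma> z)"
      unfolding y_def using K by (simp add: hom_divide[OF \<sigma>_hom] hom_mult[OF \<sigma>_hom] mult_closed)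
    also have "\<sigma> z = z * T z" using z0 unfolding T_def by simp
    also have "\<sigma> (\<theta> d) / (\<sigma> (\<theta> d') * (z * T z)) = (\<theta> d * (m d' * T z)) / (\<theta> d' * m d' * (z * T z))"
      unfolding \<sigma>\<theta> eq by simp
    also have "\<dots> = y" unfolding y_def
      using units1_neq_0[OF mU[of d']] units1_neq_0[OF T_units1[OF z]] by simp
    finally have "y \<in> \<rat>" using fixed_imp_rational[OF yK] by blast
    then obtain a b where ab: "b > 0" "y = of_int a / of_int b" by (elim Rats_cases')
    have rel: "of_int b * \<theta> d = of_int a * (\<theta> d' * z)"
      using ab z0 \<theta>0[of d'] unfolding y_def by (simp add: field_simps)
    have "nrm (of_int b * \<theta> d) = nrm (of_int a * (\<theta> d' * z))" unfolding rel ..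
    moreover have "nrm z = 1" using z unfolding units1_def by simp
    ultimately have "b ^ l * nrm (\<theta> d) = a ^ l * nrm (\<theta> d')"
      using \<theta>O units1_O[OF z] by (simp add: nrm_mult nrm_of_int O_mult)
    hence "nat \<bar>b ^ l * nrm (\<theta> d)\<bar> = nat \<bar>a ^ l * nrm (\<theta> d')\<bar>" by simp
    hence eq: "nat \<bar>b\<bar> ^ l * (p ^ fst d * q ^ snd d) = nat \<bar>a\<bar> ^ l * (p ^ fst d' * q ^ snd d')"
      by (simp add: abs_mult power_abs nat_mult_distrib nat_power_eq \<theta>nrm)
    have "a \<noteq> 0"
    proof
      assume "a = 0"
      hence "y = 0" using ab by simp
      thus False unfolding y_def using \<theta>0 z0 by simp
    qed
    hence pos: "nat \<bar>b\<bar> > 0" "nat \<bar>a\<bar> > 0" using ab by auto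
    have "fst d = fst d'"
      by (rule exponent_eq_of_power_ratio[OF p pos _ _ eq]) (use d in \<open>auto simp: D_def\<close>)
    moreover have "snd d = snd d'"
      by (rule exponent_eq_of_power_ratio[OF p(2,1) p(3)[symmetric] pos, of _ l _ "fst d" "fst d'"])
         (use d eq in \<open>auto simp: D_def mult_ac\<close>)
    ultimately show ?thesis by (rule prod_eqI)
  qed
  \<comment> \<open>\<open>V\<close> reads a list as digits in base \<open>T\<close>: m d0 * T (m
    d1) * T (T (m d2)) and so on. By \<open>separate\<close> and injectivity of \<open>T\<close>, n
    digits are determined modulo the n-th image of \<open>T\<close>.\<close>
  define V where "V = (\<lambda>ds. foldr (\<lambda>d x. m d * T x) ds 1)"
  have V_Cons: "V (d # ds) = m d * T (V ds)" for d ds unfolding V_def by simp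
  have V_Nil: "V [] = 1" unfolding V_def by simp
  have VU: "V ds \<in> units1" for ds
    by (induction ds) (use mU in \<open>auto simp: V_Cons V_Nil\<close>)
  have V_inj: "ds = ds'"
    if "length ds = n" "length ds' = n" "set ds \<subseteq> D" "set ds' \<subseteq> D" "z \<in> units1"
      "V ds = V ds' * (T ^^ n) z" for n ds ds' z
    using that
  proof (induction n arbitrary: ds ds')
    case (Suc n)
    obtain d es where ds: "ds = d # es" using Suc.prems(1) by (cases ds) auto
    obtain d' es' where ds': "ds' = d' # es'" using Suc.prems(2) by (cases ds') auto
    have Tz: "(T ^^ n) z \<in> units1" using Suc.prems(5) by auto
    have "m d * T (V es) = m d' * (T (V es') * T ((T ^^ n) z))"
      using Suc.prems(6) unfolding ds ds' V_Cons by (simp add: mult.assoc)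
    also have "T (V es') * T ((T ^^ n) z) = T (V es' * (T ^^ n) z)" using T_mult[OF VU Tz] by simp
    finally have eq: "m d * T (V es) = m d' * T (V es' * (T ^^ n) z)" .
    define x where "x = V es' * (T ^^ n) z * inverse (V es)"
    have xU: "x \<in> units1" unfolding x_def using VU Tz by auto
    have "x * V es = V es' * (T ^^ n) z"
      unfolding x_def using units1_neq_0[OF VU[of es]] by (simp add: mult.assoc)
    hence "T (V es' * (T ^^ n) z) = T x * T (V es)"
      using T_mult[OF xU VU[of es]] by simp
    hence "m d = m d' * T x" using eq units1_neq_0[OF T_units1[OF VU[of es]]] by simp
    hence dd: "d = d'" using separate[OF _ _ xU] Suc.prems(3,4) unfolding ds ds' by simp
    hence "T (V es) = T (V es' * (T ^^ n) z)" using eq units1_neq_0[OF mU[of d']] by simp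
    hence "V es = V es' * (T ^^ n) z" by (rule T_inj[OF VU units1_mult[OF VU Tz]])
    hence "es = es'" using Suc.IH[of es es'] Suc.prems unfolding ds ds' by simp
    thus ?case unfolding ds ds' dd by simp
  qed simp
  define W where "W = {ds. set ds \<subseteq> D \<and> length ds = l - 1}"
  have finD: "finite D" unfolding D_def by simp
  have finW: "finite W" unfolding W_def by (rule finite_lists_length_eq[OF finD])
  have cardW: "card W = (l * l) ^ (l - 1)"
  proof -
    have "card W = card D ^ (l - 1)" unfolding W_def by (rule card_lists_length_eq[OF finD])
    thus ?thesis by (simp add: D_def card_cartesian_product)
  qed
  \<comment> \<open>\<open>Z\<close> reads lists of such words in base l. Words of length l - 1 are
    distinct modulo l-th powers, since these lie in the image of T^(l-1), and l-th roots in
    \<open>units1\<close> are unique.\<close>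
  define Z where "Z = (\<lambda>ws. foldr (\<lambda>ds x. V ds * x ^ l) ws 1)"
  have Z_Cons: "Z (ds # ws) = V ds * Z ws ^ l" for ds ws unfolding Z_def by simp
  have Z_Nil: "Z [] = 1" unfolding Z_def by simp
  have ZU: "Z ws \<in> units1" for ws
    by (induction ws) (use VU in \<open>auto simp: Z_Cons Z_Nil\<close>)
  have Z_inj: "ws = ws'"
    if "length ws = n" "length ws' = n" "set ws \<subseteq> W" "set ws' \<subseteq> W" "Z ws = Z ws'" for n ws ws'
    using that
  proof (induction n arbitrary: ws ws')
    case (Suc n)
    obtain d es where ws: "ws = d # es" using Suc.prems(1) by (cases ws) auto
    obtain d' es' where ws': "ws' = d' # es'" using Suc.prems(2) by (cases ws') auto
    have eq: "V d * Z es ^ l = V d' * Z es' ^ l" using Suc.prems(5) unfolding ws ws' Z_Cons .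
    define x where "x = Z es' * inverse (Z es)"
    have xU: "x \<in> units1" unfolding x_def using ZU by auto
    have xl: "Z es' ^ l = x ^ l * Z es ^ l"
    proof -
      have "x * Z es = Z es'" unfolding x_def using units1_neq_0[OF ZU[of es]] by (simp add: mult.assoc)
      thus ?thesis by (metis power_mult_distrib)
    qed
    have Vd: "V d = V d' * x ^ l"
      using eq units1_neq_0[OF ZU[of es]] unfolding xl by simp
    obtain y where y: "y \<in> units1" "x ^ l = (T ^^ (l - 1)) y" using power_l_in_image[OF xU] by blast
    have "d \<in> W" "d' \<in> W" using Suc.prems(3,4) unfolding ws ws' by auto
    hence dd: "d = d'"
      using Vd unfolding y(2) W_def by (intro V_inj[of d "l - 1" d' y]) (use y in auto)
    hence "x ^ l = 1" using Vd units1_neq_0[OF VU[of d']] by simp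
    hence "x = 1" by (rule units1_root_of_unity[OF xU])
    hence "Z es = Z es'" unfolding x_def using units1_neq_0[OF ZU[of es]] by (simp add: field_simps)
    hence "es = es'" using Suc.IH[of es es'] Suc.prems unfolding ws ws' by simp
    thus ?case unfolding ws ws' dd by simp
  qed simp
  define C where "C = (\<Sum>ds\<in>W. \<Sum>i<l. nat \<lceil>\<bar>ln (cmod (s i (V ds)))\<bar>\<rceil>)"
  have C: "\<bar>ln (cmod (s i (V ds)))\<bar> \<le> real C" if "ds \<in> W" "i < l" for ds i
  proof -
    have "nat \<lceil>\<bar>ln (cmod (s i (V ds)))\<bar>\<rceil> \<le> (\<Sum>i<l. nat \<lceil>\<bar>ln (cmod (s i (V ds)))\<bar>\<rceil>)"
      using that(2) by (intro member_le_sum[of i "{..<l}" "\<lambda>i. nat \<lceil>\<bar>ln (cmod (s i (V ds)))\<bar>\<rceil>"]) auto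
    also have "\<dots> \<le> C" unfolding C_def
      by (rule member_le_sum[OF that(1) _ finW, of "\<lambda>ds. \<Sum>i<l. nat \<lceil>\<bar>ln (cmod (s i (V ds)))\<bar>\<rceil>"]) simp
    finally show ?thesis by linarith
  qed
  \<comment> \<open>Taking l-th powers multiplies logarithms by l, so n digits have height of order
    l^n. The subtracted 1 makes the induction close, because l \<ge> 2.\<close>
  have bound: "\<bar>ln (cmod (s i (Z ws)))\<bar> \<le> real C * (real l ^ length ws - 1)"
    if "set ws \<subseteq> W" "i < l" for ws i
    using that(1)
  proof (induction ws)
    case Nil
    show ?case by (simp add: Z_Nil hom_1[OF s_hom])
  next
    case (Cons ds ws)
    have "ln (cmod (s i (Z (ds # ws)))) = ln (cmod (s i (V ds))) + real l * ln (cmod (s i (Z ws)))"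
      unfolding Z_Cons using VU ZU by (simp add: ln_s_mult ln_s_power units1_power)
    hence "\<bar>ln (cmod (s i (Z (ds # ws))))\<bar> \<le> \<bar>ln (cmod (s i (V ds)))\<bar> + real l * \<bar>ln (cmod (s i (Z ws)))\<bar>"
      by (metis abs_mult abs_of_nat abs_triangle_ineq)
    also have "\<dots> \<le> real C + real l * (real C * (real l ^ length ws - 1))"
      using Cons C[OF _ that(2), of ds] by (intro add_mono mult_left_mono) auto
    also have "\<dots> = real C * (real l ^ length (ds # ws) - 1) - real C * (real l - 2)"
      by (simp add: algebra_simps)
    also have "\<dots> \<le> real C * (real l ^ length (ds # ws) - 1)"
      using l_ge_3 by simp
    finally show ?case .
  qed
  obtain S :: nat where S: "\<forall>Y h. finite Y \<and> Y \<subseteq> units1 \<and> (\<forall>u\<in>Y. log_bounded (real h) u) \<longrightarrow>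
       card Y \<le> (2 * h + 1) ^ (l - 1) * S"
    using unit_packing by blast
  have ineq: "((l * l) ^ (l - 1)) ^ n \<le> ((2 * C + 1) * l ^ n) ^ (l - 1) * S" for n
  proof -
    define ZS where "ZS = {ws. set ws \<subseteq> W \<and> length ws = n}"
    have finZS: "finite ZS" unfolding ZS_def by (rule finite_lists_length_eq[OF finW])
    have cardZS: "card ZS = ((l * l) ^ (l - 1)) ^ n"
      unfolding ZS_def card_lists_length_eq[OF finW] cardW ..
    have "inj_on Z ZS" using Z_inj unfolding ZS_def inj_on_def by blast
    hence "((l * l) ^ (l - 1)) ^ n = card (Z ` ZS)" using card_image cardZS by metis
    also have "\<dots> \<le> (2 * (C * l ^ n) + 1) ^ (l - 1) * S"
    proof (rule S[rule_format], intro conjI ballI)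
      fix y assume "y \<in> Z ` ZS"
      then obtain ws where ws: "set ws \<subseteq> W" "length ws = n" "y = Z ws" unfolding ZS_def by blast
      have "real C * (real l ^ n - 1) \<le> real (C * l ^ n)" by (simp add: algebra_simps)
      thus "log_bounded (real (C * l ^ n)) y"
        unfolding log_bounded_def using bound[OF ws(1)] ws(2,3) by fastforce
    qed (use finZS ZU in auto)
    also have "\<dots> \<le> ((2 * C + 1) * l ^ n) ^ (l - 1) * S"
      using l_pos by (intro mult_right_mono power_mono) (auto simp: algebra_simps)
    finally show ?thesis .
  qed
  \<comment> \<open>There are l^(2 n (l - 1)) words, but packing admits only k * l^(n (l - 1))
    units, so l^(n (l - 1)) \<le> k for all n; n = k refutes this. A single ramified prime would
    halve the first exponent and give no contradiction.\<close>
  define k where "k = (2 * C + 1) ^ (l - 1) * S"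
  have le: "(l ^ n) ^ (l - 1) \<le> k" for n
  proof -
    define L where "L = (l ^ n) ^ (l - 1)"
    have "((l * l) ^ (l - 1)) ^ n = L * L"
      unfolding L_def power_mult_distrib by (simp add: mult.commute flip: power_mult)
    moreover have "((2 * C + 1) * l ^ n) ^ (l - 1) * S = L * k"
      unfolding L_def k_def power_mult_distrib by (simp add: mult_ac)
    ultimately have "L * L \<le> L * k" using ineq[of n] by simp
    moreover have "L > 0" unfolding L_def using l_pos by simp
    ultimately show ?thesis unfolding L_def[symmetric] by simp
  qed
  have "(l ^ k) ^ (l - 1) \<le> k" by (rule le)
  moreover have "k < l ^ k" using l_ge_3 by (intro power_gt_expt) auto
  moreover have "l ^ k \<le> (l ^ k) ^ (l - 1)" using l_ge_3 by (intro self_le_power) auto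
  ultimately show False by simp
qed

end

section \<open>The character and Heilbronn's criterion\<close>

lemma root_of_unity_coprime:
  fixes z :: complex
  assumes "z ^ j = 1" "z ^ l = 1" "coprime j l" "j > 0"
  shows "z = 1"
proof -
  obtain x y where "j * x = l * y + gcd j l" using bezout_nat[of j l] assms(4) by auto
  hence "z ^ (j * x) = z ^ (l * y + 1)" using assms(3) by simp
  thus ?thesis using assms(1,2) by (simp add: power_mult)
qed

section \<open>Primitive characters of prime order\<close>

locale prime_order_character =
  fixes f l :: nat and chi :: "int \<Rightarrow> complex"
  assumes primitive: "primitive_dirichlet_character f chi"
    and order_l: "character_order f chi = l"
    and prime_l: "prime l" and odd_l: "odd l" and coprime_fl: "coprime f l"
begin

lemma f_pos: "f > 0" and chi_mult: "chi (m * n) = chi m * chi n"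
  and chi_period: "chi (n + int f) = chi n" and chi_neq_0: "chi n \<noteq> 0 \<longleftrightarrow> coprime n (int f)"
  using primitive unfolding primitive_dirichlet_character_def dirichlet_character_def by auto

lemma chi_1: "chi 1 = 1"
  using chi_mult[of 1 1] chi_neq_0[of 1] by simp

lemma chi_power: "chi (n ^ k) = chi n ^ k"
  by (induction k) (auto simp: chi_1 chi_mult)

lemma chi_cong: "[m = n] (mod int f) \<Longrightarrow> chi m = chi n"
proof -
  assume "[m = n] (mod int f)"
  then obtain k where k: "m = n + int f * k" by (metis cong_iff_lin cong_sym)
  have nat: "chi (a + int f * int j) = chi a" for a j
  proof (induction j)
    case (Suc j)
    have "chi (a + int f * int (Suc j)) = chi (a + int f * int j + int f)" by (simp add: algebra_simps)
    thus ?case using chi_period Suc by simp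
  qed simp
  show ?thesis
  proof (cases "k \<ge> 0")
    case True
    thus ?thesis using nat[of n "nat k"] k by simp
  next
    case False
    thus ?thesis using nat[of m "nat (- k)"] k by simp
  qed
qed

lemma chi_power_l: "coprime n (int f) \<Longrightarrow> chi n ^ l = 1"
proof -
  assume n: "coprime n (int f)"
  \<comment> \<open>The order is defined by LEAST; Euler's theorem supplies an exponent, so that the
    least one exists and has the defining property.\<close>
  have "chi n ^ totient f = 1" if n: "coprime n (int f)" for n
  proof -
    define a where "a = nat (n mod int f)"
    have a: "int a = n mod int f" unfolding a_def using f_pos by simp
    hence "coprime (int a) (int f)" using n by (simp add: coprime_mod_left_iff f_pos)
    hence "[a ^ totient f = 1] (mod f)" by (intro euler_theorem) simp
    hence "[int a ^ totient f = 1] (mod int f)" by (metis cong_int_iff of_nat_1 of_nat_power)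
    hence "chi (int a ^ totient f) = 1" using chi_cong chi_1 by metis
    moreover have "chi (int a) = chi n" by (rule chi_cong) (simp add: a)
    ultimately show ?thesis by (simp add: chi_power)
  qed
  hence "\<exists>k. k > 0 \<and> (\<forall>n. coprime n (int f) \<longrightarrow> chi n ^ k = 1)"
    using f_pos by (intro exI[of _ "totient f"]) auto
  from LeastI_ex[OF this] show ?thesis
    using n order_l unfolding character_order_def by auto
qed

lemma chi_nontrivial: "\<exists>n. coprime n (int f) \<and> chi n \<noteq> 1"
proof (rule ccontr)
  assume "\<not> ?thesis"
  hence "(LEAST k. k > 0 \<and> (\<forall>n. coprime n (int f) \<longrightarrow> chi n ^ k = 1)) \<le> 1"
    by (intro Least_le) auto
  thus False using order_l prime_gt_1_nat[OF prime_l] unfolding character_order_def by simp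
qed

lemma chi_eq_1_if_power:
  assumes "coprime n (int f)" "chi n ^ k = 1" "coprime k l" "k > 0"
  shows "chi n = 1"
  using root_of_unity_coprime[OF assms(2) chi_power_l[OF assms(1)] assms(3,4)] .

lemma chi_minus_1: "chi (- 1) = 1"
proof -
  have "chi (- 1) ^ 2 = 1" using chi_mult[of "-1" "-1"] chi_1 by (simp add: power2_eq_square)
  thus ?thesis using odd_l by (intro chi_eq_1_if_power[of _ 2]) auto
qed

lemma chi_minus: "chi (- n) = chi n"
  using chi_mult[of "-1" n] chi_minus_1 by simp

lemma chi_abs: "chi \<bar>n\<bar> = chi n"
  by (cases "n \<ge> 0") (auto simp: chi_minus)

text \<open>Suppose p^2 divides f and let d = f / p. Then n = 1 modulo d implies n^p = 1 modulo f,
  so chi n is both a p-th and an l-th root of unity and equals 1, as p differs from l. Hence chi has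
  period d, contradicting primitivity.\<close>

lemma not_square_dvd:
  assumes p: "prime p" and pf: "p dvd f"
  shows "coprime p (f div p)"
proof (rule ccontr)
  assume "\<not> coprime p (f div p)"
  hence pd: "p dvd f div p" using p prime_imp_coprime by blast
  define d where "d = f div p"
  have f: "f = p * d" unfolding d_def using pf by simp
  have d0: "d > 0" using f f_pos by (cases "d = 0") auto
  have p1: "p > 1" using prime_gt_1_nat[OF p] .
  have df: "d < f" using f d0 p1 by simp
  have cop: "coprime n (int f) \<longleftrightarrow> coprime n (int d)" for n
  proof
    assume "coprime n (int d)"
    moreover have "int p dvd int d" using pd unfolding d_def by simp
    ultimately have "coprime n (int p)" by (meson coprime_divisors dvd_refl)
    thus "coprime n (int f)" using \<open>coprime n (int d)\<close> unfolding f by (simp add: coprime_mult_right_iff)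
  qed (simp add: f coprime_mult_right_iff)
  have pl: "coprime p l" using coprime_fl f by (simp add: coprime_mult_left_iff)
  have kernel: "chi n = 1" if n: "[n = 1] (mod int d)" for n
  proof -
    obtain k where k: "n = 1 + int d * k" using n by (metis cong_iff_lin cong_sym)
    have "[n ^ p = 1] (mod int f)"
    proof -
      have "int d dvd n - 1" unfolding k by simp
      have pn: "int p dvd n - 1" using \<open>int d dvd n - 1\<close> pd unfolding d_def by (meson dvd_trans int_dvd_int_iff)
      have "n ^ p - 1 = (n - 1) * (\<Sum>i<p. n ^ i)"
        using power_diff_1_eq[of n p] p1 by simp
      moreover have "int p dvd (\<Sum>i<p. n ^ i)"
      proof -
        have "[n ^ i = 1 ^ i] (mod int p)" for i
          using pn by (intro cong_pow) (simp add: cong_iff_dvd_diff)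
        hence "[(\<Sum>i<p. n ^ i) = (\<Sum>i<p. 1)] (mod int p)" by (intro cong_sum) simp
        thus ?thesis by (simp add: cong_dvd_iff)
      qed
      ultimately have "int d * int p dvd n ^ p - 1"
        using \<open>int d dvd n - 1\<close> by (simp add: mult_dvd_mono)
      thus ?thesis unfolding f cong_iff_dvd_diff by (simp add: mult.commute)
    qed
    hence "chi n ^ p = 1" using chi_cong chi_1 chi_power by metis
    moreover have "coprime n (int f)"
      unfolding cop using n by (metis cong_imp_coprime cong_sym coprime_1_left)
    ultimately show ?thesis using pl p1 by (intro chi_eq_1_if_power[of n p]) auto
  qed
  have "dirichlet_character d chi"
    unfolding dirichlet_character_def
  proof (intro conjI allI)
    fix n
    show "chi (n + int d) = chi n"
    proof (cases "coprime n (int d)")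
      case True
      \<comment> \<open>m inverts both n and n + d modulo d, so both values of chi become 1 on
        multiplication by chi m.\<close>
      then obtain m where m: "[n * m = 1] (mod int d)" using cong_solve_coprime_int by blast
      have "[(n + int d) * m = n * m] (mod int d)" by (simp add: cong_iff_dvd_diff algebra_simps)
      hence m': "[(n + int d) * m = 1] (mod int d)" using m by (rule cong_trans)
      have "chi (n + int d) * chi m = chi n * chi m"
        using kernel[OF m] kernel[OF m'] by (simp add: chi_mult)
      moreover have "chi m \<noteq> 0" using kernel[OF m] by (auto simp: chi_mult)
      ultimately show ?thesis by simp
    next
      case False
      moreover have "\<not> coprime (n + int d) (int d)" using False by (simp add: coprime_iff_gcd_eq_1)
      ultimately show ?thesis using chi_neq_0 cop by metis
    qed
  qed (use d0 chi_mult chi_neq_0 cop in auto)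
  thus False using primitive df unfolding primitive_dirichlet_character_def f
    by (metis dvd_triv_right)
qed

lemma f_gt_1: "f > 1"
proof (rule ccontr)
  assume "\<not> f > 1"
  hence "f = 1" using f_pos by simp
  obtain n where n: "chi n \<noteq> 1" using chi_nontrivial by blast
  have "chi n = chi 1" by (rule chi_cong) (simp add: \<open>f = 1\<close>)
  thus False using n chi_1 by simp
qed

text \<open>The residue group is cyclic and chi is a nontrivial l-th root of unity on a generator g,
  so chi (g^i) = 1 forces l to divide i.\<close>

lemma kernel_is_power:
  assumes f: "prime f" and a: "coprime a (int f)" "chi a = 1"
  shows "\<exists>c. [c ^ l = a] (mod int f)"
proof -
  obtain g where g: "residue_primroot f g" using prime_primitive_root_exists[of f] f f_gt_1 by auto
  have bij: "bij_betw (\<lambda>i. g ^ i mod f) {..<totient f} (totatives f)"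
    using residue_primroot_is_generator[OF f_gt_1 g] .
  have gen: "\<exists>i. [int g ^ i = n] (mod int f)" if n: "coprime n (int f)" for n
  proof -
    define b where "b = nat (n mod int f)"
    have b: "int b = n mod int f" unfolding b_def using f_pos by simp
    have "coprime (int b) (int f)" using n b by (simp add: coprime_mod_left_iff f_pos)
    hence cb: "coprime b f" by simp
    have "b \<noteq> 0"
    proof
      assume "b = 0"
      thus False using cb f_gt_1 by simp
    qed
    moreover have "int b < int f" using b f_pos by simp
    ultimately have "b \<in> totatives f" using cb unfolding totatives_def by simp
    then obtain i where "b = g ^ i mod f" using bij unfolding bij_betw_def by blast
    hence "[int (g ^ i) = int b] (mod int f)" by (simp add: cong_def zmod_int)
    hence "[int g ^ i = n] (mod int f)" using b by (simp add: cong_def)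
    thus ?thesis by blast
  qed
  have cg: "coprime (int g) (int f)" using g by (simp add: residue_primroot_def coprime_commute)
  have chig: "chi (int g) \<noteq> 1"
  proof
    assume g1: "chi (int g) = 1"
    obtain n where n: "coprime n (int f)" "chi n \<noteq> 1" using chi_nontrivial by blast
    obtain i where "[int g ^ i = n] (mod int f)" using gen[OF n(1)] by blast
    hence "chi n = chi (int g) ^ i" using chi_cong chi_power by metis
    thus False using g1 n(2) by simp
  qed
  obtain i where i: "[int g ^ i = a] (mod int f)" using gen[OF a(1)] by blast
  have "chi (int g) ^ i = 1" using chi_cong[OF i] a(2) by (simp add: chi_power)
  have "l dvd i"
  proof (rule ccontr)
    assume "\<not> l dvd i"
    hence "coprime i l" "i > 0" using prime_l prime_imp_coprime[of l i] by (auto simp: coprime_commute intro: Nat.gr0I)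
    thus False using chi_eq_1_if_power[OF cg \<open>chi (int g) ^ i = 1\<close>] chig by blast
  qed
  then obtain j where "i = l * j" by (elim dvdE)
  hence "[(int g ^ j) ^ l = a] (mod int f)" using i by (simp add: mult.commute flip: power_mult)
  thus ?thesis by blast
qed

end

section \<open>Inert primes and norms\<close>

context cyclic_field
begin

lemma cring_O: "cring (field_ring OK)"
proof -
  have "subring OK complex_ring" by (rule C.subringI) auto
  hence "subcring OK complex_ring" by (rule C.subcringI) auto
  thus ?thesis by (subst C.subcring_iff[symmetric]) auto
qed

lemma PIdl_iff: "x \<in> PIdl\<^bsub>field_ring OK\<^esub> a \<longleftrightarrow> a dvdO x"
  unfolding cgenideal_def dvdO_def by (auto simp: mult.commute)

lemma inertD:
  assumes "inert K p"
  shows "prime p" and "x \<in> OK \<Longrightarrow> y \<in> OK \<Longrightarrow> of_nat p dvdO x * y \<Longrightarrow> of_nat p dvdO x \<or> of_nat p dvdO y"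
  using assms primeideal.I_prime[of "PIdl\<^bsub>field_ring OK\<^esub> (of_nat p)" "field_ring OK" x y]
  unfolding inert_def PIdl_iff[symmetric] by auto

lemma inertI:
  assumes p: "prime p"
    and "\<And>x y. x \<in> OK \<Longrightarrow> y \<in> OK \<Longrightarrow> of_nat p dvdO x * y \<Longrightarrow> of_nat p dvdO x \<or> of_nat p dvdO y"
  shows "inert K p"
  unfolding inert_def
proof (intro conjI p primeidealI)
  show "ideal (PIdl\<^bsub>field_ring OK\<^esub> (of_nat p)) (field_ring OK)"
    by (rule cring.cgenideal_ideal[OF cring_O]) simp
  show "cring (field_ring OK)" by (rule cring_O)
  show "carrier (field_ring OK) \<noteq> PIdl\<^bsub>field_ring OK\<^esub> (of_nat p)"
  proof
    assume "carrier (field_ring OK) = PIdl\<^bsub>field_ring OK\<^esub> (of_nat p)"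
    moreover have "1 \<in> carrier (field_ring OK)" by simp
    ultimately have "1 \<in> PIdl\<^bsub>field_ring OK\<^esub> (of_nat p)" by blast
    hence "nrm (of_nat p) dvd nrm 1" using dvdO_nrm[of "of_nat p" 1] unfolding PIdl_iff by simp
    hence "int p ^ l dvd 1" by (simp add: nrm_of_nat nrm_1)
    moreover have "int p ^ l > 1" using prime_gt_1_nat[OF p] l_pos by (intro one_less_power) auto
    ultimately show False by simp
  qed
qed (use assms(2) in \<open>auto simp: PIdl_iff\<close>)

text \<open>Being prime in \<open>OK\<close>, q divides some conjugate of x and hence x itself, so
  even q^l divides the norm.\<close>

lemma inert_square_dvd_nrm:
  assumes q: "inert K q" and x: "x \<in> OK" and dvd: "int q dvd nrm x"
  shows "int (q\<^sup>2) dvd nrm x"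
proof -
  obtain k where k: "nrm x = int q * k" using dvd by (elim dvdE)
  have "(\<Prod>i<l. s i x) = of_nat q * of_int k"
    using of_int_nrm[OF x] unfolding k N_def by simp
  hence "of_nat q dvdO (\<Prod>i<l. s i x)" unfolding dvdO_def by auto
  moreover have "\<exists>i\<in>I. of_nat q dvdO s i x" if "finite I" "I \<noteq> {}" "of_nat q dvdO (\<Prod>i\<in>I. s i x)" for I
    using that
  proof (induction I rule: finite_ne_induct)
    case (insert i I)
    have "of_nat q dvdO s i x * (\<Prod>i\<in>I. s i x)" using insert by simp
    thus ?case using inertD(2)[OF q, of "s i x" "\<Prod>i\<in>I. s i x"] x insert.IH by auto
  qed simp
  ultimately have "\<exists>i\<in>{..<l}. of_nat q dvdO s i x" using l_pos by auto
  then obtain i where i: "i < l" "of_nat q dvdO s i x" by blast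
  have "s (l - i) (of_nat q) dvdO s (l - i) (s i x)" using i by (intro dvdO_s) auto
  hence "of_nat q dvdO x"
    using s_inverse[OF O_subset[OF x], of i] i(1) by (simp add: hom_of_nat[OF s_hom])
  then obtain y where y: "y \<in> OK" "x = of_nat q * y" unfolding dvdO_def by blast
  have "nrm x = int q ^ l * nrm y" unfolding y(2) using y(1) by (simp add: nrm_mult nrm_of_nat)
  moreover have "int q ^ 2 dvd int q ^ l" using l_ge_3 by (intro le_imp_power_dvd) simp
  ultimately show ?thesis by simp
qed

end

section \<open>The character on norms from K\<close>

locale norm_euclidean_setting = euclidean_cyclic_field K l \<sigma> + prime_order_character f l chi
  for K l \<sigma> f chi +
  assumes conductor: "has_conductor K f"
begin

lemma ramification:
  assumes p: "prime p" "p dvd f"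
  shows "\<exists>w. w \<in> OK \<and> \<bar>nrm w\<bar> = int p \<and> (\<exists>u\<in>OK. \<sigma> w = w * u) \<and> (\<forall>x\<in>OK. \<exists>c. w dvdO x - of_int c) \<and>
    (\<forall>x\<in>OK. \<forall>c. w dvdO x - of_int c \<longrightarrow> int p dvd nrm x - c ^ l)"
proof -
  have f: "f = p * (f div p)" using p by simp
  have "coprime p l" using coprime_fl f by (metis coprime_mult_left_iff)
  from total_ramification[OF conductor f p(1) not_square_dvd[OF p] this]
  obtain w where "w \<in> OK" "\<bar>nrm w\<bar> = int p" "\<And>i. \<exists>u\<in>OK. \<bar>nrm u\<bar> = 1 \<and> s i w = w * u"
    "\<And>x. x \<in> OK \<Longrightarrow> \<exists>c. w dvdO x - of_int c"
    "\<And>x c. x \<in> OK \<Longrightarrow> w dvdO x - of_int c \<Longrightarrow> int p dvd nrm x - c ^ l" by metis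
  moreover from this(3)[of 1] have "\<exists>u\<in>OK. \<sigma> w = w * u" unfolding s_1 by blast
  ultimately show ?thesis by blast
qed

lemma prime_conductor: "prime f"
proof -
  obtain p where p: "prime p" "p dvd f" using prime_factor_nat[of f] f_gt_1 by auto
  have f: "f = p * (f div p)" using p by simp
  have "f div p = 1"
  proof (rule ccontr)
    assume "f div p \<noteq> 1"
    then obtain q where q: "prime q" "q dvd f div p" using prime_factor_nat by blast
    have qf: "q dvd f" using q(2) f by (metis dvd_mult)
    have "p \<noteq> q"
    proof
      assume "p = q"
      hence "is_unit p" using not_square_dvd[OF p] q(2) by (metis coprime_common_divisor dvd_refl)
      thus False using p(1) by simp
    qed
    obtain w u where w: "w \<in> OK" "\<bar>nrm w\<bar> = int p" "u \<in> OK" "\<sigma> w = w * u" using ramification[OF p] by blast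
    obtain v t where v: "v \<in> OK" "\<bar>nrm v\<bar> = int q" "t \<in> OK" "\<sigma> v = v * t" using ramification[OF q(1) qf] by blast
    have "w \<noteq> 0" "v \<noteq> 0" using w(1,2) v(1,2) p(1) q(1) nrm_eq_0_iff[of 0] by auto
    thus False using ramified_prime_unique[OF p(1) q(1) \<open>p \<noteq> q\<close> w(1,2) _ w(3,4) v(1,2) _ v(3,4)] by blast
  qed
  thus ?thesis using f p(1) by simp
qed

lemma norm_residue:
  assumes "x \<in> OK"
  shows "\<exists>c. int f dvd nrm x - c ^ l"
  using ramification[OF prime_conductor dvd_refl] assms by blast

text \<open>The totally ramified generator has norm f up to sign, which f^2 does not divide.\<close>

lemma conductor_not_inert: "\<not> inert K f"
proof
  assume "inert K f"
  obtain w where w: "w \<in> OK" "\<bar>nrm w\<bar> = int f" using ramification[OF prime_conductor dvd_refl] by blast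
  have "int f dvd nrm w" using w(2) by (metis dvd_abs_iff dvd_refl)
  hence "int (f\<^sup>2) dvd nrm w" by (rule inert_square_dvd_nrm[OF \<open>inert K f\<close> w(1)])
  hence "int (f\<^sup>2) dvd int f" using w(2) by (metis dvd_abs_iff)
  hence "f * f \<le> f" using f_pos by (auto simp: power2_eq_square dest!: dvd_imp_le simp flip: of_nat_mult)
  thus False using f_gt_1 by simp
qed

text \<open>Let p divide x y but neither factor. The ideal generated by p and x has a generator d of
  norm p^j up to sign, with 0 < j < l. This norm is an l-th power modulo f, so chi(p)^j = 1, and j
  is prime to l.\<close>

lemma chi_not_inert:
  assumes p: "prime p" "p \<noteq> f" "\<not> inert K p"
  shows "chi (int p) = 1"
proof -
  obtain x y where xy: "x \<in> OK" "y \<in> OK" "of_nat p dvdO x * y" "\<not> of_nat p dvdO x" "\<not> of_nat p dvdO y"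
    using inertI[OF p(1)] p(3) by blast
  define I where "I = {of_nat p * a + x * b | a b. a \<in> OK \<and> b \<in> OK}"
  have p0: "of_nat p \<noteq> (0 :: complex)" using p(1) by auto
  have pI: "of_nat p \<in> I"
  proof -
    have "of_nat p = of_nat p * 1 + x * (0 :: complex)" by simp
    thus ?thesis unfolding I_def by blast
  qed
  have xI: "x \<in> I"
  proof -
    have "x = of_nat p * 0 + x * 1" by simp
    thus ?thesis unfolding I_def by blast
  qed
  have closed: "u - c * v \<in> I" if uvc: "u \<in> I" "v \<in> I" "c \<in> OK" for u v c
  proof -
    obtain a b a' b' where ab: "a \<in> OK" "b \<in> OK" "a' \<in> OK" "b' \<in> OK" "u = of_nat p * a + x * b" "v = of_nat p * a' + x * b'"
      using uvc(1,2) unfolding I_def by blast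
    have "u - c * v = of_nat p * (a - c * a') + x * (b - c * b')" unfolding ab by (simp add: algebra_simps)
    moreover have "a - c * a' \<in> OK" "b - c * b' \<in> OK" using ab uvc(3) by auto
    ultimately show ?thesis unfolding I_def by blast
  qed
  have "I \<subseteq> OK" unfolding I_def using xy(1) by auto
  from principal[OF this closed pI p0] obtain d where d: "d \<in> I" "\<And>z. z \<in> I \<Longrightarrow> d dvdO z" by blast
  have dO: "d \<in> OK" using d(1) \<open>I \<subseteq> OK\<close> by blast
  obtain e where e: "e \<in> OK" "of_nat p = d * e" using d(2)[OF pI] unfolding dvdO_def by blast
  have prod: "nrm d * nrm e = int p ^ l"
    using nrm_mult[OF dO e(1)] unfolding e(2)[symmetric] by (simp add: nrm_of_nat)
  hence "nrm d dvd int (p ^ l)" by (metis dvd_triv_left of_nat_power)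
  hence "nat \<bar>nrm d\<bar> dvd p ^ l" by (simp add: nat_abs_dvd_iff)
  then obtain j where "j \<le> l" "nat \<bar>nrm d\<bar> = p ^ j" using divides_primepow_nat[OF p(1)] by blast
  hence j: "j \<le> l" "\<bar>nrm d\<bar> = int p ^ j" by (auto simp: nat_eq_iff)
  \<comment> \<open>If d were a unit, 1 would be a combination of p and x, so y would be one of p y
    and x y and thus divisible by p.\<close>
  have "j \<noteq> 0"
  proof
    assume "j = 0"
    hence inv: "inverse d \<in> OK" using nrm_unit[OF dO] j by simp
    have d0: "d \<noteq> 0" using e(2) p0 by auto
    obtain a b where ab: "a \<in> OK" "b \<in> OK" "d = of_nat p * a + x * b" using d(1) unfolding I_def by blast
    have "y = d * (y * inverse d)" using d0 by simp
    also have "\<dots> = of_nat p * (a * y * inverse d) + (x * y) * (b * inverse d)"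
      by (subst (1) ab(3)) (simp add: algebra_simps)
    finally have y: "y = of_nat p * (a * y * inverse d) + (x * y) * (b * inverse d)" .
    have "of_nat p dvdO of_nat p * (a * y * inverse d) + (x * y) * (b * inverse d)"
      using ab inv xy by (intro dvdO_add dvdO_mult dvdO_refl xy(3)) auto
    thus False using xy(5) y by simp
  qed
  \<comment> \<open>If d were an associate of p, then p would divide x, which lies in the
    ideal.\<close>
  have "j \<noteq> l"
  proof
    assume "j = l"
    have "\<bar>nrm d\<bar> * \<bar>nrm e\<bar> = int p ^ l" using prod by (metis abs_mult abs_of_nat of_nat_power)
    hence "\<bar>nrm e\<bar> = 1" using j \<open>j = l\<close> p0 by simp
    hence inv: "inverse e \<in> OK" by (rule nrm_unit[OF e(1)])
    have "e \<noteq> 0" using e(2) p0 by auto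
    hence "d = of_nat p * inverse e" unfolding e(2) by simp
    hence "of_nat p dvdO d" unfolding dvdO_def using inv by blast
    thus False using dvdO_trans[OF _ d(2)[OF xI]] xy(4) by blast
  qed
  have jl: "coprime j l" "j > 0"
    using \<open>j \<noteq> 0\<close> \<open>j \<noteq> l\<close> j(1) prime_imp_coprime[OF prime_l, of j] nat_dvd_not_less[of j l]
    by (auto simp: coprime_commute)
  have cp: "coprime (int p) (int f)" using p prime_conductor primes_coprime[of p f] by simp
  obtain c where c: "int f dvd nrm d - c ^ l" using norm_residue[OF dO] by blast
  hence cong: "[nrm d = c ^ l] (mod int f)" by (simp add: cong_iff_dvd_diff)
  have "coprime (nrm d) (int f)"
  proof -
    have "coprime \<bar>nrm d\<bar> (int f)" unfolding j using cp by simp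
    thus ?thesis by simp
  qed
  hence "coprime (c ^ l) (int f)" using cong cong_imp_coprime by blast
  hence "coprime c (int f)" using l_pos by simp
  hence "chi (c ^ l) = 1" using chi_power_l chi_power by simp
  hence "chi \<bar>nrm d\<bar> = 1" using chi_cong[OF cong] chi_abs by simp
  hence "chi (int p) ^ j = 1" unfolding j chi_power .
  thus ?thesis using chi_eq_1_if_power[OF cp] jl by blast
qed

lemma heilbronn:
  assumes ab: "f = a + b" "a > 0" "b > 0" and chi: "chi (int a) = 1"
  shows "\<exists>x\<in>OK. \<bar>nrm x\<bar> = int a \<or> \<bar>nrm x\<bar> = int b"
proof -
  have "coprime (int a) (int f)" using chi chi_neq_0 by (metis zero_neq_one)
  then obtain c where c: "[c ^ l = int a] (mod int f)" using kernel_is_power[OF prime_conductor _ chi] by blast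
  obtain w where w: "w \<in> OK" "\<bar>nrm w\<bar> = int f"
    and norm: "\<And>x c. x \<in> OK \<Longrightarrow> w dvdO x - of_int c \<Longrightarrow> int f dvd nrm x - c ^ l"
    using ramification[OF prime_conductor dvd_refl] by blast
  have "w \<noteq> 0" using w nrm_eq_0_iff[of 0] f_pos by auto
  then obtain g where g: "g \<in> OK" "\<bar>nrm (of_int c - g * w)\<bar> < \<bar>nrm w\<bar>"
    using division[of "of_int c" w] w(1) by auto
  define x where "x = of_int c - g * w"
  have xO: "x \<in> OK" unfolding x_def using g w by auto
  have "w dvdO x - of_int c" unfolding x_def dvdO_def using g(1) by (intro bexI[of _ "- g"]) auto
  hence "int f dvd nrm x - c ^ l" by (rule norm[OF xO])
  hence "[nrm x = int a] (mod int f)" using c by (meson cong_iff_dvd_diff cong_trans)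
  hence "nrm x mod int f = int a" using ab by (simp add: cong_def)
  moreover have "\<bar>nrm x\<bar> < int f" using g(2) w(2) unfolding x_def by simp
  \<comment> \<open>The remainder x has norm congruent to a modulo f and smaller than f in absolute
    value, so the norm is a or a - f = -b.\<close>
  ultimately have "nrm x = int a \<or> nrm x = int a - int f"
    by (smt (verit) mod_add_self2 mod_pos_pos_trivial)
  thus ?thesis using xO ab by (intro bexI[of _ x]) auto
qed

lemma heilbronn_inert:
  assumes "f = a + b" "chi (int a) = 1"
    and q: "inert K q" "inert K q'" "q dvd a" "\<not> q\<^sup>2 dvd a" "q' dvd b" "\<not> q'\<^sup>2 dvd b"
  shows False
proof -
  have "a > 0" "b > 0" using q by (auto intro: Nat.gr0I)
  then obtain x where x: "x \<in> OK" "\<bar>nrm x\<bar> = int a \<or> \<bar>nrm x\<bar> = int b"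
    using heilbronn[OF assms(1)] assms(2) by blast
  have no: "\<bar>nrm x\<bar> \<noteq> int c" if "inert K r" "r dvd c" "\<not> r\<^sup>2 dvd c" for r c
  proof
    assume eq: "\<bar>nrm x\<bar> = int c"
    hence "int r dvd nrm x" using that(2) by (metis dvd_abs_iff int_dvd_int_iff)
    hence "int (r\<^sup>2) dvd nrm x" by (rule inert_square_dvd_nrm[OF that(1) x(1)])
    hence "int (r\<^sup>2) dvd int c" using eq by (metis dvd_abs_iff)
    thus False using that(3) by (simp only: int_dvd_int_iff)
  qed
  show False using x(2) no[OF q(1,3,4)] no[OF q(2,5,6)] by blast
qed

end

section \<open>Admissible decompositions of the conductor\<close>

text \<open>These numbers are the denominators of Leibniz's harmonic triangle, where each entry is a
  difference of two neighbours: 1/a = 1/b - 1/c, in the proof a (c - b) = b c. So the lcm times an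
  entry stays an integer along each step in k.\<close>

lemma leibniz_triangle_dvd:
  assumes "n < M" "k \<le> n"
  shows "Suc n * (n choose k) dvd Lcm {1..M}"
  using assms
proof (induction k arbitrary: n)
  case 0
  have "Suc n \<in> {1..M}" using 0 by auto
  thus ?case by (simp add: dvd_Lcm)
next
  case (Suc k)
  obtain m where m: "n = Suc m" using Suc.prems by (cases n) auto
  define a b c where "a = int (Suc n * (n choose Suc k))" and "b = int (Suc m * (m choose k))"
    and "c = int (Suc n * (n choose k))"
  have "b dvd int (Lcm {1..M})" unfolding b_def int_dvd_int_iff
    by (rule Suc.IH) (use Suc.prems m in auto)
  then obtain x where x: "int (Lcm {1..M}) = b * x" by (elim dvdE)
  have "c dvd int (Lcm {1..M})" unfolding c_def int_dvd_int_iff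
    by (rule Suc.IH) (use Suc.prems m in auto)
  then obtain y where y: "int (Lcm {1..M}) = c * y" by (elim dvdE)
  have bk: "b = int (Suc k) * int (n choose Suc k)"
    unfolding b_def m using Suc_times_binomial[of k m] by (metis of_nat_mult)
  have "(n - k) * (n choose k) = Suc k * (n choose Suc k)"
    using binomial_absorb_comp[of n k] binomial_absorption[of k m] unfolding m
    by (metis Suc_times_binomial diff_Suc_1 mult.commute)
  hence nk: "(int n - int k) * int (n choose k) = b"
    unfolding bk using Suc.prems(2) by (metis of_nat_diff of_nat_mult Suc_leD)
  have ak: "a * int (Suc k) = (int n + 1) * b" unfolding a_def bk by (simp add: algebra_simps)
  have ck: "c * (int n - int k) = (int n + 1) * b" unfolding c_def nk[symmetric] by (simp add: algebra_simps)
  have "(a * (c - b)) * (int (Suc k) * (int n - int k)) = (a * int (Suc k)) * (c * (int n - int k) - b * (int n - int k))"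
    by (simp add: algebra_simps)
  also have "\<dots> = (b * (int n + 1) * b) * int (Suc k)" unfolding ak ck by (simp add: algebra_simps)
  also have "\<dots> = (b * c) * (int (Suc k) * (int n - int k))"
    using ck by (simp add: algebra_simps)
  finally have "a * (c - b) = b * c" using Suc.prems(2) by simp
  hence "int (Lcm {1..M}) * (b * c) = int (Lcm {1..M}) * (a * (c - b))" by simp
  also have "\<dots> = a * (x - y) * (b * c)"
    using x y by (simp add: algebra_simps)
  finally have "int (Lcm {1..M}) * (b * c) = a * (x - y) * (b * c)" .
  moreover have "b \<noteq> 0" "c \<noteq> 0" unfolding b_def c_def of_nat_eq_0_iff
    using Suc.prems m by (simp_all add: binomial_eq_0_iff)
  ultimately have "int (Lcm {1..M}) = a * (x - y)" by simp
  hence "a dvd int (Lcm {1..M})" by simp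
  thus ?case unfolding a_def int_dvd_int_iff .
qed

text \<open>Summing (n + 1) binomial(n, k) over k gives (n + 1) 2^n, and each of the n + 1 summands
  divides the lcm.\<close>

lemma Lcm_ge_power_2: "2 ^ n \<le> Lcm {1..Suc n}"
proof -
  define L where "L = Lcm {1..Suc n}"
  have "L \<noteq> 0" unfolding L_def by (subst Lcm_0_iff) auto
  hence pos: "L > 0" by simp
  have "Suc n * 2 ^ n = Suc n * (\<Sum>k\<le>n. n choose k)" by (simp only: choose_row_sum)
  also have "\<dots> = (\<Sum>k\<le>n. Suc n * (n choose k))" by (rule sum_distrib_left)
  also have "\<dots> \<le> (\<Sum>k\<le>n. L)"
    using leibniz_triangle_dvd[of n "Suc n"] pos unfolding L_def by (intro sum_mono dvd_imp_le) auto
  also have "\<dots> = Suc n * L" by simp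
  finally have "2 ^ n \<le> L" by (simp only: mult_le_cancel1)
  thus ?thesis unfolding L_def .
qed

text \<open>Since e < 2.72, a rational lower bound for a logarithm reduces to a comparison of
  powers.\<close>

lemma ln_ge_fraction:
  fixes m a b :: nat
  assumes "(272 / 100) ^ a \<le> (real m) ^ b" "m > 0" "b > 0"
  shows "real a / real b \<le> ln (real m)"
proof -
  have "exp (real a) = exp 1 ^ a" by (simp flip: exp_of_nat_mult)
  also have "\<dots> \<le> (272 / 100) ^ a" using e_less_272 by (intro power_mono) auto
  also have "\<dots> \<le> real m ^ b" by (rule assms(1))
  finally have "real a \<le> ln (real m ^ b)" using assms(2) by (simp add: ln_ge_iff)
  also have "\<dots> = real b * ln (real m)" using assms(2) by (simp add: ln_realpow)
  finally show ?thesis using assms(3) by (simp add: field_simps)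
qed

text \<open>Everything below the least non-divisor n divides k, so its lcm is at most k < q. The
  constant is governed by n = 4, q = 7, where 4 / ln 7 is about 2.056; n = 6 cannot occur since 2
  and 3 would divide k.\<close>

lemma small_nondivisor:
  fixes k q :: nat
  assumes k: "0 < k" "k < q" and q: "q \<ge> 5"
  obtains n where "\<not> n dvd k" "1 < n" "n < q" "real n \<le> 2.1 * ln (real q)"
proof -
  define n where "n = (LEAST n. 0 < n \<and> \<not> n dvd k)"
  have ex: "0 < Suc k \<and> \<not> Suc k dvd k" using k by (auto dest: dvd_imp_le)
  have n: "0 < n" "\<not> n dvd k" unfolding n_def using LeastI[of "\<lambda>n. 0 < n \<and> \<not> n dvd k", OF ex] by auto
  have least: "m dvd k" if "0 < m" "m < n" for m
    using not_less_Least[of m "\<lambda>n. 0 < n \<and> \<not> n dvd k"] that unfolding n_def by blast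
  have n1: "n > 1" using n by (cases "n = 1") auto
  have "n \<le> Suc k" unfolding n_def by (rule Least_le) (rule ex)
  hence "n \<le> q" using k(2) by simp
  have "n \<noteq> q"
  proof
    assume "n = q"
    hence "k = q - 1" using \<open>n \<le> Suc k\<close> k(2) by simp
    moreover have "q - 2 dvd k" by (rule least) (use \<open>n = q\<close> q in auto)
    ultimately have "q - 2 dvd q - 1" by (simp only:)
    hence "q - 2 dvd (q - 1) - (q - 2)" by (rule dvd_diff_nat) (rule dvd_refl)
    moreover have "(q - 1) - (q - 2) = 1" using q by simp
    ultimately have "q - 2 dvd 1" by (simp only:)
    hence "q - 2 \<le> 1" by (rule dvd_imp_le) simp
    thus False using q by simp
  qed
  hence nq: "n < q" using \<open>n \<le> q\<close> by simp
  have mono: "ln (real m) \<le> ln (real q)" if "m \<le> q" "m > 0" for m using that by simp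
  have bound: "real n \<le> 2.1 * ln (real q)"
  proof -
    consider "n \<le> 3" | "n = 4" | "n = 5" | "n = 6" | "n \<ge> 7" by linarith
    thus ?thesis
    proof cases
      case 1
      \<comment> \<open>The fractions 10/7, 40/21 and 50/21 used here and in the next two cases are
        3, 4 and 5 divided by 2.1.\<close>
      have "real 10 / real 7 \<le> ln (real 5)" by (rule ln_ge_fraction) (auto simp: field_simps)
      moreover have "ln (real 5) \<le> ln (real q)" by (rule mono) (use q in auto)
      ultimately show ?thesis using 1 by linarith
    next
      case 2
      have "2 dvd k" "3 dvd k" using least 2 by auto
      hence "2 * 3 dvd k" by (intro divides_mult) auto
      hence "7 \<le> q" using k by (auto dest: dvd_imp_le)
      have "real 40 / real 21 \<le> ln (real 7)" by (rule ln_ge_fraction) (auto simp: field_simps)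
      moreover have "ln (real 7) \<le> ln (real q)" by (rule mono) (use \<open>7 \<le> q\<close> in auto)
      ultimately show ?thesis using 2 by linarith
    next
      case 3
      have "4 dvd k" "3 dvd k" using least 3 by auto
      moreover have "coprime (4::nat) 3" by (simp add: coprime_iff_gcd_eq_1 gcd_non_0_nat)
      ultimately have "4 * 3 dvd k" by (intro divides_mult)
      hence "13 \<le> q" using k by (auto dest: dvd_imp_le)
      have "real 50 / real 21 \<le> ln (real 13)" by (rule ln_ge_fraction) (auto simp: field_simps)
      moreover have "ln (real 13) \<le> ln (real q)" by (rule mono) (use \<open>13 \<le> q\<close> in auto)
      ultimately show ?thesis using 3 by linarith
    next
      case 4
      have "2 dvd k" "3 dvd k" using least 4 by auto
      hence "2 * 3 dvd k" by (intro divides_mult) auto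
      thus ?thesis using n(2) 4 by simp
    next
      case 5
      have "Lcm {1..Suc (n - 2)} dvd k" by (rule Lcm_least) (use least n1 in auto)
      hence "2 ^ (n - 2) \<le> k" using Lcm_ge_power_2[of "n - 2"] k(1) by (auto dest: dvd_imp_le)
      hence "2 ^ (n - 2) \<le> q" using k(2) by simp
      hence "ln (real (2 ^ (n - 2))) \<le> ln (real q)" by (intro mono) auto
      hence "real (n - 2) * ln 2 \<le> ln (real q)" by (simp add: ln_realpow)
      moreover have "real (n - 2) * (2 / 3) \<le> real (n - 2) * ln 2"
        using ln2_ge_two_thirds by (intro mult_left_mono) auto
      ultimately have "(real n - 2) * (2 / 3) \<le> ln (real q)" using 5 by (simp add: of_nat_diff)
      \<comment> \<open>2.1 * (2/3) * (n - 2) = 1.4 n - 2.8, which is at least n exactly when n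
        \<ge> 7.\<close>
      thus ?thesis using 5 by (simp add: field_simps)
    qed
  qed
  show thesis by (rule that[OF n(2) n1 nq bound])
qed

lemma four_not_prime: "\<not> prime (4::nat)"
  using prime_product[of 2 2] by auto

section \<open>Multipliers for the five conditions\<close>

context norm_euclidean_setting
begin

context
  fixes q1 q2 r :: nat
  assumes smallest: "two_smallest_inert K q1 q2"
    and r: "r > 0" "coprime r (q1 * q2)" "chi (int r) = inverse (chi (int q2))"
begin

lemma inert_q: "inert K q1" "inert K q2" "q1 < q2"
  and not_inert: "prime p \<Longrightarrow> p < q2 \<Longrightarrow> p \<noteq> q1 \<Longrightarrow> \<not> inert K p"
  using smallest unfolding two_smallest_inert_def by auto

lemma prime_q: "prime q1" "prime q2"
  using inert_q inertD(1) by auto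

lemma f_neq_q: "f \<noteq> q1" "f \<noteq> q2"
  using inert_q conductor_not_inert by auto

lemma r_coprime: "coprime r q1" "coprime r q2"
  using r(2) by (simp_all add: coprime_mult_right_iff)

text \<open>Primes below q2 other than q1 are not inert, so \<open>chi_not_inert\<close> applies to
  each prime factor; f is kept out because chi vanishes there.\<close>

lemma chi_smooth:
  assumes "k > 0" "\<And>p. prime p \<Longrightarrow> p dvd k \<Longrightarrow> p < q2 \<and> p \<noteq> q1 \<and> p \<noteq> f"
  shows "chi (int k) = 1"
  using assms
proof (induction k rule: less_induct)
  case (less k)
  show ?case
  proof (cases "k = 1")
    case True
    thus ?thesis using chi_1 by simp
  next
    case False
    then obtain p where p: "prime p" "p dvd k" using prime_factor_nat by blast
    then obtain j where j: "k = p * j" by (elim dvdE)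
    have "j > 0" "j < k" using less.prems(1) prime_gt_1_nat[OF p(1)] unfolding j by auto
    hence "chi (int j) = 1" using less.IH[of j] less.prems(2) unfolding j by auto
    moreover have "chi (int p) = 1" using less.prems(2)[OF p] not_inert[OF p(1)] chi_not_inert[OF p(1)] by blast
    ultimately show ?thesis unfolding j by (simp add: chi_mult)
  qed
qed

text \<open>Heilbronn's criterion with a = r q2 k: chi a = chi k = 1, q2 divides a exactly once and
  q1 divides f - a exactly once. Equality in \<open>le\<close> is harmless, since f - a = 0 would
  violate the condition modulo q1^2.\<close>

lemma no_small_multiplier:
  assumes k: "k > 0" "\<And>p. prime p \<Longrightarrow> p dvd k \<Longrightarrow> p < q2 \<and> p \<noteq> q1 \<and> p \<noteq> f"
    and cong: "[r * q2 * k = f] (mod q1)" "\<not> [r * q2 * k = f] (mod q1\<^sup>2)" and le: "r * q2 * k \<le> f"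
  shows False
proof (rule heilbronn_inert[of "r * q2 * k" "f - r * q2 * k" q2 q1])
  have "coprime (int q2) (int f)"
    using primes_coprime[OF prime_q(2) prime_conductor] f_neq_q by simp
  hence "chi (int q2) \<noteq> 0" using chi_neq_0 by blast
  thus "chi (int (r * q2 * k)) = 1" using chi_smooth[OF k] r(3) by (simp add: chi_mult)
  have "\<not> q2 dvd r" using r_coprime(2) prime_q(2) coprime_absorb_right not_prime_unit by blast
  moreover have "\<not> q2 dvd k" using k(2)[OF prime_q(2)] by blast
  ultimately have "\<not> q2 dvd r * k" using prime_q(2) by (simp add: prime_dvd_mult_iff)
  moreover have "q2\<^sup>2 dvd r * q2 * k \<longleftrightarrow> q2 * q2 dvd q2 * (r * k)" by (simp add: power2_eq_square mult_ac)
  ultimately show "\<not> q2\<^sup>2 dvd r * q2 * k" using prime_q(2) by simp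
  show "q1 dvd f - r * q2 * k" using cong(1) le by (simp add: cong_altdef_nat cong_sym_eq)
  show "\<not> q1\<^sup>2 dvd f - r * q2 * k" using cong(2) le by (simp add: cong_altdef_nat cong_sym_eq)
qed (use le inert_q in auto)

lemma base_multiplier:
  obtains k where "0 < k" "k < q1" "[r * q2 * k = f] (mod q1)"
proof -
  have "coprime q2 q1" using primes_coprime[OF prime_q(2,1)] inert_q(3) by simp
  hence "coprime (r * q2) q1" using r_coprime(1) by (simp add: coprime_mult_left_iff)
  then obtain x where x: "[r * q2 * x = 1] (mod q1)" using cong_solve_coprime_nat by fastforce
  define k where "k = (x * f) mod q1"
  have "[r * q2 * k = r * q2 * (x * f)] (mod q1)" unfolding k_def by (intro cong_mult) auto
  also have "r * q2 * (x * f) = (r * q2 * x) * f" by simp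
  also have "[(r * q2 * x) * f = 1 * f] (mod q1)" by (intro cong_mult x) auto
  finally have c: "[r * q2 * k = f] (mod q1)" by simp
  \<comment> \<open>k = 0 would let q1 divide the prime f, but f is not inert and so differs from
    q1.\<close>
  have "k \<noteq> 0"
  proof
    assume "k = 0"
    hence "[f = 0] (mod q1)" using c by (simp add: cong_sym_eq)
    hence "q1 dvd f" by (simp only: cong_0_iff)
    thus False using primes_dvd_imp_eq[OF prime_q(1) prime_conductor] f_neq_q by simp
  qed
  moreover have "k < q1" unfolding k_def using prime_gt_0_nat[OF prime_q(1)] by simp
  ultimately show thesis using that c by blast
qed

lemma cong_square_imp_eq:
  assumes "[r * q2 * k = f] (mod q1\<^sup>2)" "[r * q2 * k' = f] (mod q1\<^sup>2)"
  shows "[k = k'] (mod q1\<^sup>2)"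
proof -
  have "coprime q2 q1" using primes_coprime[OF prime_q(2,1)] inert_q(3) by simp
  hence "coprime (r * q2) (q1\<^sup>2)" using r_coprime(1) by (simp add: coprime_mult_left_iff)
  moreover have "[r * q2 * k = r * q2 * k'] (mod q1\<^sup>2)" using assms cong_sym cong_trans by blast
  ultimately show ?thesis using cong_mult_lcancel_nat by blast
qed

lemma case_1:
  assumes "\<forall>k\<in>{1..q1 - 1}. \<not> [r * q2 * k = f] (mod q1\<^sup>2)" "(q1 - 1) * (q2 * r - 1) \<le> f"
  shows False
proof -
  obtain k where k: "0 < k" "k < q1" "[r * q2 * k = f] (mod q1)" by (rule base_multiplier)
  have q: "q1 \<ge> 2" "q2 \<ge> 3" using prime_ge_2_nat[OF prime_q(1)] inert_q(3) by auto
  have qr: "q2 * r \<ge> 3" using q r(1) mult_le_mono[of 3 q2 1 r] by simp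
  have "(q1 - 1) * 2 \<le> (q1 - 1) * (q2 * r - 1)" using qr by (intro mult_le_mono) auto
  hence "(q1 - 1) * 2 \<le> f" using assms(2) by (rule order_trans)
  hence fq: "q1 \<le> f" using q by linarith
  show False
  proof (rule no_small_multiplier[OF k(1) _ k(3)])
    fix p assume "prime p" "p dvd k"
    thus "p < q2 \<and> p \<noteq> q1 \<and> p \<noteq> f" using dvd_imp_le[of p k] k inert_q(3) fq by simp
  next
    show "\<not> [r * q2 * k = f] (mod q1\<^sup>2)" using assms(1) k by auto
  next
    show "r * q2 * k \<le> f"
    \<comment> \<open>From k \<le> q1 - 1 the product r q2 k exceeds f by at most q1 - 1, yet q1
      divides the excess. This slack is the reason for q2 r - 1 in the hypothesis.\<close>
    proof (rule ccontr)
      assume gt: "\<not> r * q2 * k \<le> f"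
      have "k \<le> q1 - 1" using k(2) by simp
      hence "r * q2 * k \<le> r * q2 * (q1 - 1)" by (rule mult_le_mono2)
      also have "\<dots> = (q1 - 1) * ((q2 * r - 1) + 1)"
      proof -
        have "q2 * r - 1 + 1 = q2 * r" using qr by simp
        thus ?thesis by (simp only: mult_ac)
      qed
      also have "\<dots> = (q1 - 1) * (q2 * r - 1) + (q1 - 1)"
        by (simp only: distrib_left mult_1_right)
      also have "\<dots> \<le> f + (q1 - 1)" using assms(2) by simp
      finally have "r * q2 * k - f < q1" using q by simp
      moreover have "q1 dvd r * q2 * k - f" using k(3) gt by (simp add: cong_altdef_nat)
      ultimately show False using gt by (auto dest: dvd_imp_le)
    qed
  qed
qed

lemma case_3:
  assumes q: "q1 \<notin> {2, 3}" and bd: "2.1 * real q1 * real q2 * real r * ln (real q1) < real f"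
  shows False
proof -
  have "q1 \<noteq> 4" using prime_q(1) four_not_prime by auto
  hence q5: "q1 \<ge> 5" using q prime_ge_2_nat[OF prime_q(1)] by (cases "q1 = 2 \<or> q1 = 3") auto
  have ln1: "ln (real q1) \<ge> 1"
  proof -
    have "exp 1 \<le> (5 :: real)" using e_less_272 by linarith
    hence "exp 1 \<le> real q1" using q5 by linarith
    thus ?thesis using q5 by (simp add: ln_ge_iff)
  qed
  have scaled: "r * q2 * (m * q1) < f" if "real m \<le> 2.1 * ln (real q1)" for m
  proof -
    have "real m * (real q1 * real q2 * real r) \<le> 2.1 * ln (real q1) * (real q1 * real q2 * real r)"
      using that by (intro mult_right_mono) auto
    also have "\<dots> < real f" using bd by (simp add: mult_ac)
    finally have "real (r * q2 * (m * q1)) < real f" by (simp add: mult_ac)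
    thus ?thesis by (simp only: of_nat_less_iff)
  qed
  \<comment> \<open>m = 1 in \<open>scaled\<close> already covers every multiplier below q1 and
    shows q1 < f.\<close>
  have f1: "r * q2 * (1 * q1) < f" using ln1 by (intro scaled) simp
  have "1 * (1 * q1) \<le> r * q2 * (1 * q1)"
    using r(1) prime_gt_0_nat[OF prime_q(2)] by (intro mult_le_mono1) (simp add: Suc_le_eq)
  hence fq: "q1 < f" using f1 by linarith
  obtain k where k: "0 < k" "k < q1" "[r * q2 * k = f] (mod q1)" by (rule base_multiplier)
  have small: "p < q2 \<and> p \<noteq> q1 \<and> p \<noteq> f" if "prime p" "p dvd j" "0 < j" "j < q1" for p j
    using dvd_imp_le[of p j] that inert_q(3) fq by simp
  show False
  proof (cases "[r * q2 * k = f] (mod q1\<^sup>2)")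
    case False
    have "r * q2 * k \<le> r * q2 * (1 * q1)" using k(2) by (intro mult_le_mono2) simp
    hence "r * q2 * k \<le> f" using f1 by linarith
    thus False using no_small_multiplier[OF k(1) _ k(3) False] small k by blast
  next
    case True
    obtain n where n: "\<not> n dvd k" "1 < n" "n < q1" "real n \<le> 2.1 * ln (real q1)"
      using small_nondivisor[OF k(1,2) q5] .
    have "coprime n q1" using prime_imp_coprime[OF prime_q(1), of n] n nat_dvd_not_less[of n q1]
      by (simp add: coprime_commute)
    then obtain x where x: "[n * x = 1] (mod q1)" using cong_solve_coprime_nat by fastforce
    define j where "j = (x * k) mod q1"
    have "[n * j = n * (x * k)] (mod q1)" unfolding j_def by (intro cong_mult) auto
    also have "n * (x * k) = n * x * k" by simp
    also have "[n * x * k = 1 * k] (mod q1)" by (intro cong_mult x) auto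
    finally have nj: "[n * j = k] (mod q1)" by simp
    have j: "j < q1" unfolding j_def using q5 by simp
    have "j \<noteq> 0"
    proof
      assume "j = 0"
      hence "[k = 0] (mod q1)" using nj by (simp add: cong_sym_eq)
      hence "q1 dvd k" by (simp only: cong_0_iff)
      thus False using k by (auto dest: dvd_imp_le)
    qed
    \<comment> \<open>n j and k both lie below q1^2, so congruence modulo q1^2 would mean equality,
      and n does not divide k.\<close>
    have "n * j < q1 * q1" using n(3) j by (intro mult_strict_mono) auto
    hence lt: "n * j < q1\<^sup>2" by (simp add: power2_eq_square)
    have kq: "k < q1\<^sup>2" using k(2) q5 self_le_power[of q1 2] by simp
    show False
    proof (rule no_small_multiplier[of "n * j"])
      show "0 < n * j" using n(2) \<open>j \<noteq> 0\<close> by simp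
      fix p assume p: "prime p" "p dvd n * j"
      hence "p dvd n \<or> p dvd j" by (simp add: prime_dvd_mult_iff)
      thus "p < q2 \<and> p \<noteq> q1 \<and> p \<noteq> f" using small[OF p(1)] n j \<open>j \<noteq> 0\<close> by auto
    next
      have "[r * q2 * (n * j) = r * q2 * k] (mod q1)" using nj by (rule cong_scalar_left)
      thus "[r * q2 * (n * j) = f] (mod q1)" using k(3) by (rule cong_trans)
    next
      show "\<not> [r * q2 * (n * j) = f] (mod q1\<^sup>2)"
      proof
        assume "[r * q2 * (n * j) = f] (mod q1\<^sup>2)"
        hence "[n * j = k] (mod q1\<^sup>2)" using True cong_square_imp_eq by blast
        hence "n * j = k" using lt kq by (rule cong_less_modulus_unique_nat)
        thus False using n(1) by auto
      qed
    next
      have "r * q2 * (n * j) \<le> r * q2 * (n * q1)" using j by (intro mult_le_mono2) simp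
      thus "r * q2 * (n * j) \<le> f" using scaled[OF n(4)] by linarith
    qed
  qed
qed

text \<open>The multipliers are 1 and 3, congruent modulo 2 but not modulo 4, so at least one of
  them passes the test modulo 4. As q2 > 3, the prime 3 is not inert.\<close>

lemma case_4:
  assumes q: "q1 = 2" "q2 \<noteq> 3" and bd: "3 * q2 * r < f"
  shows False
proof -
  have q5: "q2 > 3" using inert_q(3) q by simp
  have "3 * q2 * 1 \<le> 3 * q2 * r" using r(1) by (intro mult_le_mono2) simp
  hence f3: "f > 3" using bd q5 by linarith
  have le: "r * q2 * j \<le> f" if "j \<le> 3" for j
  proof -
    have "r * q2 * j \<le> r * q2 * 3" using that by (rule mult_le_mono2)
    also have "\<dots> = 3 * q2 * r" by simp
    finally show ?thesis using bd by linarith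
  qed
  obtain k where k: "0 < k" "k < q1" "[r * q2 * k = f] (mod q1)" by (rule base_multiplier)
  have k1: "k = 1" using k q by simp
  have small: "p < q2 \<and> p \<noteq> q1 \<and> p \<noteq> f" if "prime p" "p dvd 3" for p
  proof -
    have "p = 3" using primes_dvd_imp_eq[OF that(1) _ that(2)] by simp
    thus ?thesis using q5 q f3 by simp
  qed
  show False
  proof (cases "[r * q2 * 1 = f] (mod q1\<^sup>2)")
    case False
    show False by (rule no_small_multiplier[OF _ _ _ False]) (use k k1 le[of 1] in auto)
  next
    case True
    show False
    proof (rule no_small_multiplier[of 3])
      have "[r * q2 * 3 = r * q2 * 1] (mod q1)" unfolding q by (intro cong_scalar_left) (simp add: cong_def)
      thus "[r * q2 * 3 = f] (mod q1)" using k(3) unfolding k1 by (rule cong_trans)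
      show "\<not> [r * q2 * 3 = f] (mod q1\<^sup>2)"
      proof
        assume "[r * q2 * 3 = f] (mod q1\<^sup>2)"
        hence "[3 = 1] (mod q1\<^sup>2)" using True cong_square_imp_eq by blast
        thus False unfolding q by (simp add: cong_def)
      qed
    qed (use small le in auto)
  qed
qed

text \<open>The multipliers k and k + 3 with k = 1 or 2 agree modulo 3 but not modulo 9. Their prime
  factors are 2 and 5, neither of which is inert since q2 > 5.\<close>

lemma case_5:
  assumes q: "q1 = 3" "q2 \<noteq> 5" and bd: "5 * q2 * r < f"
  shows False
proof -
  have "q2 \<noteq> 4" using prime_q(2) four_not_prime by auto
  hence q5: "q2 > 5" using inert_q(3) q by simp
  have "5 * q2 * 1 \<le> 5 * q2 * r" using r(1) by (intro mult_le_mono2) simp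
  hence f5: "f > 5" using bd q5 by linarith
  obtain k where k: "0 < k" "k < q1" "[r * q2 * k = f] (mod q1)" by (rule base_multiplier)
  have k12: "k = 1 \<or> k = 2" using k q by auto
  have small: "p < q2 \<and> p \<noteq> q1 \<and> p \<noteq> f" if "prime p" "p dvd j" "j \<in> {1, 2, 4, 5}" for p j
  proof -
    have "p \<le> 5" using that dvd_imp_le[of p j] by auto
    moreover have "p \<noteq> 3" using that by auto
    ultimately show ?thesis using q5 q f5 by simp
  qed
  have le: "r * q2 * j \<le> f" if "j \<le> 5" for j
  proof -
    have "r * q2 * j \<le> r * q2 * 5" using that by (rule mult_le_mono2)
    also have "\<dots> = 5 * q2 * r" by simp
    finally show ?thesis using bd by linarith
  qed
  show False
  proof (cases "[r * q2 * k = f] (mod q1\<^sup>2)")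
    case False
    show False by (rule no_small_multiplier[OF k(1) _ k(3) False], rule small[where j = k]) (use k12 le[of k] in auto)
  next
    case True
    show False
    proof (rule no_small_multiplier[of "k + 3"])
      have "[r * q2 * (k + 3) = r * q2 * k] (mod q1)" unfolding q by (intro cong_scalar_left) (simp add: cong_def)
      thus "[r * q2 * (k + 3) = f] (mod q1)" using k(3) by (rule cong_trans)
      show "\<not> [r * q2 * (k + 3) = f] (mod q1\<^sup>2)"
      proof
        assume "[r * q2 * (k + 3) = f] (mod q1\<^sup>2)"
        hence "[k + 3 = k] (mod q1\<^sup>2)" using True cong_square_imp_eq by blast
        thus False using k12 unfolding q by (auto simp: cong_def)
      qed
      fix p assume "prime p" "p dvd k + 3"
      thus "p < q2 \<and> p \<noteq> q1 \<and> p \<noteq> f" using small[of p "k + 3"] k12 by auto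
    qed (use le[of "k + 3"] k12 in auto)
  qed
qed

end

end

theorem theorem3p1:
  fixes K :: "complex set" and l f q1 q2 :: nat and chi :: "int \<Rightarrow> complex"
  assumes "prime l" and "odd l"
    and "number_field_of_degree K l" and "galois_over_rat K"
    and "has_conductor K f" and "coprime f l"
    and "primitive_dirichlet_character f chi" and "character_order f chi = l"
    and "two_smallest_inert K q1 q2"
    and "\<exists>r::nat. r > 0 \<and> coprime r (q1 * q2) \<and> chi (int r) = inverse (chi (int q2)) \<and>
      ((\<forall>k\<in>{1..q1 - 1}. \<not> [r * q2 * k = f] (mod q1\<^sup>2)) \<and> (q1 - 1) * (q2 * r - 1) \<le> f
       \<or> q1 \<notin> {2, 3} \<and> 3 * real q1 * real q2 * real r * ln (real q1) < real f
       \<or> q1 \<notin> {2, 3, 7} \<and> 2.1 * real q1 * real q2 * real r * ln (real q1) < real f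
       \<or> q1 = 2 \<and> q2 \<noteq> 3 \<and> 3 * q2 * r < f
       \<or> q1 = 3 \<and> q2 \<noteq> 5 \<and> 5 * q2 * r < f)"
  shows "\<not> norm_euclidean K"
proof
  assume euclidean: "norm_euclidean K"
  interpret prime_degree_field K l
    using assms(1-3) by unfold_locales
  obtain x where x: "x \<in> K" "x \<notin> \<rat>" using K_neq_Rats Rats_closed by blast
  \<comment> \<open>The fixed field is the rationals, so some automorphism moves the irrational
    x.\<close>
  then obtain \<sigma> where \<sigma>: "\<sigma> \<in> ring_iso (field_ring K) (field_ring K)" "\<sigma> x \<noteq> x"
    using assms(4) unfolding galois_over_rat_def by blast
  interpret norm_euclidean_setting K l \<sigma> f chi
    using \<sigma> x assms euclidean by unfold_locales blast+
  obtain r where r: "r > 0" "coprime r (q1 * q2)" "chi (int r) = inverse (chi (int q2))"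
    and cases: "(\<forall>k\<in>{1..q1 - 1}. \<not> [r * q2 * k = f] (mod q1\<^sup>2)) \<and> (q1 - 1) * (q2 * r - 1) \<le> f
       \<or> q1 \<notin> {2, 3} \<and> 3 * real q1 * real q2 * real r * ln (real q1) < real f
       \<or> q1 \<notin> {2, 3, 7} \<and> 2.1 * real q1 * real q2 * real r * ln (real q1) < real f
       \<or> q1 = 2 \<and> q2 \<noteq> 3 \<and> 3 * q2 * r < f
       \<or> q1 = 3 \<and> q2 \<noteq> 5 \<and> 5 * q2 * r < f"
    using assms(10) by blast
  note ctx = assms(9) r
  have "q1 > 0" using prime_gt_0_nat[OF prime_q(1)[OF ctx]] .
  \<comment> \<open>As ln q1 \<ge> 0, the bound with 3 implies the bound with 2.1, so
    \<open>case_3\<close> settles both logarithmic conditions.\<close>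
  hence "2.1 * real q1 * real q2 * real r * ln (real q1) \<le> 3 * real q1 * real q2 * real r * ln (real q1)"
    by (intro mult_right_mono) auto
  thus False
    using cases case_1[OF ctx] case_3[OF ctx] case_4[OF ctx] case_5[OF ctx] by fastforce
qed

end
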